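(* Let $d\ge 1$ and $p\in(0,1)$, and consider the $d$-dimensional East model on $\mathbb{Z}^d$ with parameter $p$. For any probability measure $\nu$ on $\{0,1\}^{\mathbb{Z}^d}$ satisfying Condition $(\mathcal{C})$, there exist constants $\chi=\chi(p)>0$, $c_1=c_1(p,\nu)>0$ and $C_1=C_1(p,\nu)>0$ such that for every $t\ge 0$ and every function $f:\{0,1\}^{\mathbb{Z}^d}\to\mathbb{R}$ with $\mathrm{supp}(f)\subset\Lambda(\chi t^{1/d})$, \[ \int_{\{0,1\}^{\mathbb{Z}^d}}\left|\mathbb{E}_\eta(f(\eta_t))-\mu(f)\right|\,\mathrm{d}\nu(\eta)\le C_1\|f\|_\infty e^{-c_1 t}. \]
   Context: Let $e_1,\dots,e_d$ be the canonical basis of $\mathbb{R}^d$ and $p\in(0,1)$. The East model on $\mathbb{Z}^d$ is the following continuous-time process $(\eta_t)_{t\ge0}$ on $\{0,1\}^{\mathbb{Z}^d}$: independently for each site $x\in\mathbb{Z}^d$, let $(B_{x,n})_{n\ge1}$ be i.i.d. Bernoulli$(p)$ variables and $0=t_{x,0}<t_{x,1}<t_{x,2}<\dots$ times whose increments $t_{x,n}-t_{x,n-1}$ are i.i.d. exponential of parameter 1, independent of the $B$'s. At time $t_{x,n}$, if there exists $i\in\{1,\dots,d\}$ with $\eta_{t_{x,n}}(x-e_i)=0$ (state just before the time $t_{x,n}$), the spin at $x$ is replaced by $B_{x,n}$ (an "update at $x$"); otherwise nothing happens. $\mathbb{P}_\eta,\mathbb{E}_\eta$ denote law and expectation of the process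 started from $\eta$. $\mu$ is the product Bernoulli$(p)$ measure on $\{0,1\}^{\mathbb{Z}^d}$ and $\mu(f)$ the expectation of $f$ under $\mu$. For $f:\{0,1\}^{\mathbb{Z}^d}\to\mathbb{R}$ and $\Lambda'\subset\mathbb{Z}^d$, $\mathrm{supp}(f)\subset\Lambda'$ means $f(\eta)=f(\eta')$ whenever $\eta,\eta'$ coincide on $\Lambda'$; $\|f\|_\infty=\sup_\eta|f(\eta)|$. For $r\ge0$, $\Lambda(r)=\left(\prod_{i=1}^d\{0,\dots,\lfloor r\rfloor\}\right)\setminus\{(0,\dots,0)\}$. A measure $\nu$ on $\{0,1\}^{\mathbb{Z}^d}$ satisfies Condition $(\mathcal{C})$ if there exist $a,A>0$ such that for all $\ell\ge0$, $\nu\left(\forall x\in\{-\lfloor\ell\rfloor,\dots,0\}^d,\ \eta(x)=1\right)\le Ae^{-a\ell}$. *)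

theory Defs
  imports "HOL-Probability.Probability"
begin

(* Sites of Z^d are functions 'd => int, with 'd a finite type of cardinality d.
   Configurations are ('d => int) => bool, True standing for spin 1. *)

type_synonym 'd site = "'d \<Rightarrow> int"
type_synonym 'd config = "'d site \<Rightarrow> bool"

definition shift_down :: "'d site \<Rightarrow> 'd \<Rightarrow> 'd site" where
  "shift_down x i = x(i := x i - 1)"

(* Clock/coin space: omega (x, k) = (k+1-th exponential increment at x, B_{x,k+1}) *)
definition east_clocks :: "real \<Rightarrow> ('d site \<times> nat \<Rightarrow> real \<times> bool) measure" where
  "east_clocks p = (\<Pi>\<^sub>M _\<in>UNIV. density lborel (exponential_density 1) \<Otimes>\<^sub>M measure_pmf (bernoulli_pmf p))"

definition ring_time :: "('d site \<times> nat \<Rightarrow> real \<times> bool) \<Rightarrow> 'd site \<Rightarrow> nat \<Rightarrow> real" where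
  "ring_time \<omega> x n = (\<Sum>k<n. fst (\<omega> (x, k)))"

(* B_{x,n} for n >= 1 *)
definition coin :: "('d site \<times> nat \<Rightarrow> real \<times> bool) \<Rightarrow> 'd site \<Rightarrow> nat \<Rightarrow> bool" where
  "coin \<omega> x n = snd (\<omega> (x, n - 1))"

definition rings_before :: "('d site \<times> nat \<Rightarrow> real \<times> bool) \<Rightarrow> 'd site \<Rightarrow> real \<Rightarrow> nat" where
  "rings_before \<omega> x s = card {m. 1 \<le> m \<and> ring_time \<omega> x m < s}"

definition rings_upto :: "('d site \<times> nat \<Rightarrow> real \<times> bool) \<Rightarrow> 'd site \<Rightarrow> real \<Rightarrow> nat" where
  "rings_upto \<omega> x s = card {m. 1 \<le> m \<and> ring_time \<omega> x m \<le> s}"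

(* v x n = spin at x right after its n-th clock ring (v x 0 = initial spin).
   Graphical construction of the East dynamics. *)
definition east_solution ::
  "'d config \<Rightarrow> ('d site \<times> nat \<Rightarrow> real \<times> bool) \<Rightarrow> ('d site \<Rightarrow> nat \<Rightarrow> bool) \<Rightarrow> bool" where
  "east_solution \<eta> \<omega> v \<longleftrightarrow>
     (\<forall>x. v x 0 = \<eta> x) \<and>
     (\<forall>x n. v x (Suc n) =
        (if (\<exists>i. \<not> v (shift_down x i) (rings_before \<omega> (shift_down x i) (ring_time \<omega> x (Suc n))))
         then coin \<omega> x (Suc n) else v x n))"

(* eta_t as a function of the clocks (defined whenever the graphical construction
   has a unique solution, which holds almost surely) *)
definition east_config :: "'d config \<Rightarrow> real \<Rightarrow> ('d site \<times> nat \<Rightarrow> real \<times> bool) \<Rightarrow> 'd config" where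
  "east_config \<eta> t \<omega> =
     (if \<exists>!v. east_solution \<eta> \<omega> v
      then (\<lambda>x. (THE v. east_solution \<eta> \<omega> v) x (rings_upto \<omega> x t))
      else \<eta>)"

definition east_expect :: "real \<Rightarrow> 'd config \<Rightarrow> real \<Rightarrow> ('d config \<Rightarrow> real) \<Rightarrow> real" where
  "east_expect p \<eta> t f = (\<integral>\<omega>. f (east_config \<eta> t \<omega>) \<partial>completion (east_clocks p))"

definition bern_prod :: "real \<Rightarrow> 'd config measure" where
  "bern_prod p = (\<Pi>\<^sub>M _\<in>UNIV. measure_pmf (bernoulli_pmf p))"

definition config_space :: "'d config measure" where
  "config_space = (\<Pi>\<^sub>M _\<in>UNIV. count_space UNIV)"

definition supp_in :: "('d config \<Rightarrow> real) \<Rightarrow> 'd site set \<Rightarrow> bool" where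
  "supp_in f L \<longleftrightarrow> (\<forall>\<eta> \<eta>'. (\<forall>x\<in>L. \<eta> x = \<eta>' x) \<longrightarrow> f \<eta> = f \<eta>')"

definition sup_norm :: "('d config \<Rightarrow> real) \<Rightarrow> real" where
  "sup_norm f = (SUP \<eta>. \<bar>f \<eta>\<bar>)"

definition Lam :: "real \<Rightarrow> 'd site set" where
  "Lam r = {x. \<forall>i. 0 \<le> x i \<and> x i \<le> \<lfloor>r\<rfloor>} - {(\<lambda>_. 0)}"

definition condition_C :: "'d config measure \<Rightarrow> bool" where
  "condition_C \<nu> \<longleftrightarrow> (\<exists>a A. a > 0 \<and> A > 0 \<and> (\<forall>l::real. l \<ge> 0 \<longrightarrow>
      measure \<nu> {\<eta>. \<forall>x. (\<forall>i. - \<lfloor>l\<rfloor> \<le> x i \<and> x i \<le> 0) \<longrightarrow> \<eta> x} \<le> A * exp (- a * l)))"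

end

theory Submission
  imports Defs
begin

text \<open>Fix a zero \<open>y\<close> of the initial configuration in the negative box of side \<open>\<epsilon> t\<close>, which fails to exist only
  with \<open>\<nu>\<close>-probability \<open>A e\<^sup>-\<^sup>a\<^sup>\<epsilon>\<^sup>t\<close>. Resampling the sites of the support one at a time bounds the integrand by
  a multiple of the sum over \<open>x\<close> in the support of the probability that \<open>x\<close> is not updated before time \<open>t\<close>.
  For given clock rings, this probability is a completely alternating functional of the history of the facilitating
  zeros, which allows it to be passed down a path from \<open>x\<close> to \<open>y\<close>, at the cost of a factor \<open>1 / p\<close> for each
  site, and then down all paths of length \<open>k\<close> from the distinguished zero \<open>y\<close>. Up to an error
  \<open>p\<^sup>k\<close>, what remains at the end of a path is the probability that in a one-dimensional East chain
  in equilibrium the last site is never zero at the rings of its child. The spectral gap of the chain, uniform in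
  its length, makes this decay like \<open>e\<^sup>-\<^sup>\<kappa>\<^sup>t\<close>. Taking \<open>k\<close> and the box small multiples of \<open>t\<close>, the decay
  wins over the \<open>d\<^sup>k\<close> paths and over the factors \<open>1 / p\<close>.\<close>

section \<open>Completely alternating functionals and the one-site kernel\<close>

text \<open>The dynamics is not attractive: an additional zero permits updates that may remove other
  zeros. Accordingly the kernel of one site does not preserve decreasing functionals, because
  facilitating a ring changes the expectation by an averaged second difference of the functional,
  weighted by \<open>p * (1 - p)\<close>. The class \<open>CM\<close> fixes the signs of all mixed
  differences and is closed under the kernel. It is the cone spanned by the indicators that a given
  set of positions carries no \<open>True\<close>. The factor \<open>1 / p\<close> pays for an
  unknown initial spin. Paid along \<open>k\<close> further sites, it would use up the gain
  \<open>p ^ k\<close>. A site known to start from zero costs nothing: its first legal update gives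
  it an equilibrium spin and exhibits a zero among its parents. Which parent this is depends on the
  coins, so all paths have to be considered. The unknown history at the end of a path is compared
  with a permanent zero; the error shrinks by a factor \<open>p\<close> per site, since a site that
  is never facilitated is itself a permanent zero with probability \<open>1 - p\<close>. The
  permanent zero is what gives the remaining chain its spectral gap.\<close>

text \<open>A function of lists of length \<open>n\<close>, seen as a set function of the positions carrying \<open>True\<close>, all of whose
  alternating differences of order at most one in every coordinate are nonnegative.\<close>

fun CM :: "nat \<Rightarrow> (bool list \<Rightarrow> real) \<Rightarrow> bool" where
  "CM 0 \<Phi> = (0 \<le> \<Phi> [])"
| "CM (Suc n) \<Phi> = (CM n (\<lambda>A. \<Phi> (True # A)) \<and> CM n (\<lambda>A. \<Phi> (False # A) - \<Phi> (True # A)))"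

lemma CM_cong: "(\<And>A. length A = n \<Longrightarrow> \<Phi> A = \<Psi> A) \<Longrightarrow> CM n \<Phi> \<longleftrightarrow> CM n \<Psi>"
proof (induction n arbitrary: \<Phi> \<Psi>)
  case (Suc n)
  have "CM n (\<lambda>A. \<Phi> (True # A)) \<longleftrightarrow> CM n (\<lambda>A. \<Psi> (True # A))"
    "CM n (\<lambda>A. \<Phi> (False # A) - \<Phi> (True # A)) \<longleftrightarrow> CM n (\<lambda>A. \<Psi> (False # A) - \<Psi> (True # A))"
    using Suc.prems by (intro Suc.IH; simp)+
  then show ?case by simp
qed simp

lemma CM_zero: "CM n (\<lambda>_. 0)"
  by (induction n) auto

lemma CM_add: "CM n \<Phi> \<Longrightarrow> CM n \<Psi> \<Longrightarrow> CM n (\<lambda>A. \<Phi> A + \<Psi> A)"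
proof (induction n arbitrary: \<Phi> \<Psi>)
  case (Suc n)
  have "CM n (\<lambda>A. (\<Phi> (False # A) - \<Phi> (True # A)) + (\<Psi> (False # A) - \<Psi> (True # A)))"
    using Suc.prems by (intro Suc.IH) auto
  then show ?case using Suc by (simp add: algebra_simps)
qed simp

lemma CM_scale: "CM n \<Phi> \<Longrightarrow> 0 \<le> c \<Longrightarrow> CM n (\<lambda>A. c * \<Phi> A)"
proof (induction n arbitrary: \<Phi>)
  case (Suc n)
  have "CM n (\<lambda>A. c * (\<Phi> (False # A) - \<Phi> (True # A)))"
    using Suc.prems by (intro Suc.IH) auto
  then show ?case using Suc by (simp add: algebra_simps)
qed simp

lemma CM_nonneg: "CM n \<Phi> \<Longrightarrow> length A = n \<Longrightarrow> 0 \<le> \<Phi> A"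
proof (induction n arbitrary: \<Phi> A)
  case (Suc n)
  then obtain a A' where A: "A = a # A'" "length A' = n" by (metis length_Suc_conv)
  have "0 \<le> \<Phi> (True # A')" "0 \<le> \<Phi> (False # A') - \<Phi> (True # A')"
    using Suc.IH[of "\<lambda>A. \<Phi> (True # A)" A'] Suc.IH[of "\<lambda>A. \<Phi> (False # A) - \<Phi> (True # A)" A'] Suc.prems A by auto
  then show ?case using A by (cases a) auto
qed simp

lemma CM_antimono:
  "CM n \<Phi> \<Longrightarrow> length B = n \<Longrightarrow> list_all2 (\<longrightarrow>) A B \<Longrightarrow> \<Phi> B \<le> \<Phi> A"
proof (induction n arbitrary: \<Phi> A B)
  case (Suc n)
  then obtain b B' where B: "B = b # B'" "length B' = n" by (metis length_Suc_conv)
  with Suc.prems obtain a A' where A: "A = a # A'" "a \<longrightarrow> b" "list_all2 (\<longrightarrow>) A' B'"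
    by (auto simp: list_all2_Cons2)
  have T: "\<Phi> (True # B') \<le> \<Phi> (True # A')"
    using Suc.IH[of "\<lambda>A. \<Phi> (True # A)"] Suc.prems A B by auto
  have F: "\<Phi> (False # B') - \<Phi> (True # B') \<le> \<Phi> (False # A') - \<Phi> (True # A')"
    using Suc.IH[of "\<lambda>A. \<Phi> (False # A) - \<Phi> (True # A)"] Suc.prems A B by auto
  have P: "0 \<le> \<Phi> (False # A') - \<Phi> (True # A')"
    by (rule CM_nonneg[of n "\<lambda>A. \<Phi> (False # A) - \<Phi> (True # A)"])
      (use Suc.prems A B in \<open>auto dest: list_all2_lengthD\<close>)
  show ?case using A B T F P by (cases a; cases b) auto
qed simp

lemma list_all2_imp_replicate_True: "length A = n \<Longrightarrow> list_all2 (\<longrightarrow>) A (replicate n True)"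
  by (auto simp: list_all2_conv_all_nth simp del: replicate_Suc)

lemma list_all2_replicate_False_imp: "length A = n \<Longrightarrow> list_all2 (\<longrightarrow>) (replicate n False) A"
  by (auto simp: list_all2_conv_all_nth simp del: replicate_Suc)

definition rings :: "'s \<Rightarrow> 's list \<Rightarrow> bool list" where
  "rings y L = map (\<lambda>z. z = y) L"

definition zeros :: "'s \<Rightarrow> ('s \<Rightarrow> bool) list \<Rightarrow> bool list" where
  "zeros y tr = map (\<lambda>\<eta>. \<not> \<eta> y) tr"

lemma rings_Cons [simp]: "rings y (x # L) = (x = y) # rings y L"
  by (simp add: rings_def)

text \<open>Indicator that no ring (\<open>T\<close>) comes at a moment when the site is facilitated (\<open>A\<close>). Histories
  are one entry longer than schedules: they list the states before each ring and the final state.\<close>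

fun NU :: "bool list \<Rightarrow> bool list \<Rightarrow> real" where
  "NU [] A = 1"
| "NU (t # T) A = (if t \<and> hd A then 0 else NU T (tl A))"

lemma CM_NU: "CM (Suc (length T)) (NU T)"
proof (induction T)
  case (Cons t T)
  then show ?case by (cases t) (auto simp: CM_zero)
qed simp

lemma NU_allFalse: "NU T (replicate (Suc (length T)) False) = 1"
  by (induction T) auto

section \<open>The kernel of a single site and its composition along a path\<close>

locale refresh =
  fixes p :: real
  assumes p0: "0 < p" and p1: "p < 1"
begin

text \<open>Expectation of \<open>\<Phi>\<close> on the history of zeros of a site with initial spin \<open>v\<close>, ring times \<open>T\<close> and history
  of facilitation \<open>A\<close>.\<close>

fun K :: "bool \<Rightarrow> (bool list \<Rightarrow> real) \<Rightarrow> bool list \<Rightarrow> bool list \<Rightarrow> real" where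
  "K v \<Phi> [] A = \<Phi> [\<not> v]"
| "K v \<Phi> (t # T) A =
     (if t \<and> hd A
      then p * K True (\<lambda>Z. \<Phi> ((\<not> v) # Z)) T (tl A) + (1 - p) * K False (\<lambda>Z. \<Phi> ((\<not> v) # Z)) T (tl A)
      else K v (\<lambda>Z. \<Phi> ((\<not> v) # Z)) T (tl A))"

definition Kf :: "(bool list \<Rightarrow> real) \<Rightarrow> bool list \<Rightarrow> bool list \<Rightarrow> real" where
  "Kf \<Phi> T A = p * K True \<Phi> T A + (1 - p) * K False \<Phi> T A"

lemma K_add: "K v (\<lambda>Z. \<Phi> Z + \<Psi> Z) T A = K v \<Phi> T A + K v \<Psi> T A"
  by (induction T arbitrary: v \<Phi> \<Psi> A) (auto simp: algebra_simps)

lemma K_diff: "K v (\<lambda>Z. \<Phi> Z - \<Psi> Z) T A = K v \<Phi> T A - K v \<Psi> T A"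
  using K_add[of v "\<lambda>Z. \<Phi> Z - \<Psi> Z" \<Psi> T A] by simp

lemma K_mono:
  "(\<And>Z. length Z = Suc (length T) \<Longrightarrow> \<Phi> Z \<le> \<Psi> Z) \<Longrightarrow> K v \<Phi> T A \<le> K v \<Psi> T A"
proof (induction T arbitrary: v \<Phi> \<Psi> A)
  case (Cons t T)
  have *: "K w (\<lambda>Z. \<Phi> ((\<not> v) # Z)) T (tl A) \<le> K w (\<lambda>Z. \<Psi> ((\<not> v) # Z)) T (tl A)" for w
    using Cons.prems by (intro Cons.IH) auto
  show ?case using *[of True] *[of False] *[of v] p0 p1
    by (auto intro!: add_mono mult_left_mono)
qed simp

lemma K_const: "K v (\<lambda>_. c) T A = c"
  by (induction T arbitrary: v A) (auto simp: algebra_simps)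

text \<open>The second conjunct carries the induction. For the difference \<Delta> of \<Phi> in its
  first entry it makes \<open>K True\<close> \<Delta> completely alternating, as the sum of
  \<open>Kf\<close> \<Delta> and a nonnegative multiple of \<open>K True\<close> \<Delta> -
  \<open>K False\<close> \<Delta>; every difference in the first entry of \<open>A\<close> is a
  combination of such terms.\<close>

lemma CM_K:
  "CM (Suc (length T)) \<Phi> \<Longrightarrow>
     CM (Suc (length T)) (Kf \<Phi> T) \<and> CM (Suc (length T)) (\<lambda>A. K True \<Phi> T A - K False \<Phi> T A)"
proof (induction T arbitrary: \<Phi>)
  case Nil
  then show ?case using p0 p1 by (auto simp: Kf_def intro!: add_nonneg_nonneg mult_nonneg_nonneg)
next
  case (Cons t T)
  define n where "n = Suc (length T)"
  define \<Phi>0 where "\<Phi>0 = (\<lambda>Z. \<Phi> (True # Z))"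
  define \<Phi>1 where "\<Phi>1 = (\<lambda>Z. \<Phi> (False # Z))"
  define \<Delta> where "\<Delta> = (\<lambda>Z. \<Phi>1 Z - \<Phi>0 Z)"
  have c0: "CM n \<Phi>0" and cD: "CM n \<Delta>"
    using Cons.prems by (auto simp: n_def \<Phi>0_def \<Phi>1_def \<Delta>_def)
  have c1: "CM n \<Phi>1" using CM_add[OF c0 cD] by (simp add: \<Delta>_def)
  note I0 = Cons.IH[folded n_def, OF c0] and I1 = Cons.IH[folded n_def, OF c1] and ID = Cons.IH[folded n_def, OF cD]
  have K1: "K True \<Phi>1 T A = K True \<Phi>0 T A + K True \<Delta> T A"
       and K0: "K False \<Phi>1 T A = K False \<Phi>0 T A + K False \<Delta> T A" for A
    by (simp_all add: \<Delta>_def K_diff)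
  have q: "0 \<le> p" "0 \<le> 1 - p" using p0 p1 by auto
  have KD: "CM n (K True \<Delta> T)"
  proof -
    have "CM n (\<lambda>A. Kf \<Delta> T A + (1 - p) * (K True \<Delta> T A - K False \<Delta> T A))"
      by (intro CM_add CM_scale) (use ID q in auto)
    then show ?thesis by (rule CM_cong[THEN iffD1, rotated]) (simp add: Kf_def algebra_simps)
  qed
  show ?case
  proof (cases t)
    case False
    have "CM n (\<lambda>A. Kf \<Phi>0 T A + p * K True \<Delta> T A)" by (intro CM_add CM_scale) (use I0 KD q in auto)
    then have a: "CM n (\<lambda>A. p * K True \<Phi>1 T A + (1 - p) * K False \<Phi>0 T A)"
      by (rule CM_cong[THEN iffD1, rotated]) (simp add: Kf_def K1 algebra_simps)
    have "CM n (\<lambda>A. (K True \<Phi>0 T A - K False \<Phi>0 T A) + K True \<Delta> T A)" by (intro CM_add) (use I0 KD in auto)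
    then have b: "CM n (\<lambda>A. K True \<Phi>1 T A - K False \<Phi>0 T A)"
      by (rule CM_cong[THEN iffD1, rotated]) (simp add: K1 algebra_simps)
    show ?thesis using a b False by (simp add: Kf_def n_def \<Phi>0_def \<Phi>1_def CM_zero)
  next
    case True
    have "CM n (\<lambda>A. p * Kf \<Phi>1 T A + (1 - p) * Kf \<Phi>0 T A)" by (intro CM_add CM_scale) (use I0 I1 q in auto)
    then have a1: "CM n (\<lambda>A. Kf \<Phi> (t # T) (True # A))"
      by (rule CM_cong[THEN iffD1, rotated]) (simp add: Kf_def True \<Phi>0_def \<Phi>1_def algebra_simps)
    \<comment> \<open>A facilitated ring makes the spins before and after it independent, while
      without facilitation they agree. The difference of the two expectations is a covariance, which
      accounts for the factor \<open>p * (1 - p)\<close>.\<close>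
    have "CM n (\<lambda>A. (p * (1 - p)) * (K True \<Delta> T A - K False \<Delta> T A))" by (intro CM_scale) (use ID q in auto)
    then have a2: "CM n (\<lambda>A. Kf \<Phi> (t # T) (False # A) - Kf \<Phi> (t # T) (True # A))"
      by (rule CM_cong[THEN iffD1, rotated]) 
        (simp add: Kf_def True \<Phi>0_def \<Phi>1_def \<Delta>_def K_diff algebra_simps)
    have "CM n (Kf \<Delta> T)" using ID by simp
    then have b1: "CM n (\<lambda>A. K True \<Phi> (t # T) (True # A) - K False \<Phi> (t # T) (True # A))"
      by (rule CM_cong[THEN iffD1, rotated]) 
        (simp add: Kf_def True \<Phi>0_def \<Phi>1_def \<Delta>_def K_diff algebra_simps)
    have "CM n (\<lambda>A. (1 - p) * (K True \<Phi>1 T A - K False \<Phi>1 T A) + p * (K True \<Phi>0 T A - K False \<Phi>0 T A))"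
      by (intro CM_add CM_scale) (use I0 I1 q in auto)
    then have b2: "CM n (\<lambda>A. (K True \<Phi> (t # T) (False # A) - K False \<Phi> (t # T) (False # A))
         - (K True \<Phi> (t # T) (True # A) - K False \<Phi> (t # T) (True # A)))"
      by (rule CM_cong[THEN iffD1, rotated]) 
        (simp add: Kf_def True \<Phi>0_def \<Phi>1_def \<Delta>_def K_diff algebra_simps)
    show ?thesis using a1 a2 b1 b2 unfolding n_def by simp
  qed
qed

lemma CM_Kf: "CM (Suc (length T)) \<Phi> \<Longrightarrow> CM (Suc (length T)) (Kf \<Phi> T)"
  using CM_K by blast

text \<open>By the second half of \<open>CM_K\<close> the worst initial spin is \<open>True\<close>,
  and it has weight \<open>p\<close> in \<open>Kf\<close>. Every factor \<open>1 / p\<close> of the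
  proof originates here.\<close>

lemma K_le_Kf:
  assumes "CM (Suc (length T)) \<Phi>" "length A = Suc (length T)"
  shows "K v \<Phi> T A \<le> Kf \<Phi> T A / p"
proof -
  have "0 \<le> K False \<Phi> T A"
    using K_mono[of T "\<lambda>_. 0" \<Phi> False A] CM_nonneg[OF assms(1)] K_const by simp
  then have 1: "K True \<Phi> T A \<le> Kf \<Phi> T A / p"
    using p0 p1 by (simp add: Kf_def field_simps mult_left_le_one_le)
  have "K False \<Phi> T A \<le> K True \<Phi> T A"
    using CM_nonneg[OF CM_K[OF assms(1), THEN conjunct2] assms(2)] by simp
  with 1 show ?thesis by (cases v) auto
qed

lemma Kf_ge_allTrue:
  assumes "CM (Suc (length T)) \<Phi>"
  shows "\<Phi> (replicate (Suc (length T)) True) \<le> Kf \<Phi> T A"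
proof -
  have "\<Phi> (replicate (Suc (length T)) True) \<le> K v \<Phi> T A" for v
  proof -
    have "K v (\<lambda>_. \<Phi> (replicate (Suc (length T)) True)) T A \<le> K v \<Phi> T A"
      by (intro K_mono CM_antimono[OF assms] list_all2_imp_replicate_True) auto
    then show ?thesis by (simp add: K_const)
  qed
  from this[of True] this[of False] show ?thesis
    using p0 p1 convex_bound_le[of "- K True \<Phi> T A" "- \<Phi> (replicate (Suc (length T)) True)" "- K False \<Phi> T A" p "1 - p"]
    by (simp add: Kf_def)
qed

lemma K_allFalse: "K v \<Phi> T (replicate (Suc (length T)) False) = \<Phi> (replicate (Suc (length T)) (\<not> v))"
  by (induction T arbitrary: \<Phi>) auto

lemma Kf_allFalse:
  "Kf \<Phi> T (replicate (Suc (length T)) False) =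
     p * \<Phi> (replicate (Suc (length T)) False) + (1 - p) * \<Phi> (replicate (Suc (length T)) True)"
  unfolding Kf_def K_allFalse by simp

text \<open>\<open>Kf\<close> turns a functional of the zeros of \<open>y\<close> into one of the
  facilitation of \<open>y\<close>, which is then read as the history of zeros of the next site. The
  final argument is thus the history of zeros below the last site of the path.\<close>

fun KK :: "'s list \<Rightarrow> 's list \<Rightarrow> (bool list \<Rightarrow> real) \<Rightarrow> bool list \<Rightarrow> real" where
  "KK [] L \<Phi> = \<Phi>"
| "KK (y # \<gamma>) L \<Phi> = KK \<gamma> L (Kf \<Phi> (map (\<lambda>z. z = y) L))"

lemma KK_append: "KK (\<gamma> @ \<delta>) L \<Phi> = KK \<delta> L (KK \<gamma> L \<Phi>)"
  by (induction \<gamma> arbitrary: \<Phi>) auto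

lemma CM_KK: "CM (Suc (length L)) \<Phi> \<Longrightarrow> CM (Suc (length L)) (KK \<gamma> L \<Phi>)"
  using CM_Kf[of "map (\<lambda>z. z = _) L"] by (induction \<gamma> arbitrary: \<Phi>) auto

lemma KK_ge_allTrue:
  assumes "CM (Suc (length L)) \<Phi>" "length A = Suc (length L)"
  shows "\<Phi> (replicate (Suc (length L)) True) \<le> KK \<gamma> L \<Phi> A"
  using assms
proof (induction \<gamma> arbitrary: \<Phi>)
  case Nil
  then show ?case using CM_antimono[OF Nil(1) _ list_all2_imp_replicate_True] by simp
next
  case (Cons y \<gamma>)
  have "\<Phi> (replicate (Suc (length L)) True) \<le> Kf \<Phi> (map (\<lambda>z. z = y) L) (replicate (Suc (length L)) True)"
    using Kf_ge_allTrue[of "map (\<lambda>z. z = y) L" \<Phi>] Cons.prems by simp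
  also have "\<dots> \<le> KK (y # \<gamma>) L \<Phi> A"
    using Cons.IH[of "Kf \<Phi> (map (\<lambda>z. z = y) L)"] CM_Kf[of "map (\<lambda>z. z = y) L" \<Phi>] Cons.prems by simp
  finally show ?case .
qed

text \<open>Compares a boundary that is never zero with one that is always zero. A site that is
  never facilitated keeps its initial spin, which is a zero with probability \<open>1 - p\<close>,
  and then the next site sees a permanent zero; only the remaining weight \<open>p\<close> passes
  the discrepancy on.\<close>

lemma KK_allFalse_le:
  assumes "CM (Suc (length L)) \<Phi>"
  shows "KK \<gamma> L \<Phi> (replicate (Suc (length L)) False) \<le> KK \<gamma> L \<Phi> (replicate (Suc (length L)) True)
      + p ^ length \<gamma> * (\<Phi> (replicate (Suc (length L)) False) - \<Phi> (replicate (Suc (length L)) True))"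
  using assms
proof (induction \<gamma> arbitrary: \<Phi>)
  case (Cons y \<gamma>)
  let ?T = "map (\<lambda>z. z = y) L" and ?f = "replicate (Suc (length L)) False" and ?t = "replicate (Suc (length L)) True"
  have c: "CM (Suc (length L)) (Kf \<Phi> ?T)" using CM_Kf[of ?T \<Phi>] Cons.prems by simp
  have "Kf \<Phi> ?T ?f = p * \<Phi> ?f + (1 - p) * \<Phi> ?t" using Kf_allFalse[of \<Phi> ?T] by simp
  moreover have "\<Phi> ?t \<le> Kf \<Phi> ?T ?t" using Kf_ge_allTrue[of ?T \<Phi> ?t] Cons.prems by simp
  ultimately have "Kf \<Phi> ?T ?f - Kf \<Phi> ?T ?t \<le> p * (\<Phi> ?f - \<Phi> ?t)" by (simp add: algebra_simps)
  then have "p ^ length \<gamma> * (Kf \<Phi> ?T ?f - Kf \<Phi> ?T ?t) \<le> p ^ length \<gamma> * (p * (\<Phi> ?f - \<Phi> ?t))"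
    using p0 by (intro mult_left_mono) auto
  with Cons.IH[OF c] show ?case by (simp add: algebra_simps)
qed simp

text \<open>Lets an induction on the schedule forget the rings that have already occurred.\<close>

lemma KK_Cons_schedule:
  assumes "CM (Suc (length L)) \<Psi>" "CM (Suc (Suc (length L))) \<Phi>"
    "CM (Suc (length L)) (\<lambda>A. \<Phi> (True # A) - \<Psi> A)" "length A = Suc (length L)"
  shows "KK \<gamma> L \<Psi> A \<le> KK \<gamma> (x # L) \<Phi> (b # A)"
  using assms(1-3)
proof (induction \<gamma> arbitrary: \<Phi> \<Psi>)
  case Nil
  have "0 \<le> \<Phi> (True # A) - \<Psi> A" using CM_nonneg[OF Nil(3) assms(4)] .
  moreover have "0 \<le> \<Phi> (False # A) - \<Phi> (True # A)"
    using CM_nonneg[of "Suc (length L)" "\<lambda>A. \<Phi> (False # A) - \<Phi> (True # A)" A] Nil(2) assms(4) by simp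
  ultimately show ?case by (cases b) auto
next
  case (Cons y \<gamma>)
  let ?T = "map (\<lambda>z. z = y) L" and ?n = "Suc (length L)"
  define \<Phi>0 where "\<Phi>0 = (\<lambda>Z. \<Phi> (True # Z))"
  define \<Delta> where "\<Delta> = (\<lambda>Z. \<Phi> (False # Z) - \<Phi>0 Z)"
  have cD: "CM ?n \<Delta>" using Cons.prems(2) by (simp add: \<Delta>_def \<Phi>0_def)
  have cE: "CM ?n (\<lambda>Z. \<Phi>0 Z - \<Psi> Z)" using Cons.prems(3) by (simp add: \<Phi>0_def)
  have a: "CM ?n (Kf \<Psi> ?T)" using CM_Kf[of ?T \<Psi>] Cons.prems by simp
  have b: "CM (Suc ?n) (Kf \<Phi> ((x = y) # ?T))"
    using CM_Kf[of "(x = y) # ?T" \<Phi>] Cons.prems by simp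
  have kD: "CM ?n (Kf \<Delta> ?T)" "CM ?n (\<lambda>A. K True \<Delta> ?T A - K False \<Delta> ?T A)"
    using CM_K[of ?T \<Delta>] cD by simp_all
  have kE: "CM ?n (Kf (\<lambda>Z. \<Phi>0 Z - \<Psi> Z) ?T)" using CM_Kf[of ?T "\<lambda>Z. \<Phi>0 Z - \<Psi> Z"] cE by simp
  have q: "0 \<le> p" "0 \<le> p * (1 - p)" using p0 p1 by auto
  \<comment> \<open>The relation between \<Phi> and \<Psi> has to be reproduced one site further
    down. Both schedules share the image of \<Phi>\<open>0\<close> - \<Psi>; the extra first entry
    adds a term in \<Delta>, which is completely alternating whether or not the forgotten ring was
    at \<open>y\<close>.\<close>
  have "CM ?n (\<lambda>A. Kf \<Phi> ((x = y) # ?T) (True # A) - Kf \<Psi> ?T A)"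
  proof (cases "x = y")
    case True
    have "CM ?n (\<lambda>A. Kf (\<lambda>Z. \<Phi>0 Z - \<Psi> Z) ?T A + p * Kf \<Delta> ?T A)"
      by (intro CM_add CM_scale kE kD q)
    then show ?thesis
      by (rule CM_cong[THEN iffD1, rotated]) (simp add: True Kf_def \<Delta>_def \<Phi>0_def K_diff algebra_simps)
  next
    case False
    have "CM ?n (\<lambda>A. Kf (\<lambda>Z. \<Phi>0 Z - \<Psi> Z) ?T A + (p * Kf \<Delta> ?T A + (p * (1 - p)) * (K True \<Delta> ?T A - K False \<Delta> ?T A)))"
      by (intro CM_add CM_scale kE kD q)
    then show ?thesis
      by (rule CM_cong[THEN iffD1, rotated]) (simp add: False Kf_def \<Delta>_def \<Phi>0_def K_diff algebra_simps)
  qed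
  then show ?case using Cons.IH[OF a, of "Kf \<Phi> ((x = y) # ?T)"] b by simp
qed

end

section \<open>Expectation over the coins for a fixed order of rings\<close>

locale facilitated = refresh +
  fixes par :: "'s \<Rightarrow> 's set"
begin

definition fac :: "('s \<Rightarrow> bool) \<Rightarrow> 's \<Rightarrow> bool" where
  "fac \<eta> x \<longleftrightarrow> (\<exists>y\<in>par x. \<not> \<eta> y)"

text \<open>Expectation over the coins alone, given that the rings occur in the order \<open>L\<close>.\<close>

fun EE :: "'s list \<Rightarrow> ('s \<Rightarrow> bool) \<Rightarrow> (('s \<Rightarrow> bool) list \<Rightarrow> real) \<Rightarrow> real" where
  "EE [] \<eta> g = g [\<eta>]"
| "EE (x # L) \<eta> g =
     (if fac \<eta> x
      then p * EE L (\<eta>(x := True)) (\<lambda>tr. g (\<eta> # tr)) + (1 - p) * EE L (\<eta>(x := False)) (\<lambda>tr. g (\<eta> # tr))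
      else EE L \<eta> (\<lambda>tr. g (\<eta> # tr)))"

lemma EE_mono:
  "(\<And>tr. length tr = Suc (length L) \<Longrightarrow> g tr \<le> g' tr) \<Longrightarrow> EE L \<eta> g \<le> EE L \<eta> g'"
proof (induction L arbitrary: \<eta> g g')
  case (Cons x L)
  have "EE L \<zeta> (\<lambda>tr. g (\<eta> # tr)) \<le> EE L \<zeta> (\<lambda>tr. g' (\<eta> # tr))" for \<zeta>
    using Cons.prems by (intro Cons.IH) auto
  then show ?case using p0 p1 by (auto intro!: add_mono mult_left_mono)
qed simp

lemma EE_cong:
  "(\<And>tr. length tr = Suc (length L) \<Longrightarrow> g tr = g' tr) \<Longrightarrow> EE L \<eta> g = EE L \<eta> g'"
  using EE_mono[of L g g'] EE_mono[of L g' g] by (simp add: order_antisym)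

lemma EE_add: "EE L \<eta> (\<lambda>tr. g tr + g' tr) = EE L \<eta> g + EE L \<eta> g'"
  by (induction L arbitrary: \<eta> g g') (auto simp: algebra_simps)

lemma EE_scale: "EE L \<eta> (\<lambda>tr. c * g tr) = c * EE L \<eta> g"
  by (induction L arbitrary: \<eta> g) (auto simp: algebra_simps)

lemma EE_const: "EE L \<eta> (\<lambda>_. c) = c"
  by (induction L arbitrary: \<eta>) (auto simp: algebra_simps)

lemma EE_diff: "EE L \<eta> (\<lambda>tr. g tr - g' tr) = EE L \<eta> g - EE L \<eta> g'"
  using EE_add[of L \<eta> "\<lambda>tr. g tr - g' tr" g'] by simp

text \<open>Influence runs from parents to children only. As \<open>D\<close> is closed under
  parents, a ring outside \<open>D\<close> changes nothing that \<open>g\<close> or a later ring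
  inside \<open>D\<close> can see, and its coin averages out.\<close>

lemma EE_local:
  assumes "\<And>x. x \<in> D \<Longrightarrow> par x \<subseteq> D"
    and "\<And>tr tr'. list_all2 (\<lambda>\<zeta> \<zeta>'. \<forall>x\<in>D. \<zeta> x = \<zeta>' x) tr tr' \<Longrightarrow> g tr = g tr'"
    and "\<forall>x\<in>D. \<eta> x = \<eta>' x"
  shows "EE L \<eta> g = EE L \<eta>' g"
  using assms(2,3)
proof (induction L arbitrary: \<eta> \<eta>' g)
  case Nil
  then show ?case by simp
next
  case (Cons x L)
  have *: "EE L \<zeta> (\<lambda>tr. g (\<eta> # tr)) = EE L \<zeta>' (\<lambda>tr. g (\<eta>' # tr))"
    if "\<forall>x\<in>D. \<zeta> x = \<zeta>' x" for \<zeta> \<zeta>'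
  proof -
    have "g (\<eta> # tr) = g (\<eta>' # tr)" for tr
      using Cons.prems by (intro Cons.prems(1)) (auto simp: list_all2_refl)
    moreover have "EE L \<zeta> (\<lambda>tr. g (\<eta> # tr)) = EE L \<zeta>' (\<lambda>tr. g (\<eta> # tr))"
      using that by (intro Cons.IH Cons.prems(1)) auto
    ultimately show ?thesis by simp
  qed
  show ?case
  proof (cases "x \<in> D")
    case True
    then have "fac \<eta> x = fac \<eta>' x" using assms(1)[OF True] Cons.prems(2) by (auto simp: fac_def)
    then show ?thesis
      using *[OF Cons.prems(2)] *[of "\<eta>(x := True)" "\<eta>'(x := True)"] *[of "\<eta>(x := False)" "\<eta>'(x := False)"]
        Cons.prems(2) by simp
  next
    case False
    have 1: "EE L (\<zeta>(x := b)) (\<lambda>tr. g (\<zeta> # tr)) = EE L \<zeta> (\<lambda>tr. g (\<zeta> # tr))" for \<zeta> b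
      using False Cons.prems by (intro Cons.IH Cons.prems(1)) (auto simp: list_all2_refl)
    have "EE (x # L) \<zeta> g = EE L \<zeta> (\<lambda>tr. g (\<zeta> # tr))" for \<zeta>
      unfolding EE.simps 1 by (simp add: algebra_simps)
    then show ?thesis using *[OF Cons.prems(2)] by simp
  qed
qed

definition facs :: "'s \<Rightarrow> ('s \<Rightarrow> bool) list \<Rightarrow> bool list" where
  "facs y tr = map (\<lambda>\<eta>. fac \<eta> y) tr"

lemma facs_local: "list_all2 (\<lambda>\<zeta> \<zeta>'. \<forall>x\<in>par y. \<zeta> x = \<zeta>' x) tr tr' \<Longrightarrow> facs y tr = facs y tr'"
  by (induction rule: list_all2_induct) (auto simp: facs_def fac_def)

lemma EE_facs_upd:
  assumes "\<And>x. x \<in> D \<Longrightarrow> par x \<subseteq> D" "par y \<subseteq> D" "y \<notin> D"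
  shows "EE L (\<eta>(y := b)) (\<lambda>tr. G (facs y tr)) = EE L \<eta> (\<lambda>tr. G (facs y tr))"
proof (rule EE_local[where D = D])
  show "G (facs y tr) = G (facs y tr')" if "list_all2 (\<lambda>\<zeta> \<zeta>'. \<forall>x\<in>D. \<zeta> x = \<zeta>' x) tr tr'" for tr tr'
    using list_all2_mono[OF that, of "\<lambda>\<zeta> \<zeta>'. \<forall>x\<in>par y. \<zeta> x = \<zeta>' x"] assms(2)
    by (intro arg_cong[where f = G] facs_local) blast
qed (use assms in auto)

text \<open>The history of facilitation of \<open>y\<close> is a function of the sites in
  \<open>D\<close>, on which \<open>y\<close> has no influence. Given this history, \<open>y\<close>
  is refreshed by independent coins at its facilitated rings, and \<open>K\<close> is the resulting
  conditional expectation.\<close>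

lemma EE_zeros_eq_facs:
  assumes D: "\<And>x. x \<in> D \<Longrightarrow> par x \<subseteq> D" "par y \<subseteq> D" "y \<notin> D"
  shows "EE L \<eta> (\<lambda>tr. \<Phi> (zeros y tr)) = EE L \<eta> (\<lambda>tr. K (\<eta> y) \<Phi> (rings y L) (facs y tr))"
proof (induction L arbitrary: \<eta> \<Phi>)
  case Nil
  show ?case by (simp add: zeros_def rings_def)
next
  case (Cons x L)
  let ?T = "rings y L"
  define \<Phi>' where "\<Phi>' = (\<lambda>Z. \<Phi> ((\<not> \<eta> y) # Z))"
  have IH: "EE L \<zeta> (\<lambda>tr. \<Phi>' (zeros y tr)) = EE L \<zeta> (\<lambda>tr. K (\<zeta> y) \<Phi>' ?T (facs y tr))" for \<zeta>
    by (rule Cons.IH)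
  have z: "\<Phi> (zeros y (\<eta> # tr)) = \<Phi>' (zeros y tr)" for tr by (simp add: zeros_def \<Phi>'_def)
  have f: "facs y (\<eta> # tr) = fac \<eta> y # facs y tr" for tr by (simp add: facs_def)
  have r: "rings y (x # L) = (x = y) # ?T" by (simp add: rings_def)
  show ?case
  proof (cases "fac \<eta> x \<and> x = y")
    case True
    have u: "EE L (\<eta>(y := b)) (\<lambda>tr. G (facs y tr)) = EE L \<eta> (\<lambda>tr. G (facs y tr))" for b G
      by (rule EE_facs_upd[OF D])
    from True have xy: "x = y" and fy: "fac \<eta> y" by auto
    define G where "G = (\<lambda>A. p * K True \<Phi>' ?T A + (1 - p) * K False \<Phi>' ?T A)"
    have "K (\<eta> y) \<Phi> (rings y (x # L)) (facs y (\<eta> # tr)) = G (facs y tr)" for tr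
      unfolding f r using xy fy by (simp add: G_def \<Phi>'_def)
    then have "EE (x # L) \<eta> (\<lambda>tr. K (\<eta> y) \<Phi> (rings y (x # L)) (facs y tr)) =
       p * EE L (\<eta>(y := True)) (\<lambda>tr. G (facs y tr)) + (1 - p) * EE L (\<eta>(y := False)) (\<lambda>tr. G (facs y tr))"
      using xy fy by simp
    also have "\<dots> = EE L \<eta> (\<lambda>tr. p * K True \<Phi>' ?T (facs y tr) + (1 - p) * K False \<Phi>' ?T (facs y tr))"
      unfolding u by (simp add: G_def algebra_simps)
    also have "\<dots> = p * EE L \<eta> (\<lambda>tr. K True \<Phi>' ?T (facs y tr)) + (1 - p) * EE L \<eta> (\<lambda>tr. K False \<Phi>' ?T (facs y tr))"
      by (simp add: EE_add EE_scale)
    also have "\<dots> = EE (x # L) \<eta> (\<lambda>tr. \<Phi> (zeros y tr))"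
      using xy fy by (simp add: z IH u)
    finally show ?thesis by simp
  next
    case False
    then show ?thesis
      by (cases "fac \<eta> x"; cases "x = y") (auto simp: z f IH, auto simp: \<Phi>'_def)
  qed
qed

lemma zeros_imp_facs: "y' \<in> par y \<Longrightarrow> list_all2 (\<longrightarrow>) (zeros y' tr) (facs y tr)"
  by (induction tr) (auto simp: zeros_def facs_def fac_def)

text \<open>The initial spin of \<open>y\<close> is exchanged for an equilibrium spin at the price
  \<open>1 / p\<close>. Counting only the zeros of one parent then shrinks the history of
  facilitation, which can only raise a completely alternating functional.\<close>

lemma EE_zeros_descend:
  assumes D: "\<And>x. x \<in> D \<Longrightarrow> par x \<subseteq> D" "par y \<subseteq> D" "y \<notin> D"
    and y': "y' \<in> par y" and \<Phi>: "CM (Suc (length L)) \<Phi>"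
  shows "EE L \<eta> (\<lambda>tr. \<Phi> (zeros y tr)) \<le> EE L \<eta> (\<lambda>tr. Kf \<Phi> (rings y L) (zeros y' tr)) / p"
proof -
  have l: "length (rings y L) = length L" by (simp add: rings_def)
  have "K (\<eta> y) \<Phi> (rings y L) (facs y tr) \<le> inverse p * Kf \<Phi> (rings y L) (zeros y' tr)"
    if "length tr = Suc (length L)" for tr
  proof -
    have lf: "length (facs y tr) = Suc (length (rings y L))" using that by (simp add: facs_def l)
    have "K (\<eta> y) \<Phi> (rings y L) (facs y tr) \<le> Kf \<Phi> (rings y L) (facs y tr) / p"
      using K_le_Kf[OF _ lf] \<Phi> l by simp
    also have "\<dots> \<le> Kf \<Phi> (rings y L) (zeros y' tr) / p"
      using CM_antimono[OF CM_Kf[of "rings y L" \<Phi>] lf zeros_imp_facs[OF y']] \<Phi> l p0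
      by (intro divide_right_mono) auto
    finally show ?thesis by (simp add: field_simps)
  qed
  then have "EE L \<eta> (\<lambda>tr. K (\<eta> y) \<Phi> (rings y L) (facs y tr))
      \<le> EE L \<eta> (\<lambda>tr. inverse p * Kf \<Phi> (rings y L) (zeros y' tr))" by (rule EE_mono)
  then show ?thesis
    using EE_zeros_eq_facs[OF D, of L \<eta> \<Phi>] unfolding EE_scale by (simp add: divide_inverse_commute)
qed

text \<open>A path contains its starting point: for positive \<open>k\<close> it consists of
  \<open>y\<close> and \<open>k - 1\<close> further generations.\<close>

fun paths :: "nat \<Rightarrow> 's \<Rightarrow> 's list set" where
  "paths 0 y = {[]}"
| "paths (Suc k) y = (\<Union>y'\<in>par y. (#) y ` paths k y')"

end

locale oriented = facilitated p par for p and par :: "'s \<Rightarrow> 's set" +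
  fixes rk :: "'s \<Rightarrow> int"
  assumes rk_par: "y \<in> par x \<Longrightarrow> rk y < rk x" and par_ne: "par x \<noteq> {}"
begin

lemma below: "x \<in> {z. rk z < r} \<Longrightarrow> par x \<subseteq> {z. rk z < r}" "par y \<subseteq> {z. rk z < rk y}" "y \<notin> {z. rk z < rk y}"
  by (auto dest: rk_par intro: less_trans)

text \<open>A zero at \<open>y\<close> stays there until the first legal update at \<open>y\<close>, and at that time some parent of \<open>y\<close> is a
  zero: the distinguished zero moves to this parent, and \<open>y\<close> is in equilibrium from then on.\<close>

lemma EE_zeros_le_of_zero:
  assumes "\<not> \<eta> y" "CM (Suc (length L)) \<Phi>"
    and "\<And>\<gamma>. \<gamma> \<in> paths k y \<Longrightarrow> KK \<gamma> L \<Phi> (replicate (Suc (length L)) False) \<le> B"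
  shows "EE L \<eta> (\<lambda>tr. \<Phi> (zeros y tr)) \<le> B"
  using assms
proof (induction k arbitrary: L \<eta> y \<Phi>)
  case 0
  have "EE L \<eta> (\<lambda>tr. \<Phi> (zeros y tr)) \<le> EE L \<eta> (\<lambda>tr. \<Phi> (replicate (Suc (length L)) False))"
    by (intro EE_mono CM_antimono[OF 0(2)] list_all2_replicate_False_imp) (auto simp: zeros_def)
  then show ?case using 0(3) by (simp add: EE_const)
next
  case (Suc k)
  \<comment> \<open>The hypothesis on \<open>k\<close> is kept for arbitrary schedules and
    functionals: the inner induction on the schedule calls it at the first legal update of
    \<open>y\<close>, with the rings that remain.\<close>
  have outer: "EE L \<eta> (\<lambda>tr. \<Phi> (zeros y tr)) \<le> B" if "\<not> \<eta> y" "CM (Suc (length L)) \<Phi>"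
     "\<And>\<gamma>. \<gamma> \<in> paths k y \<Longrightarrow> KK \<gamma> L \<Phi> (replicate (Suc (length L)) False) \<le> B" for L \<eta> y \<Phi>
    using that by (rule Suc.IH)
  have ne: "paths j z \<noteq> {}" for j z
    by (induction j arbitrary: z) (use par_ne in auto)
  show ?case using Suc.prems
  proof (induction L arbitrary: \<eta> \<Phi>)
    case Nil
    obtain \<gamma> where \<gamma>: "\<gamma> \<in> paths (Suc k) y" using ne by blast
    have "\<Phi> [True] \<le> KK \<gamma> [] \<Phi> [False]" using KK_ge_allTrue[of "[]" \<Phi> "[False]" \<gamma>] Nil.prems(2) by simp
    then show ?case using Nil.prems(1) Nil.prems(3)[OF \<gamma>] by (simp add: zeros_def)
  next
    case (Cons x L)
    define \<Phi>0 where "\<Phi>0 = (\<lambda>Z. \<Phi> (True # Z))"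
    have c0: "CM (Suc (length L)) \<Phi>0" using Cons.prems(2) by (simp add: \<Phi>0_def)
    have B: "KK \<gamma> L \<Phi>0 (replicate (Suc (length L)) False) \<le> B" if "\<gamma> \<in> paths (Suc k) y" for \<gamma>
    proof -
      have "KK \<gamma> L \<Phi>0 (replicate (Suc (length L)) False)
          \<le> KK \<gamma> (x # L) \<Phi> (False # replicate (Suc (length L)) False)"
        by (rule KK_Cons_schedule) (use c0 Cons.prems(2) in \<open>simp_all add: \<Phi>0_def CM_zero\<close>)
      also have "\<dots> \<le> B" using Cons.prems(3)[OF that] by simp
      finally show ?thesis .
    qed
    have z: "\<Phi> (zeros y (\<eta> # tr)) = \<Phi>0 (zeros y tr)" for tr
      using Cons.prems(1) by (simp add: zeros_def \<Phi>0_def)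
    show ?case
    proof (cases "fac \<eta> x \<and> x = y")
      case False
      have IH: "EE L \<zeta> (\<lambda>tr. \<Phi>0 (zeros y tr)) \<le> B" if "\<not> \<zeta> y" for \<zeta>
        using that c0 B by (rule Cons.IH)
      show ?thesis
      proof (cases "fac \<eta> x")
        case True
        then have "x \<noteq> y" using False by simp
        then have "EE L (\<eta>(x := b)) (\<lambda>tr. \<Phi>0 (zeros y tr)) \<le> B" for b using Cons.prems(1) by (intro IH) simp
        then show ?thesis using True p0 p1 by (simp add: z convex_bound_le)
      next
        case False
        then show ?thesis using IH[of \<eta>] Cons.prems(1) by (simp add: z)
      qed
    next
      case True
      then have xy: "x = y" and fy: "fac \<eta> y" by auto
      then obtain y' where y': "y' \<in> par y" "\<not> \<eta> y'" by (auto simp: fac_def)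
      note D = below(1)[of _ "rk y"] below(2,3)[of y]
      let ?T = "rings y L"
      have l: "length ?T = length L" by (simp add: rings_def)
      have u: "EE L (\<eta>(y := b)) (\<lambda>tr. \<Phi>0 (zeros y tr)) = EE L \<eta> (\<lambda>tr. K b \<Phi>0 ?T (facs y tr))" for b
        using EE_zeros_eq_facs[OF D, of L "\<eta>(y := b)" \<Phi>0] EE_facs_upd[OF D, of L \<eta> b "K b \<Phi>0 ?T"] by simp
      have "EE (x # L) \<eta> (\<lambda>tr. \<Phi> (zeros y tr)) =
         p * EE L \<eta> (\<lambda>tr. K True \<Phi>0 ?T (facs y tr)) + (1 - p) * EE L \<eta> (\<lambda>tr. K False \<Phi>0 ?T (facs y tr))"
        using xy fy by (simp add: z u)
      also have "\<dots> = EE L \<eta> (\<lambda>tr. Kf \<Phi>0 ?T (facs y tr))"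
        by (simp add: Kf_def EE_add EE_scale)
      also have "\<dots> \<le> EE L \<eta> (\<lambda>tr. Kf \<Phi>0 ?T (zeros y' tr))"
        using CM_antimono[OF CM_Kf[of ?T \<Phi>0] _ zeros_imp_facs[OF y'(1)]] c0 l
        by (intro EE_mono) (simp add: facs_def)
      also have "\<dots> \<le> B"
      proof (rule outer[of \<eta> y', OF y'(2)])
        show "CM (Suc (length L)) (Kf \<Phi>0 ?T)" using CM_Kf[of ?T \<Phi>0] c0 l by simp
        fix \<gamma> assume "\<gamma> \<in> paths k y'"
        then have "y # \<gamma> \<in> paths (Suc k) y" using y'(1) by auto
        from B[OF this] show "KK \<gamma> L (Kf \<Phi>0 ?T) (replicate (Suc (length L)) False) \<le> B"
          by (simp add: rings_def)
      qed
      finally show ?thesis .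
    qed
  qed
qed

fun descending :: "'s list \<Rightarrow> bool" where
  "descending (x # y # \<gamma>) \<longleftrightarrow> y \<in> par x \<and> descending (y # \<gamma>)"
| "descending _ \<longleftrightarrow> True"

lemma EE_zeros_path:
  assumes "descending (\<pi> @ [y])" "CM (Suc (length L)) \<Phi>"
  shows "EE L \<eta> (\<lambda>tr. \<Phi> (zeros (hd (\<pi> @ [y])) tr)) \<le> EE L \<eta> (\<lambda>tr. KK \<pi> L \<Phi> (zeros y tr)) / p ^ length \<pi>"
  using assms
proof (induction \<pi> arbitrary: \<Phi>)
  case (Cons x \<pi>)
  note D = below(1)[of _ "rk x"] below(2,3)[of x]
  let ?y = "hd (\<pi> @ [y])"
  have y: "?y \<in> par x" "descending (\<pi> @ [y])"
    using Cons.prems(1) by (cases \<pi>; simp)+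
  have c: "CM (Suc (length L)) (Kf \<Phi> (rings x L))"
    using CM_Kf[of "rings x L" \<Phi>] Cons.prems(2) by (simp add: rings_def)
  have "EE L \<eta> (\<lambda>tr. \<Phi> (zeros x tr)) \<le> EE L \<eta> (\<lambda>tr. Kf \<Phi> (rings x L) (zeros ?y tr)) / p"
    by (rule EE_zeros_descend[OF D y(1) Cons.prems(2)])
  also have "\<dots> \<le> (EE L \<eta> (\<lambda>tr. KK \<pi> L (Kf \<Phi> (rings x L)) (zeros y tr)) / p ^ length \<pi>) / p"
    using p0 by (intro divide_right_mono Cons.IH y c) auto
  finally show ?case by (simp add: rings_def mult.commute)
qed simp

text \<open>The continued path has \<open>length\<close> \<pi> \<open>+ k\<close> sites, so the
  boundary error is \<open>p\<close> to this power; dividing by the price of the path \<pi> leaves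
  \<open>p ^ k\<close>. For a fixed schedule a maximum over \<gamma> would do; the sum is preferred
  because it commutes with the later expectation over schedules.\<close>

theorem no_update_le:
  assumes "descending (x # \<pi> @ [y])" "\<not> \<eta> y" "finite (paths k y)"
  shows "EE L \<eta> (\<lambda>tr. NU (rings x L) (facs x tr)) \<le>
     (\<Sum>\<gamma>\<in>paths k y. KK (\<pi> @ \<gamma>) L (NU (rings x L)) (replicate (Suc (length L)) True)) / p ^ length \<pi> + p ^ k"
    (is "_ \<le> sum ?S _ / _ + _")
proof -
  let ?\<Phi> = "NU (rings x L)"
  have l: "length (rings x L) = length L" by (simp add: rings_def)
  have c: "CM (Suc (length L)) ?\<Phi>" using CM_NU[of "rings x L"] l by simp
  have d: "hd (\<pi> @ [y]) \<in> par x" "descending (\<pi> @ [y])" using assms(1) by (cases \<pi>; simp)+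
  have S0: "0 \<le> ?S \<gamma>" for \<gamma> by (rule CM_nonneg[OF CM_KK[OF c]]) simp
  have len: "length \<gamma> = k" if "\<gamma> \<in> paths k y" for \<gamma>
    using that by (induction k arbitrary: y \<gamma>) auto
  have 1: "EE L \<eta> (\<lambda>tr. KK \<pi> L ?\<Phi> (zeros y tr)) \<le> sum ?S (paths k y) + p ^ (length \<pi> + k)"
  proof (rule EE_zeros_le_of_zero[where \<eta> = \<eta> and y = y and k = k, OF assms(2) CM_KK[OF c]])
    fix \<gamma> assume \<gamma>: "\<gamma> \<in> paths k y"
    have "?\<Phi> (replicate (Suc (length L)) False) = 1" using NU_allFalse[of "rings x L"] l by simp
    moreover have "0 \<le> ?\<Phi> (replicate (Suc (length L)) True)" by (rule CM_nonneg[OF c]) simp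
    ultimately have "KK (\<pi> @ \<gamma>) L ?\<Phi> (replicate (Suc (length L)) False) \<le> ?S \<gamma> + p ^ length (\<pi> @ \<gamma>) * 1"
      using p0 by (intro order_trans[OF KK_allFalse_le[OF c]] add_mono order_refl mult_left_mono) auto
    also have "?S \<gamma> \<le> sum ?S (paths k y)" by (rule member_le_sum[OF \<gamma>]) (use S0 assms(3) in auto)
    finally show "KK \<gamma> L (KK \<pi> L ?\<Phi>) (replicate (Suc (length L)) False) \<le> sum ?S (paths k y) + p ^ (length \<pi> + k)"
      using len[OF \<gamma>] by (simp add: KK_append)
  qed
  have "EE L \<eta> (\<lambda>tr. ?\<Phi> (facs x tr)) \<le> EE L \<eta> (\<lambda>tr. ?\<Phi> (zeros (hd (\<pi> @ [y])) tr))"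
    using CM_antimono[OF c _ zeros_imp_facs[OF d(1)]] by (intro EE_mono) (simp add: facs_def)
  also have "\<dots> \<le> EE L \<eta> (\<lambda>tr. KK \<pi> L ?\<Phi> (zeros y tr)) / p ^ length \<pi>"
    by (rule EE_zeros_path[OF d(2) c])
  also have "\<dots> \<le> (sum ?S (paths k y) + p ^ (length \<pi> + k)) / p ^ length \<pi>"
    using 1 p0 by (intro divide_right_mono) auto
  also have "\<dots> = sum ?S (paths k y) / p ^ length \<pi> + p ^ k"
    using p0 by (simp add: field_simps power_add)
  finally show ?thesis .
qed

section \<open>Resampling the support, highest sites first\<close>

lemma EE_last_Cons:
  "EE (x # L) \<eta> (\<lambda>tr. f (last tr)) =
     (if fac \<eta> x
      then p * EE L (\<eta>(x := True)) (\<lambda>tr. f (last tr)) + (1 - p) * EE L (\<eta>(x := False)) (\<lambda>tr. f (last tr))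
      else EE L \<eta> (\<lambda>tr. f (last tr)))"
proof -
  have "EE L \<zeta> (\<lambda>tr. f (last (\<eta> # tr))) = EE L \<zeta> (\<lambda>tr. f (last tr))" for \<zeta>
    by (rule EE_cong) auto
  then show ?thesis by simp
qed

lemma last_local: "list_all2 P tr tr' \<Longrightarrow> tr \<noteq> [] \<Longrightarrow> P (last tr) (last tr')"
  by (metis last_conv_nth list_all2_conv_all_nth list_all2_Nil2 diff_less length_greater_0_conv zero_less_one)

lemma EE_last_skip:
  assumes g: "\<And>\<zeta> \<zeta>'. \<forall>z. rk z \<le> r \<longrightarrow> \<zeta> z = \<zeta>' z \<Longrightarrow> g \<zeta> = g \<zeta>'" and x: "r < rk x"
  shows "EE (x # L) \<eta> (\<lambda>tr. g (last tr)) = EE L \<eta> (\<lambda>tr. g (last tr))"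
proof -
  have "EE L (\<eta>(x := b)) (\<lambda>tr. if tr = [] then 0 else g (last tr)) = EE L \<eta> (\<lambda>tr. if tr = [] then 0 else g (last tr))" for b
  proof (rule EE_local[where D = "{z. rk z \<le> r}"])
    show "(if tr = [] then 0 else g (last tr)) = (if tr' = [] then 0 else g (last tr'))"
      if "list_all2 (\<lambda>\<zeta> \<zeta>'. \<forall>z\<in>{z. rk z \<le> r}. \<zeta> z = \<zeta>' z) tr tr'" for tr tr'
      using that last_local[OF that] by (auto intro: g)
  qed (use x in \<open>auto dest: rk_par\<close>)
  moreover have "EE L \<zeta> (\<lambda>tr. if tr = [] then 0 else g (last tr)) = EE L \<zeta> (\<lambda>tr. g (last tr))" for \<zeta>
    by (rule EE_cong) auto
  ultimately have "EE L (\<eta>(x := b)) (\<lambda>tr. g (last tr)) = EE L \<eta> (\<lambda>tr. g (last tr))" for b by simp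
  then show ?thesis unfolding EE_last_Cons by (simp add: algebra_simps)
qed

text \<open>If \<open>g\<close> has conditional mean zero at \<open>x\<close> and ignores all other sites of rank above that of \<open>x\<close>, then only the
  coins without an update at \<open>x\<close> contribute to the expectation of \<open>g\<close>.\<close>

lemma EE_centered_eq_0:
  assumes g: "\<And>\<zeta> \<zeta>'. \<forall>z. rk z \<le> rk x \<longrightarrow> \<zeta> z = \<zeta>' z \<Longrightarrow> g \<zeta> = g \<zeta>'"
    and c: "\<And>\<zeta>. p * g (\<zeta>(x := True)) + (1 - p) * g (\<zeta>(x := False)) = 0"
  shows "p * EE L (\<eta>(x := True)) (\<lambda>tr. g (last tr)) + (1 - p) * EE L (\<eta>(x := False)) (\<lambda>tr. g (last tr)) = 0"
proof -
  have "\<forall>\<eta>. p * EE L (\<eta>(x := True)) (\<lambda>tr. g (last tr)) + (1 - p) * EE L (\<eta>(x := False)) (\<lambda>tr. g (last tr)) = 0"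
  proof (induction L)
    case Nil
    show ?case unfolding EE.simps last_ConsL[OF refl] using c by blast
  next
    case (Cons z L)
    let ?E = "\<lambda>\<zeta>. EE L \<zeta> (\<lambda>tr. g (last tr))"
    have IH: "p * ?E (\<zeta>(x := True)) + (1 - p) * ?E (\<zeta>(x := False)) = 0" for \<zeta>
      using Cons.IH by blast
    show ?case
    proof
      fix \<eta>
      show "p * EE (z # L) (\<eta>(x := True)) (\<lambda>tr. g (last tr)) + (1 - p) * EE (z # L) (\<eta>(x := False)) (\<lambda>tr. g (last tr)) = 0"
      proof (cases "rk x < rk z")
        case True
        then show ?thesis using EE_last_skip[of "rk x" g z L, OF g True] IH[of \<eta>] by simp
      next
        case False
        \<comment> \<open>A ring at a site other than \<open>x\<close> and of no higher rank does
          not see the spin at \<open>x\<close>, so averaging over this spin commutes with the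
          ring.\<close>
        then have "x \<notin> par z" using rk_par by fastforce
        then have f: "fac (\<eta>(x := b)) z = fac \<eta> z" for b by (auto simp: fac_def)
        show ?thesis
        proof (cases "fac \<eta> z")
          case fz: True
          show ?thesis
          proof (cases "z = x")
            case True
            then show ?thesis unfolding EE_last_Cons f using fz IH[of \<eta>] by simp
          next
            case False
            have "p * (p * ?E (\<eta>(z := True, x := True)) + (1 - p) * ?E (\<eta>(z := True, x := False)))
              + (1 - p) * (p * ?E (\<eta>(z := False, x := True)) + (1 - p) * ?E (\<eta>(z := False, x := False))) = 0"
              unfolding IH by simp
            moreover have "\<eta>(x := b, z := b') = \<eta>(z := b', x := b)" for b b' using False by (simp add: fun_upd_twist)
            ultimately show ?thesis unfolding EE_last_Cons f using fz by (simp add: algebra_simps)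
          qed
        next
          case False
          then show ?thesis unfolding EE_last_Cons f using IH[of \<eta>] by simp
        qed
      qed
    qed
  qed
  then show ?thesis by blast
qed

text \<open>The first legal update at \<open>x\<close> gives \<open>x\<close> a fresh Bernoulli
  spin, and \<open>EE_centered_eq_0\<close> annihilates everything that follows. Only coins without
  such an update survive, each contributing at most \<open>M\<close>.\<close>

lemma EE_centered_le:
  assumes g: "\<And>\<zeta> \<zeta>'. \<forall>z. rk z \<le> rk x \<longrightarrow> \<zeta> z = \<zeta>' z \<Longrightarrow> g \<zeta> = g \<zeta>'"
    and c: "\<And>\<zeta>. p * g (\<zeta>(x := True)) + (1 - p) * g (\<zeta>(x := False)) = 0"
    and M: "\<And>\<zeta>. \<bar>g \<zeta>\<bar> \<le> M"
  shows "\<bar>EE L \<eta> (\<lambda>tr. g (last tr))\<bar> \<le> M * EE L \<eta> (\<lambda>tr. NU (rings x L) (facs x tr))"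
proof (induction L arbitrary: \<eta>)
  case Nil
  then show ?case using M by (simp add: rings_def)
next
  case (Cons z L)
  let ?E = "\<lambda>\<zeta>. EE L \<zeta> (\<lambda>tr. g (last tr))" and ?N = "\<lambda>\<zeta>. EE L \<zeta> (\<lambda>tr. NU (rings x L) (facs x tr))"
  have f: "facs x (\<eta> # tr) = fac \<eta> x # facs x tr" for tr by (simp add: facs_def)
  show ?case
  proof (cases "fac \<eta> z")
    case fz: True
    show ?thesis
    proof (cases "z = x")
      case True
      then show ?thesis unfolding EE_last_Cons using fz EE_centered_eq_0[OF g c, of L \<eta>] by (simp add: f EE_const)
    next
      case False
      have "\<bar>p * ?E (\<eta>(z := True)) + (1 - p) * ?E (\<eta>(z := False))\<bar>
          \<le> p * \<bar>?E (\<eta>(z := True))\<bar> + (1 - p) * \<bar>?E (\<eta>(z := False))\<bar>"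
        using p0 p1 by (intro order_trans[OF abs_triangle_ineq]) (simp add: abs_mult)
      also have "\<dots> \<le> p * (M * ?N (\<eta>(z := True))) + (1 - p) * (M * ?N (\<eta>(z := False)))"
        using p0 p1 by (intro add_mono mult_left_mono Cons.IH) auto
      finally show ?thesis unfolding EE_last_Cons using fz False by (simp add: f algebra_simps)
    qed
  next
    case False
    then show ?thesis unfolding EE_last_Cons using Cons.IH[of \<eta>] by (cases "z = x") (simp_all add: f)
  qed
qed

end

context refresh
begin

definition av :: "'s \<Rightarrow> (('s \<Rightarrow> bool) \<Rightarrow> real) \<Rightarrow> ('s \<Rightarrow> bool) \<Rightarrow> real" where
  "av x f \<eta> = p * f (\<eta>(x := True)) + (1 - p) * f (\<eta>(x := False))"

fun avs :: "'s list \<Rightarrow> (('s \<Rightarrow> bool) \<Rightarrow> real) \<Rightarrow> ('s \<Rightarrow> bool) \<Rightarrow> real" where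
  "avs [] f = f"
| "avs (x # xs) f = avs xs (av x f)"

lemma av_abs_le: "(\<And>\<zeta>. \<bar>f \<zeta>\<bar> \<le> M) \<Longrightarrow> \<bar>av x f \<eta>\<bar> \<le> M"
proof -
  assume *: "\<And>\<zeta>. \<bar>f \<zeta>\<bar> \<le> M"
  have "\<bar>av x f \<eta>\<bar> \<le> p * \<bar>f (\<eta>(x := True))\<bar> + (1 - p) * \<bar>f (\<eta>(x := False))\<bar>"
    unfolding av_def using p0 p1 by (intro order_trans[OF abs_triangle_ineq]) (simp add: abs_mult)
  also have "\<dots> \<le> M" using * p0 p1 by (intro convex_bound_le) auto
  finally show ?thesis .
qed

end

context oriented
begin

text \<open>Telescopes over the sites. The decreasing order of ranks ensures that
  \<open>f - av x f\<close> involves, besides \<open>x\<close>, only sites of no higher rank, as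
  \<open>EE_centered_le\<close> demands; its sup norm is at most \<open>2 * M\<close>.\<close>

theorem EE_last_minus_avs:
  assumes "sorted_wrt (\<lambda>x y. rk y \<le> rk x) xs"
    and "\<And>\<zeta> \<zeta>'. \<forall>x\<in>set xs. \<zeta> x = \<zeta>' x \<Longrightarrow> f \<zeta> = f \<zeta>'" and "\<And>\<zeta>. \<bar>f \<zeta>\<bar> \<le> M"
  shows "\<bar>EE L \<eta> (\<lambda>tr. f (last tr)) - avs xs f \<zeta>\<bar> \<le> (\<Sum>x\<leftarrow>xs. 2 * M * EE L \<eta> (\<lambda>tr. NU (rings x L) (facs x tr)))"
  using assms
proof (induction xs arbitrary: f)
  case Nil
  then have "f = (\<lambda>_. f \<zeta>)" by auto
  then have "EE L \<eta> (\<lambda>tr. f (last tr)) = EE L \<eta> (\<lambda>tr. f \<zeta>)" by metis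
  then show ?case by (simp add: EE_const)
next
  case (Cons x xs)
  let ?N = "EE L \<eta> (\<lambda>tr. NU (rings x L) (facs x tr))"
  define g where "g = (\<lambda>\<zeta>. f \<zeta> - av x f \<zeta>)"
  have dep: "av x f \<zeta> = av x f \<zeta>'" if "\<forall>z\<in>set xs. \<zeta> z = \<zeta>' z" for \<zeta> \<zeta>'
  proof -
    have "f (\<zeta>(x := b)) = f (\<zeta>'(x := b))" for b using that by (intro Cons.prems(2)) auto
    then show ?thesis by (simp add: av_def)
  qed
  have 1: "\<bar>EE L \<eta> (\<lambda>tr. g (last tr))\<bar> \<le> (2 * M) * ?N"
  proof (rule EE_centered_le)
    show "g \<zeta> = g \<zeta>'" if "\<forall>z. rk z \<le> rk x \<longrightarrow> \<zeta> z = \<zeta>' z" for \<zeta> \<zeta>'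
    proof -
      have "f \<zeta> = f \<zeta>'" by (rule Cons.prems(2)) (use that Cons.prems(1) in auto)
      moreover have "av x f \<zeta> = av x f \<zeta>'" by (rule dep) (use that Cons.prems(1) in auto)
      ultimately show ?thesis by (simp add: g_def)
    qed
    show "p * g (\<zeta>(x := True)) + (1 - p) * g (\<zeta>(x := False)) = 0" for \<zeta>
      by (simp add: g_def av_def algebra_simps)
    show "\<bar>g \<zeta>\<bar> \<le> 2 * M" for \<zeta>
      using Cons.prems(3)[of \<zeta>] av_abs_le[of f M x \<zeta>, OF Cons.prems(3)] by (simp add: g_def)
  qed
  have 2: "\<bar>EE L \<eta> (\<lambda>tr. av x f (last tr)) - avs xs (av x f) \<zeta>\<bar> \<le> (\<Sum>x\<leftarrow>xs. 2 * M * EE L \<eta> (\<lambda>tr. NU (rings x L) (facs x tr)))"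
  proof (rule Cons.IH)
    show "\<bar>av x f \<zeta>\<bar> \<le> M" for \<zeta> by (rule av_abs_le[OF Cons.prems(3)])
  qed (use Cons.prems(1) dep in auto)
  have "EE L \<eta> (\<lambda>tr. g (last tr)) = EE L \<eta> (\<lambda>tr. f (last tr)) - EE L \<eta> (\<lambda>tr. av x f (last tr))"
    unfolding g_def by (rule EE_diff)
  with 1 2 show ?case by simp
qed

end

section \<open>The spectral gap of the one-dimensional chain\<close>

context refresh
begin

definition indep :: "'s \<Rightarrow> (('s \<Rightarrow> bool) \<Rightarrow> 'b) \<Rightarrow> bool" where
  "indep x f \<longleftrightarrow> (\<forall>\<eta> b. f (\<eta>(x := b)) = f \<eta>)"

lemma av_add: "av x (\<lambda>\<eta>. f \<eta> + g \<eta>) = (\<lambda>\<eta>. av x f \<eta> + av x g \<eta>)"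
  by (auto simp: av_def algebra_simps)

lemma av_diff: "av x (\<lambda>\<eta>. f \<eta> - g \<eta>) = (\<lambda>\<eta>. av x f \<eta> - av x g \<eta>)"
  by (auto simp: av_def algebra_simps)

lemma av_mono: "(\<And>\<eta>. f \<eta> \<le> g \<eta>) \<Longrightarrow> av x f \<eta> \<le> av x g \<eta>"
  unfolding av_def using p0 p1 by (intro add_mono mult_left_mono) auto

lemma av_commute: "av x (av y f) = av y (av x f)"
proof (cases "x = y")
  case False
  then show ?thesis by (auto simp: av_def fun_upd_twist[of x y] algebra_simps)
qed simp

lemma av_indep: "indep x f \<Longrightarrow> av x f = f"
  by (auto simp: indep_def av_def algebra_simps)

lemma indep_av: "indep x (av x f)"
  by (simp add: indep_def av_def)

lemma indep_av': "indep y f \<Longrightarrow> indep y (av x f)"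
  by (cases "x = y") (auto simp: indep_def av_def fun_upd_twist)

lemma av_mult: "indep x c \<Longrightarrow> av x (\<lambda>\<eta>. c \<eta> * f \<eta>) = (\<lambda>\<eta>. c \<eta> * av x f \<eta>)"
  by (auto simp: indep_def av_def algebra_simps)

lemma avs_append: "avs (xs @ ys) f = avs ys (avs xs f)"
  by (induction xs arbitrary: f) auto

lemma av_avs: "av x (avs xs f) = avs xs (av x f)"
  by (induction xs arbitrary: f) (auto simp: av_commute)

lemma avs_commute: "avs xs (avs ys f) = avs ys (avs xs f)"
  by (induction xs arbitrary: f) (auto simp: av_avs)

lemma avs_add: "avs xs (\<lambda>\<eta>. f \<eta> + g \<eta>) = (\<lambda>\<eta>. avs xs f \<eta> + avs xs g \<eta>)"
  by (induction xs arbitrary: f g) (auto simp: av_add)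

lemma avs_diff: "avs xs (\<lambda>\<eta>. f \<eta> - g \<eta>) = (\<lambda>\<eta>. avs xs f \<eta> - avs xs g \<eta>)"
  by (induction xs arbitrary: f g) (auto simp: av_diff)

lemma avs_mono: "(\<And>\<eta>. f \<eta> \<le> g \<eta>) \<Longrightarrow> avs xs f \<eta> \<le> avs xs g \<eta>"
  by (induction xs arbitrary: f g) (auto simp: av_mono)

lemma indep_avs': "indep y f \<Longrightarrow> indep y (avs xs f)"
  by (induction xs arbitrary: f) (auto simp: indep_av')

lemma indep_avs: "x \<in> set xs \<Longrightarrow> indep x (avs xs f)"
  by (induction xs arbitrary: f) (auto simp: indep_av indep_avs')

lemma avs_mult: "(\<And>x. x \<in> set xs \<Longrightarrow> indep x c) \<Longrightarrow> avs xs (\<lambda>\<eta>. c \<eta> * f \<eta>) = (\<lambda>\<eta>. c \<eta> * avs xs f \<eta>)"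
  by (induction xs arbitrary: f) (auto simp: av_mult)

lemma avs_scale: "avs xs (\<lambda>\<eta>. (a::real) * f \<eta>) = (\<lambda>\<eta>. a * avs xs f \<eta>)"
  by (rule avs_mult) (simp add: indep_def)

lemma avs_indep: "(\<And>x. x \<in> set xs \<Longrightarrow> indep x f) \<Longrightarrow> avs xs f = f"
  by (induction xs) (auto simp: av_indep)

lemma avs_const: "avs xs (\<lambda>_. a) = (\<lambda>_. a)"
  by (rule avs_indep) (simp add: indep_def)

lemma avs_absorb: "set ys \<subseteq> set xs \<Longrightarrow> avs xs (avs ys f) = avs xs f"
proof -
  assume "set ys \<subseteq> set xs"
  then have "avs ys (avs xs f) = avs xs f" by (intro avs_indep indep_avs) auto
  then show ?thesis by (simp add: avs_commute)
qed

lemma avs_square_mean: "(avs xs f \<eta>)\<^sup>2 \<le> avs xs (\<lambda>\<eta>. (f \<eta>)\<^sup>2) \<eta>"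
proof (induction xs arbitrary: f)
  case (Cons x xs)
  have "(avs xs (av x f) \<eta>)\<^sup>2 \<le> avs xs (\<lambda>\<eta>. (av x f \<eta>)\<^sup>2) \<eta>" by (rule Cons)
  also have "\<dots> \<le> avs xs (av x (\<lambda>\<eta>. (f \<eta>)\<^sup>2)) \<eta>"
  proof (rule avs_mono)
    fix \<eta>
    have "0 \<le> p * (1 - p) * (f (\<eta>(x := True)) - f (\<eta>(x := False)))\<^sup>2"
      using p0 p1 by simp
    then show "(av x f \<eta>)\<^sup>2 \<le> av x (\<lambda>\<eta>. (f \<eta>)\<^sup>2) \<eta>"
      by (simp add: av_def power2_eq_square algebra_simps)
  qed
  finally show ?case by simp
qed simp

text \<open>Discriminant criterion, used for the Cauchy-Schwarz inequality of the averages and later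
  for that of the quadratic form of the transfer operator.\<close>

lemma quadratic_nonneg_imp:
  fixes a b c :: real
  assumes "\<And>s. 0 \<le> a + 2 * s * b + s\<^sup>2 * c"
  shows "b\<^sup>2 \<le> a * c"
proof (cases "c = 0")
  case True
  show ?thesis
  proof (cases "b = 0")
    case False
    then show ?thesis using assms[of "(- a - 1) / (2 * b)"] True by (simp add: field_simps)
  qed (use True in auto)
next
  case False
  have "0 \<le> c"
  proof (rule ccontr)
    assume "\<not> 0 \<le> c"
    then have c: "c < 0" by simp
    \<comment> \<open>Beyond this point the negative quadratic term dominates the others;
      \<open>s\<close> is at least 1 so that the constant term is bounded by
      \<bar>\<open>a\<close>\<bar> times \<open>s\<close>.\<close>
    define s where "s = max 1 ((\<bar>a\<bar> + 2 * \<bar>b\<bar> + 1) / - c)"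
    have s: "1 \<le> s" "\<bar>a\<bar> + 2 * \<bar>b\<bar> + 1 \<le> s * - c" using c by (auto simp: s_def field_simps max_def)
    have "a + 2 * s * b + s\<^sup>2 * c \<le> \<bar>a\<bar> * s + 2 * s * \<bar>b\<bar> + s * (s * c)"
      using s(1) mult_right_mono[of 1 s "\<bar>a\<bar>"] by (intro add_mono) (auto simp: power2_eq_square mult.commute)
    also have "\<dots> = s * (\<bar>a\<bar> + 2 * \<bar>b\<bar> + s * c)" by (simp add: algebra_simps)
    also have "\<dots> < 0" using s by (intro mult_pos_neg) auto
    finally show False using assms[of s] by simp
  qed
  with False have c: "0 < c" by simp
  have "0 \<le> a + 2 * (- b / c) * b + (- b / c)\<^sup>2 * c" by (rule assms)
  then have "0 \<le> (a * c - b\<^sup>2) / c" using c by (simp add: field_simps power2_eq_square)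
  then show ?thesis using c by (simp add: zero_le_divide_iff)
qed

lemma avs_Cauchy_Schwarz:
  "(avs xs (\<lambda>\<eta>. f \<eta> * g \<eta>) \<eta>)\<^sup>2 \<le> avs xs (\<lambda>\<eta>. (f \<eta>)\<^sup>2) \<eta> * avs xs (\<lambda>\<eta>. (g \<eta>)\<^sup>2) \<eta>"
proof (rule quadratic_nonneg_imp)
  fix s
  have "0 = avs xs (\<lambda>_. 0) \<eta>" by (simp add: avs_const)
  also have "\<dots> \<le> avs xs (\<lambda>\<eta>. (f \<eta> + s * g \<eta>)\<^sup>2) \<eta>" by (rule avs_mono) simp
  also have "(\<lambda>\<eta>. (f \<eta> + s * g \<eta>)\<^sup>2) = (\<lambda>\<eta>. (f \<eta>)\<^sup>2 + ((2 * s) * (f \<eta> * g \<eta>) + s\<^sup>2 * (g \<eta>)\<^sup>2))"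
    by (auto simp: power2_eq_square algebra_simps)
  also have "avs xs \<dots> \<eta> = avs xs (\<lambda>\<eta>. (f \<eta>)\<^sup>2) \<eta> + 2 * s * avs xs (\<lambda>\<eta>. f \<eta> * g \<eta>) \<eta> + s\<^sup>2 * avs xs (\<lambda>\<eta>. (g \<eta>)\<^sup>2) \<eta>"
    by (simp only: avs_add avs_scale add.assoc)
  finally show "0 \<le> avs xs (\<lambda>\<eta>. (f \<eta>)\<^sup>2) \<eta> + 2 * s * avs xs (\<lambda>\<eta>. f \<eta> * g \<eta>) \<eta> + s\<^sup>2 * avs xs (\<lambda>\<eta>. (g \<eta>)\<^sup>2) \<eta>" .
qed

text \<open>Sites \<open>1..n\<close> are averaged; site 0 is the frozen boundary.\<close>

definition mean :: "nat \<Rightarrow> ((nat \<Rightarrow> bool) \<Rightarrow> real) \<Rightarrow> real" where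
  "mean n f = avs [1..<Suc n] f (\<lambda>_. False)"

abbreviation vac :: "nat \<Rightarrow> (nat \<Rightarrow> bool) \<Rightarrow> real" where
  "vac i \<eta> \<equiv> of_bool (\<not> \<eta> i)"

lemma mean_add: "mean n (\<lambda>\<eta>. f \<eta> + g \<eta>) = mean n f + mean n g"
  and mean_diff: "mean n (\<lambda>\<eta>. f \<eta> - g \<eta>) = mean n f - mean n g"
  and mean_scale: "mean n (\<lambda>\<eta>. a * f \<eta>) = a * mean n f"
  and mean_const: "mean n (\<lambda>_. a) = a"
  by (simp_all only: mean_def avs_add avs_diff avs_scale avs_const)

lemma mean_mono: "(\<And>\<eta>. f \<eta> \<le> g \<eta>) \<Longrightarrow> mean n f \<le> mean n g"
  unfolding mean_def by (rule avs_mono)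

lemma mean_nonneg: "(\<And>\<eta>. 0 \<le> f \<eta>) \<Longrightarrow> 0 \<le> mean n f"
  using mean_mono[of "\<lambda>_. 0" f n] by (simp add: mean_const)

lemma mean_avs: "set xs \<subseteq> {1..n} \<Longrightarrow> mean n (avs xs f) = mean n f"
  unfolding mean_def by (subst avs_absorb) auto

lemma mean_av: "1 \<le> i \<Longrightarrow> i \<le> n \<Longrightarrow> mean n (av i f) = mean n f"
  using mean_avs[of "[i]" n f] by simp

lemma mean_mult_avs:
  assumes "set xs \<subseteq> {1..n}" "\<And>x. x \<in> set xs \<Longrightarrow> indep x w"
  shows "mean n (\<lambda>\<eta>. w \<eta> * avs xs f \<eta>) = mean n (\<lambda>\<eta>. w \<eta> * f \<eta>)"
  using mean_avs[OF assms(1), of "\<lambda>\<eta>. w \<eta> * f \<eta>"] avs_mult[of xs w f, OF assms(2)] by simp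

text \<open>Pythagoras: since \<open>w\<close> does not involve the averaged sites,
  \<open>avs xs\<close> is an orthogonal projection for the weighted form as well.\<close>

lemma mean_var:
  assumes "set xs \<subseteq> {1..n}" "\<And>x. x \<in> set xs \<Longrightarrow> indep x w"
  shows "mean n (\<lambda>\<eta>. w \<eta> * (f \<eta> - avs xs f \<eta>)\<^sup>2) = mean n (\<lambda>\<eta>. w \<eta> * (f \<eta>)\<^sup>2) - mean n (\<lambda>\<eta>. w \<eta> * (avs xs f \<eta>)\<^sup>2)"
proof -
  have i: "indep x (\<lambda>\<eta>. w \<eta> * avs xs f \<eta>)" if "x \<in> set xs" for x
    using assms(2)[OF that] indep_avs[OF that, of f] by (simp add: indep_def)
  have "mean n (\<lambda>\<eta>. (w \<eta> * avs xs f \<eta>) * avs xs f \<eta>) = mean n (\<lambda>\<eta>. (w \<eta> * avs xs f \<eta>) * f \<eta>)"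
    by (rule mean_mult_avs[OF assms(1) i])
  then have e: "mean n (\<lambda>\<eta>. w \<eta> * (avs xs f \<eta>)\<^sup>2) = mean n (\<lambda>\<eta>. w \<eta> * (f \<eta> * avs xs f \<eta>))"
    by (simp add: power2_eq_square mult_ac)
  have "(\<lambda>\<eta>. w \<eta> * (f \<eta> - avs xs f \<eta>)\<^sup>2) =
     (\<lambda>\<eta>. (w \<eta> * (f \<eta>)\<^sup>2 - 2 * (w \<eta> * (f \<eta> * avs xs f \<eta>))) + w \<eta> * (avs xs f \<eta>)\<^sup>2)"
    by (auto simp: power2_eq_square algebra_simps)
  then have "mean n (\<lambda>\<eta>. w \<eta> * (f \<eta> - avs xs f \<eta>)\<^sup>2) =
     mean n (\<lambda>\<eta>. w \<eta> * (f \<eta>)\<^sup>2) - 2 * mean n (\<lambda>\<eta>. w \<eta> * (f \<eta> * avs xs f \<eta>)) + mean n (\<lambda>\<eta>. w \<eta> * (avs xs f \<eta>)\<^sup>2)"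
    by (simp only: mean_add mean_diff mean_scale)
  then show ?thesis using e by simp
qed

lemma mean_avs_square_le:
  assumes "set xs \<subseteq> {1..n}" "\<And>x. x \<in> set xs \<Longrightarrow> indep x w" "\<And>\<eta>. 0 \<le> w \<eta>"
  shows "mean n (\<lambda>\<eta>. w \<eta> * (avs xs f \<eta>)\<^sup>2) \<le> mean n (\<lambda>\<eta>. w \<eta> * (f \<eta>)\<^sup>2)"
proof -
  have "mean n (\<lambda>\<eta>. w \<eta> * (avs xs f \<eta>)\<^sup>2) \<le> mean n (\<lambda>\<eta>. w \<eta> * avs xs (\<lambda>\<eta>. (f \<eta>)\<^sup>2) \<eta>)"
    by (intro mean_mono mult_left_mono avs_square_mean assms)
  then show ?thesis using mean_mult_avs[OF assms(1,2), of "\<lambda>\<eta>. (f \<eta>)\<^sup>2"] by simp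
qed

lemma mean_var_mono:
  assumes "set xs \<subseteq> {1..n}" "set ys \<subseteq> set xs" "\<And>x. x \<in> set xs \<Longrightarrow> indep x w" "\<And>\<eta>. 0 \<le> w \<eta>"
  shows "mean n (\<lambda>\<eta>. w \<eta> * (f \<eta> - avs ys f \<eta>)\<^sup>2) \<le> mean n (\<lambda>\<eta>. w \<eta> * (f \<eta> - avs xs f \<eta>)\<^sup>2)"
proof -
  have "mean n (\<lambda>\<eta>. w \<eta> * (avs xs (avs ys f) \<eta>)\<^sup>2) \<le> mean n (\<lambda>\<eta>. w \<eta> * (avs ys f \<eta>)\<^sup>2)"
    by (rule mean_avs_square_le) (use assms in auto)
  moreover have "mean n (\<lambda>\<eta>. w \<eta> * (f \<eta> - avs ys f \<eta>)\<^sup>2) = mean n (\<lambda>\<eta>. w \<eta> * (f \<eta>)\<^sup>2) - mean n (\<lambda>\<eta>. w \<eta> * (avs ys f \<eta>)\<^sup>2)"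
    by (rule mean_var) (use assms in auto)
  moreover have "mean n (\<lambda>\<eta>. w \<eta> * (f \<eta> - avs xs f \<eta>)\<^sup>2) = mean n (\<lambda>\<eta>. w \<eta> * (f \<eta>)\<^sup>2) - mean n (\<lambda>\<eta>. w \<eta> * (avs xs f \<eta>)\<^sup>2)"
    by (rule mean_var) (use assms in auto)
  ultimately show ?thesis using assms by (simp add: avs_absorb)
qed

section \<open>Dirichlet form and Poincare inequalities\<close>

definition Dir :: "nat \<Rightarrow> nat \<Rightarrow> ((nat \<Rightarrow> bool) \<Rightarrow> real) \<Rightarrow> real" where
  "Dir n i f = mean n (\<lambda>\<eta>. vac (i - 1) \<eta> * (f \<eta> - av i f \<eta>)\<^sup>2)"

lemma Dir_nonneg: "0 \<le> Dir n i f"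
  unfolding Dir_def by (rule mean_nonneg) simp

text \<open>Growth factor of the local Poincare constant per added site: 1 for the variance over the
  earlier sites, and 2 / (1-p)^2 for the price of introducing the constraint at the new
  site.\<close>

definition gam :: real where "gam = 1 + 2 / (1 - p)\<^sup>2"

lemma indep_vac: "i \<noteq> j \<Longrightarrow> indep i (vac j)"
  by (auto simp: indep_def)

lemma indep_mult: "indep i f \<Longrightarrow> indep i g \<Longrightarrow> indep i (\<lambda>\<eta>. f \<eta> * (g \<eta> :: real))"
  by (simp add: indep_def)

text \<open>The variance over one more site splits into the variance \<open>X\<close> over the old
  block and the variance \<open>Y\<close> of the block average at the new site \<open>m\<close>. The
  Dirichlet term at \<open>m\<close> requires a zero at \<open>m - 1\<close>; this constraint is
  inserted through its indicator \<open>c\<close>, of mean \<open>1 - p\<close>, at the cost of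
  another multiple of \<open>X\<close>. The constant is exponential in the length, so the estimate
  is applied to blocks of bounded length only.\<close>

lemma box_Poincare:
  "a + r \<le> n \<Longrightarrow>
   mean n (\<lambda>\<eta>. vac a \<eta> * (f \<eta> - avs [a+1..<a+r+1] f \<eta>)\<^sup>2) \<le> gam ^ r * (\<Sum>i\<in>{a+1..a+r}. Dir n i f)"
proof (induction r)
  case 0
  then show ?case by (simp add: mean_const)
next
  case (Suc r)
  let ?q = "1 - p"
  define A where "A = [a+1..<a+r+1]"
  define m where "m = a + r + 1"
  have A: "set A \<subseteq> {1..n}" "m \<notin> set A" "a \<notin> set A" and m: "1 \<le> m" "m \<le> n" "m \<noteq> a"
    using Suc.prems by (auto simp: A_def m_def)
  have split: "[a+1..<a+Suc r+1] = A @ [m]" by (simp add: A_def m_def)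
  define X where "X = mean n (\<lambda>\<eta>. vac a \<eta> * (f \<eta> - avs A f \<eta>)\<^sup>2)"
  define g where "g = (\<lambda>\<eta>. f \<eta> - av m f \<eta>)"
  define Y where "Y = mean n (\<lambda>\<eta>. vac a \<eta> * (avs A g \<eta>)\<^sup>2)"
  have wA: "indep x (vac a)" if "x \<in> set A" for x using that A by (intro indep_vac) auto
  have wm: "indep m (vac a)" using m by (intro indep_vac) auto
  have gA: "avs A g = (\<lambda>\<eta>. avs A f \<eta> - av m (avs A f) \<eta>)"
    unfolding g_def avs_diff av_avs ..
  have "mean n (\<lambda>\<eta>. vac a \<eta> * (f \<eta> - avs (A @ [m]) f \<eta>)\<^sup>2) = X + Y"
  proof -
    have "mean n (\<lambda>\<eta>. vac a \<eta> * (f \<eta> - avs (A @ [m]) f \<eta>)\<^sup>2) =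
        mean n (\<lambda>\<eta>. vac a \<eta> * (f \<eta>)\<^sup>2) - mean n (\<lambda>\<eta>. vac a \<eta> * (avs (A @ [m]) f \<eta>)\<^sup>2)"
      by (rule mean_var) (use A m wA wm in auto)
    moreover have "X = mean n (\<lambda>\<eta>. vac a \<eta> * (f \<eta>)\<^sup>2) - mean n (\<lambda>\<eta>. vac a \<eta> * (avs A f \<eta>)\<^sup>2)"
      unfolding X_def by (rule mean_var) (use A wA in auto)
    moreover have "Y = mean n (\<lambda>\<eta>. vac a \<eta> * (avs A f \<eta>)\<^sup>2) - mean n (\<lambda>\<eta>. vac a \<eta> * (avs [m] (avs A f) \<eta>)\<^sup>2)"
      using mean_var[of "[m]" n "vac a" "avs A f"] m wm unfolding Y_def gA by simp
    ultimately show ?thesis by (simp add: avs_append)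
  qed
  moreover have "Y \<le> (2 / ?q\<^sup>2) * (Dir n m f + X)"
  proof (cases "r = 0")
    \<comment> \<open>With an empty block the neighbour of \<open>m\<close> is \<open>a\<close>,
      whose zero is already part of the weight.\<close>
    case True
    then have "Y = Dir n m f" by (simp add: Y_def Dir_def g_def A_def m_def)
    moreover have "1 \<le> 2 / ?q\<^sup>2"
    proof -
      have "?q\<^sup>2 \<le> 1" using p0 p1 by (simp add: power_le_one)
      then show ?thesis using p1 by (simp add: field_simps)
    qed
    moreover have "0 \<le> X" unfolding X_def by (rule mean_nonneg) simp
    ultimately show ?thesis using Dir_nonneg[of n m f] p1
      by (smt (verit) mult_le_cancel_right1 mult_nonneg_nonneg)
  next
    case False
    define c where "c = vac (a + r)"
    have ar: "a + r \<in> set A" using False by (auto simp: A_def)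
    have c01: "c \<eta> = 0 \<or> c \<eta> = 1" for \<eta> by (simp add: c_def)
    have Ac: "avs A c = (\<lambda>_. ?q)"
    proof -
      have 1: "av (a + r) c = (\<lambda>_. ?q)" by (auto simp: c_def av_def)
      have "avs A c = avs A (avs [a + r] c)" using ar by (subst avs_absorb) auto
      then show ?thesis by (simp add: 1 avs_const)
    qed
    have key: "?q\<^sup>2 * (avs A g \<eta>)\<^sup>2 \<le> 2 * avs A (\<lambda>\<eta>. c \<eta> * (g \<eta>)\<^sup>2) \<eta> + 2 * avs A (\<lambda>\<eta>. (g \<eta> - avs A g \<eta>)\<^sup>2) \<eta>" for \<eta>
    proof -
      \<comment> \<open>Decoupling of \<open>c\<close> from \<open>g\<close>: the product (1-p)
        \<open>g\<close> is \<open>c g\<close> plus \<open>u\<close> plus a term proportional to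
        \<open>1 - p - c\<close> with a coefficient constant on the block, and this last term
        averages to zero.\<close>
      define u where "u = (\<lambda>\<eta>. (?q - c \<eta>) * (g \<eta> - avs A g \<eta>))"
      have ig: "indep x (avs A g)" if "x \<in> set A" for x using that by (rule indep_avs)
      have "avs A (\<lambda>\<eta>. avs A g \<eta> * (?q - c \<eta>)) = (\<lambda>\<eta>. avs A g \<eta> * avs A (\<lambda>\<eta>. ?q - c \<eta>) \<eta>)"
        by (rule avs_mult[OF ig])
      also have "\<dots> = (\<lambda>_. 0)" by (simp add: avs_diff avs_const Ac)
      finally have z: "avs A (\<lambda>\<eta>. avs A g \<eta> * (?q - c \<eta>)) = (\<lambda>_. 0)" .
      have "(\<lambda>\<eta>. ?q * g \<eta>) = (\<lambda>\<eta>. c \<eta> * g \<eta> + (u \<eta> + avs A g \<eta> * (?q - c \<eta>)))"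
        by (auto simp: u_def algebra_simps)
      then have "avs A (\<lambda>\<eta>. ?q * g \<eta>) = avs A (\<lambda>\<eta>. c \<eta> * g \<eta> + (u \<eta> + avs A g \<eta> * (?q - c \<eta>)))" by simp
      then have "?q * avs A g \<eta> = avs A (\<lambda>\<eta>. c \<eta> * g \<eta>) \<eta> + avs A u \<eta>"
        by (simp only: avs_scale avs_add z add_0_right) (metis add.right_neutral)
      then have "?q\<^sup>2 * (avs A g \<eta>)\<^sup>2 = (avs A (\<lambda>\<eta>. c \<eta> * g \<eta>) \<eta> + avs A u \<eta>)\<^sup>2"
        by (metis power_mult_distrib)
      also have "\<dots> \<le> 2 * (avs A (\<lambda>\<eta>. c \<eta> * g \<eta>) \<eta>)\<^sup>2 + 2 * (avs A u \<eta>)\<^sup>2"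
        using sum_squares_bound[of "avs A (\<lambda>\<eta>. c \<eta> * g \<eta>) \<eta>" "avs A u \<eta>"] by (simp add: power2_sum)
      also have "(avs A (\<lambda>\<eta>. c \<eta> * g \<eta>) \<eta>)\<^sup>2 \<le> avs A (\<lambda>\<eta>. (c \<eta> * g \<eta>)\<^sup>2) \<eta>" by (rule avs_square_mean)
      also have "(\<lambda>\<eta>. (c \<eta> * g \<eta>)\<^sup>2) = (\<lambda>\<eta>. c \<eta> * (g \<eta>)\<^sup>2)"
      proof
        show "(c \<eta> * g \<eta>)\<^sup>2 = c \<eta> * (g \<eta>)\<^sup>2" for \<eta> using c01[of \<eta>] by auto
      qed
      also have "(avs A u \<eta>)\<^sup>2 \<le> avs A (\<lambda>\<eta>. (u \<eta>)\<^sup>2) \<eta>" by (rule avs_square_mean)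
      also have "\<dots> \<le> avs A (\<lambda>\<eta>. (g \<eta> - avs A g \<eta>)\<^sup>2) \<eta>"
      proof (rule avs_mono)
        fix \<eta>
        have "(?q - c \<eta>)\<^sup>2 \<le> 1" using c01[of \<eta>] p0 p1 by (auto simp: abs_square_le_1)
        then show "(u \<eta>)\<^sup>2 \<le> (g \<eta> - avs A g \<eta>)\<^sup>2"
          by (simp add: u_def power_mult_distrib mult_left_le_one_le)
      qed
      finally show ?thesis by simp
    qed
    have "?q\<^sup>2 * Y = mean n (\<lambda>\<eta>. vac a \<eta> * (?q\<^sup>2 * (avs A g \<eta>)\<^sup>2))"
      unfolding Y_def mean_scale[symmetric] by (simp add: mult_ac)
    also have "\<dots> \<le> mean n (\<lambda>\<eta>. vac a \<eta> * (2 * avs A (\<lambda>\<eta>. c \<eta> * (g \<eta>)\<^sup>2) \<eta> + 2 * avs A (\<lambda>\<eta>. (g \<eta> - avs A g \<eta>)\<^sup>2) \<eta>))"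
      by (intro mean_mono mult_left_mono key) simp
    also have "\<dots> = 2 * mean n (\<lambda>\<eta>. vac a \<eta> * avs A (\<lambda>\<eta>. c \<eta> * (g \<eta>)\<^sup>2) \<eta>)
         + 2 * mean n (\<lambda>\<eta>. vac a \<eta> * avs A (\<lambda>\<eta>. (g \<eta> - avs A g \<eta>)\<^sup>2) \<eta>)"
      unfolding mean_scale[symmetric] mean_add[symmetric] by (simp add: algebra_simps)
    also have "\<dots> = 2 * mean n (\<lambda>\<eta>. vac a \<eta> * (c \<eta> * (g \<eta>)\<^sup>2)) + 2 * mean n (\<lambda>\<eta>. vac a \<eta> * (g \<eta> - avs A g \<eta>)\<^sup>2)"
      using mean_mult_avs[OF A(1) wA] by simp
    also have "mean n (\<lambda>\<eta>. vac a \<eta> * (c \<eta> * (g \<eta>)\<^sup>2)) \<le> Dir n m f"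
      unfolding Dir_def by (rule mean_mono) (simp add: m_def c_def g_def)
    also have "mean n (\<lambda>\<eta>. vac a \<eta> * (g \<eta> - avs A g \<eta>)\<^sup>2) \<le> X"
    proof -
      define h where "h = (\<lambda>\<eta>. f \<eta> - avs A f \<eta>)"
      have "(\<lambda>\<eta>. g \<eta> - avs A g \<eta>) = (\<lambda>\<eta>. h \<eta> - avs [m] h \<eta>)"
        unfolding gA by (simp add: g_def h_def av_diff fun_eq_iff)
      then have "mean n (\<lambda>\<eta>. vac a \<eta> * (g \<eta> - avs A g \<eta>)\<^sup>2) = mean n (\<lambda>\<eta>. vac a \<eta> * (h \<eta> - avs [m] h \<eta>)\<^sup>2)"
        by (simp add: fun_eq_iff)
      also have "\<dots> \<le> mean n (\<lambda>\<eta>. vac a \<eta> * (h \<eta>)\<^sup>2)"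
        using mean_var[of "[m]" n "vac a" h] m wm mean_nonneg[of "\<lambda>\<eta>. vac a \<eta> * (avs [m] h \<eta>)\<^sup>2" n] by simp
      finally show ?thesis by (simp add: X_def h_def)
    qed
    finally have "?q\<^sup>2 * Y \<le> 2 * (Dir n m f + X)" by simp
    then show ?thesis using p1 by (simp add: field_simps)
  qed
  ultimately have "mean n (\<lambda>\<eta>. vac a \<eta> * (f \<eta> - avs [a+1..<a+Suc r+1] f \<eta>)\<^sup>2) \<le> gam * X + (2 / ?q\<^sup>2) * Dir n m f"
    unfolding split by (simp add: gam_def algebra_simps add_divide_distrib)
  also have "\<dots> \<le> gam * (gam ^ r * (\<Sum>i\<in>{a+1..a+r}. Dir n i f)) + gam ^ Suc r * Dir n m f"
  proof (intro add_mono mult_left_mono mult_right_mono)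
    show "X \<le> gam ^ r * (\<Sum>i\<in>{a+1..a+r}. Dir n i f)" using Suc by (simp add: X_def A_def)
    have g1: "1 \<le> gam" by (simp add: gam_def)
    then show "0 \<le> gam" by simp
    have "2 / ?q\<^sup>2 \<le> gam * 1" by (simp add: gam_def)
    also have "\<dots> \<le> gam * gam ^ r" using g1 by (intro mult_left_mono one_le_power) auto
    finally show "2 / ?q\<^sup>2 \<le> gam ^ Suc r" by simp
  qed (rule Dir_nonneg)
  also have "\<dots> = gam ^ Suc r * (\<Sum>i\<in>{a+1..a+Suc r}. Dir n i f)"
    by (simp add: m_def algebra_simps)
  finally show ?case .
qed

lemma avs_all_True: "distinct xs \<Longrightarrow> avs xs (\<lambda>\<eta>. of_bool (\<forall>i\<in>set xs. \<eta> i)) = (\<lambda>_. p ^ length xs)"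
proof (induction xs)
  case (Cons x xs)
  have "av x (\<lambda>\<eta>. of_bool (\<forall>i\<in>set (x # xs). \<eta> i)) = (\<lambda>\<eta>. p * of_bool (\<forall>i\<in>set xs. \<eta> i))"
    using Cons.prems by (auto simp: av_def fun_eq_iff)
  then show ?case using Cons by (simp add: avs_scale)
qed simp

lemma gam_ge_1: "1 \<le> gam"
  by (simp add: gam_def)

lemma sum_Dir_mono: "S \<subseteq> S' \<Longrightarrow> finite S' \<Longrightarrow> (\<Sum>i\<in>S. Dir n i f) \<le> (\<Sum>i\<in>S'. Dir n i f)"
  by (rule sum_mono2) (auto simp: Dir_nonneg)

text \<open>With \<open>F k\<close> the average of \<open>f\<close> over the first \<open>k\<close> blocks, the variance is the telescoping sum of the
  \<open>s k - s (Suc k)\<close>. A block contains a zero except with probability \<open>p\<^sup>l\<close>, and given this zero the local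
  variance over the next block is controlled by the Dirichlet form (\<open>box_Poincare\<close>); the exceptional event costs
  one quarter of two neighbouring increments, which is absorbed after summation.\<close>

lemma block_Poincare:
  fixes l m :: nat and f :: "(nat \<Rightarrow> bool) \<Rightarrow> real"
  assumes l: "p ^ l \<le> 1 / 8"
  defines "N \<equiv> m * l"
  shows "mean N (\<lambda>\<eta>. (f \<eta>)\<^sup>2) - (mean N f)\<^sup>2 \<le> 2 * ((2 * l + 1) * gam ^ (2 * l) * 2) * (\<Sum>i\<in>{1..N}. Dir N i f)"
proof -
  define F where "F k = avs [1..<k * l + 1] f" for k
  define B where "B k = [k * l + 1..<(k + 1) * l + 1]" for k
  define s where "s k = mean N (\<lambda>\<eta>. (F k \<eta>)\<^sup>2)" for k
  define D where "D k = (\<Sum>i\<in>{k * l + 1..(k + 1) * l}. Dir N i f)" for k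
  define \<Gamma> where "\<Gamma> = gam ^ (2 * l)"
  define c0 where "c0 = (2 * l + 1) * \<Gamma>"
  have \<Gamma>1: "1 \<le> \<Gamma>" unfolding \<Gamma>_def by (rule one_le_power[OF gam_ge_1])
  have D0: "0 \<le> D k" for k unfolding D_def by (intro sum_nonneg Dir_nonneg)
  have FS: "F (Suc k) = avs (B k) (F k)" for k
  proof -
    have "[1..<Suc k * l + 1] = [1..<k * l + 1] @ B k"
      unfolding B_def using upt_add_eq_append[of 1 "k * l + 1" l] by (simp add: algebra_simps)
    then show ?thesis by (simp add: F_def avs_append)
  qed
  have setB: "set (B k) = {k * l + 1..(k + 1) * l}" for k by (auto simp: B_def)
  have lenB: "distinct (B k)" "length (B k) = l" for k by (simp_all add: B_def del: upt.simps)
  have BN: "set (B k) \<subseteq> {1..N}" if "k < m" for k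
  proof -
    have "(k + 1) * l \<le> m * l" using that by (intro mult_right_mono) auto
    then show ?thesis by (auto simp: B_def N_def)
  qed
  have a: "s k - s (Suc k) = mean N (\<lambda>\<eta>. (F k \<eta> - F (Suc k) \<eta>)\<^sup>2)" if "k < m" for k
    using mean_var[OF BN[OF that], of "\<lambda>_. 1" "F k"] by (simp add: s_def FS indep_def)
  have a0: "0 \<le> s k - s (Suc k)" if "k < m" for k
    unfolding a[OF that] by (rule mean_nonneg) simp
  have base: "s 0 - s 1 \<le> c0 * D 0" if "0 < m"
  proof -
    have "s 0 - s 1 = mean N (\<lambda>\<eta>. (f \<eta> - avs [1..<l + 1] f \<eta>)\<^sup>2)"
      using a[OF that] by (simp add: F_def)
    also have "\<dots> = mean N (\<lambda>\<eta>. vac 0 \<eta> * (f \<eta> - avs [0+1..<0+l + 1] f \<eta>)\<^sup>2)"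
    proof -
      have "avs [1..<Suc N] (\<lambda>\<eta>. vac 0 \<eta> * h \<eta>) = (\<lambda>\<eta>. vac 0 \<eta> * avs [1..<Suc N] h \<eta>)" for h
        by (rule avs_mult) (auto intro!: indep_vac)
      then show ?thesis by (simp add: mean_def)
    qed
    also have "\<dots> \<le> gam ^ l * (\<Sum>i\<in>{0+1..0+l}. Dir N i f)"
      using that by (intro box_Poincare) (simp add: N_def)
    also have "\<dots> \<le> c0 * D 0"
    proof -
      have "gam ^ l \<le> \<Gamma>" unfolding \<Gamma>_def by (rule power_increasing) (auto simp: gam_ge_1)
      also have "\<dots> \<le> c0" using \<Gamma>1 by (simp add: c0_def)
      finally have "gam ^ l \<le> c0" .
      then have "gam ^ l * D 0 \<le> c0 * D 0" by (rule mult_right_mono[OF _ D0])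
      then show ?thesis by (simp add: D_def)
    qed
    finally show ?thesis .
  qed
  have step: "s (Suc k) - s (Suc (Suc k)) \<le> c0 * (D k + D (Suc k)) + 1 / 4 * (s k - s (Suc (Suc k)))" if k: "Suc k < m" for k
  proof -
    let ?B = "B k" and ?C = "B (Suc k)"
    define g where "g = (\<lambda>\<eta>. F k \<eta> - avs ?C (F k) \<eta>)"
    define c where "c = (\<lambda>\<eta>. of_bool (\<exists>i\<in>set ?B. \<not> \<eta> i) :: real)"
    define e where "e = (\<lambda>\<eta>. of_bool (\<forall>i\<in>set ?B. \<eta> i) :: real)"
    have BC: "set ?B \<subseteq> {1..N}" "set ?C \<subseteq> {1..N}" by (rule BN, use k in simp)+
    have ce: "c \<eta> + e \<eta> = 1" "c \<eta> = 0 \<or> c \<eta> = 1" "e \<eta> = 0 \<or> e \<eta> = 1" for \<eta> by (auto simp: c_def e_def)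
    have gB: "avs ?B g = (\<lambda>\<eta>. F (Suc k) \<eta> - F (Suc (Suc k)) \<eta>)"
      unfolding g_def avs_diff FS by (simp add: avs_commute)
    have ee: "avs ?B (\<lambda>\<eta>. (e \<eta>)\<^sup>2) = (\<lambda>_. p ^ l)"
    proof -
      have "(\<lambda>\<eta>. (e \<eta>)\<^sup>2) = e" by (auto simp: e_def)
      then show ?thesis using avs_all_True[OF lenB(1)[of k]] by (simp add: e_def lenB)
    qed
    \<comment> \<open>Splitting \<open>g\<close> by the presence of a zero in the block and squaring
      doubles the bound 1/8 on \<open>p ^ l\<close>, which gives the announced quarter.\<close>
    have pt: "(avs ?B g \<eta>)\<^sup>2 \<le> 2 * avs ?B (\<lambda>\<eta>. c \<eta> * (g \<eta>)\<^sup>2) \<eta> + 1 / 4 * avs ?B (\<lambda>\<eta>. (g \<eta>)\<^sup>2) \<eta>" for \<eta>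
    proof -
      have "g = (\<lambda>\<eta>. c \<eta> * g \<eta> + e \<eta> * g \<eta>)" using ce(1) by (metis mult_1 distrib_right)
      then have "avs ?B g \<eta> = avs ?B (\<lambda>\<eta>. c \<eta> * g \<eta>) \<eta> + avs ?B (\<lambda>\<eta>. e \<eta> * g \<eta>) \<eta>"
        by (metis avs_add)
      then have "(avs ?B g \<eta>)\<^sup>2 \<le> 2 * (avs ?B (\<lambda>\<eta>. c \<eta> * g \<eta>) \<eta>)\<^sup>2 + 2 * (avs ?B (\<lambda>\<eta>. e \<eta> * g \<eta>) \<eta>)\<^sup>2"
        using sum_squares_bound[of "avs ?B (\<lambda>\<eta>. c \<eta> * g \<eta>) \<eta>" "avs ?B (\<lambda>\<eta>. e \<eta> * g \<eta>) \<eta>"] by (simp add: power2_sum)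
      also have "(avs ?B (\<lambda>\<eta>. c \<eta> * g \<eta>) \<eta>)\<^sup>2 \<le> avs ?B (\<lambda>\<eta>. (c \<eta> * g \<eta>)\<^sup>2) \<eta>" by (rule avs_square_mean)
      also have "(\<lambda>\<eta>. (c \<eta> * g \<eta>)\<^sup>2) = (\<lambda>\<eta>. c \<eta> * (g \<eta>)\<^sup>2)"
      proof
        show "(c \<eta> * g \<eta>)\<^sup>2 = c \<eta> * (g \<eta>)\<^sup>2" for \<eta> using ce(2)[of \<eta>] by auto
      qed
      also have "(avs ?B (\<lambda>\<eta>. e \<eta> * g \<eta>) \<eta>)\<^sup>2 \<le> p ^ l * avs ?B (\<lambda>\<eta>. (g \<eta>)\<^sup>2) \<eta>"
        using avs_Cauchy_Schwarz[of ?B e g \<eta>] by (simp add: ee)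
      also have "\<dots> \<le> 1 / 8 * avs ?B (\<lambda>\<eta>. (g \<eta>)\<^sup>2) \<eta>"
      proof (rule mult_right_mono[OF l])
        show "0 \<le> avs ?B (\<lambda>\<eta>. (g \<eta>)\<^sup>2) \<eta>" using avs_mono[of "\<lambda>_. 0" "\<lambda>\<eta>. (g \<eta>)\<^sup>2" ?B \<eta>] by (simp add: avs_const)
      qed
      finally show ?thesis by simp
    qed
    have "s (Suc k) - s (Suc (Suc k)) = mean N (\<lambda>\<eta>. (avs ?B g \<eta>)\<^sup>2)"
      using a[OF k] by (simp add: gB)
    also have "\<dots> \<le> mean N (\<lambda>\<eta>. 2 * avs ?B (\<lambda>\<eta>. c \<eta> * (g \<eta>)\<^sup>2) \<eta> + 1 / 4 * avs ?B (\<lambda>\<eta>. (g \<eta>)\<^sup>2) \<eta>)"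
      by (rule mean_mono[OF pt])
    also have "\<dots> = 2 * mean N (\<lambda>\<eta>. c \<eta> * (g \<eta>)\<^sup>2) + 1 / 4 * mean N (\<lambda>\<eta>. (g \<eta>)\<^sup>2)"
      by (simp only: mean_add mean_scale mean_avs[OF BC(1)])
    also have "mean N (\<lambda>\<eta>. (g \<eta>)\<^sup>2) \<le> s k - s (Suc (Suc k))"
    proof -
      have "mean N (\<lambda>\<eta>. 1 * (g \<eta>)\<^sup>2) \<le> mean N (\<lambda>\<eta>. 1 * (F k \<eta> - avs (?B @ ?C) (F k) \<eta>)\<^sup>2)"
        unfolding g_def by (rule mean_var_mono) (use BC in \<open>auto simp: indep_def\<close>)
      also have "\<dots> = s k - s (Suc (Suc k))"
        using mean_var[of "?B @ ?C" N "\<lambda>_. 1" "F k"] BC by (simp add: s_def FS avs_append indep_def)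
      finally show ?thesis by simp
    qed
    also have "mean N (\<lambda>\<eta>. c \<eta> * (g \<eta>)\<^sup>2) \<le> l * (\<Gamma> * (D k + D (Suc k)))"
    proof -
      let ?P = "[1..<k * l + 1]"
      define h where "h = (\<lambda>\<eta>. f \<eta> - avs ?C f \<eta>)"
      have P: "set ?P \<subseteq> {1..N}"
      proof -
        have "k * l \<le> m * l" using k by (intro mult_right_mono) auto
        then have "x \<le> m * l" if "x < k * l + 1" for x using that by linarith
        then show ?thesis unfolding set_upt N_def by (simp add: subset_iff)
      qed
      have gh: "g = avs ?P h" unfolding g_def h_def avs_diff F_def by (simp only: avs_commute)
      have ci: "indep x c" if "x \<in> set ?P" for x
      proof -
        have "x \<notin> set ?B" using that by (auto simp: setB simp del: upt.simps)
        then have "(\<eta>(x := b)) i = \<eta> i" if "i \<in> set ?B" for \<eta> b i using that by auto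
        then have "(\<exists>i\<in>set ?B. \<not> (\<eta>(x := b)) i) \<longleftrightarrow> (\<exists>i\<in>set ?B. \<not> \<eta> i)" for \<eta> b
          by (metis (no_types))
        then show ?thesis unfolding indep_def c_def by simp
      qed
      have "mean N (\<lambda>\<eta>. c \<eta> * (g \<eta>)\<^sup>2) \<le> mean N (\<lambda>\<eta>. c \<eta> * (h \<eta>)\<^sup>2)"
        unfolding gh by (rule mean_avs_square_le[OF P ci]) (simp_all add: c_def)
      also have "\<dots> \<le> mean N (\<lambda>\<eta>. avs [] (\<lambda>\<eta>. \<Sum>i\<in>set ?B. vac i \<eta> * (h \<eta>)\<^sup>2) \<eta>)"
      proof (rule mean_mono)
        fix \<eta>
        show "c \<eta> * (h \<eta>)\<^sup>2 \<le> avs [] (\<lambda>\<eta>. \<Sum>i\<in>set ?B. vac i \<eta> * (h \<eta>)\<^sup>2) \<eta>"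
        proof (cases "\<exists>i\<in>set ?B. \<not> \<eta> i")
          case True
          then obtain i where i: "i \<in> set ?B" "\<not> \<eta> i" by blast
          have "c \<eta> * (h \<eta>)\<^sup>2 = vac i \<eta> * (h \<eta>)\<^sup>2" using i by (auto simp: c_def)
          also have "\<dots> \<le> (\<Sum>i\<in>set ?B. vac i \<eta> * (h \<eta>)\<^sup>2)"
            by (rule member_le_sum) (use i in auto)
          finally show ?thesis by simp
        next
          case False
          then show ?thesis by (simp add: c_def sum_nonneg)
        qed
      qed
      also have "\<dots> = (\<Sum>i\<in>set ?B. mean N (\<lambda>\<eta>. vac i \<eta> * (h \<eta>)\<^sup>2))"
      proof -
        have "mean N (\<lambda>\<eta>. \<Sum>i\<in>S. u i \<eta>) = (\<Sum>i\<in>S. mean N (u i))" if "finite S" for S :: "nat set" and u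
          using that by (induction S) (simp_all add: mean_const mean_add)
        from this[of "set ?B" "\<lambda>i \<eta>. vac i \<eta> * (h \<eta>)\<^sup>2"] show ?thesis by (simp only: avs.simps List.finite_set simp_thms)
      qed
      also have "\<dots> \<le> (\<Sum>i\<in>set ?B. \<Gamma> * (D k + D (Suc k)))"
      proof (rule sum_mono)
        fix i assume i: "i \<in> set ?B"
        \<comment> \<open>Distance from the zero \<open>i\<close> to the end of the next block, at
          most \<open>2 * l\<close>: the box inequality started at \<open>i\<close> covers this
          block entirely.\<close>
        define r where "r = (k + 2) * l - i"
        have ir: "i + r = (k + 2) * l" "r \<le> 2 * l" "k * l + 1 \<le> i" "i \<le> (k + 1) * l" using i by (auto simp: r_def B_def)
        have kN: "(k + 2) * l \<le> N" using k unfolding N_def by (intro mult_right_mono) auto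
        let ?X = "[i+1..<i+r+1]"
        have "mean N (\<lambda>\<eta>. vac i \<eta> * (h \<eta>)\<^sup>2) \<le> mean N (\<lambda>\<eta>. vac i \<eta> * (f \<eta> - avs ?X f \<eta>)\<^sup>2)"
          unfolding h_def
        proof (rule mean_var_mono)
          show "set ?C \<subseteq> set ?X" using ir by (auto simp: B_def)
          show "set ?X \<subseteq> {1..N}" using ir kN by auto
        qed (auto intro!: indep_vac)
        also have "\<dots> \<le> gam ^ r * (\<Sum>j\<in>{i+1..i+r}. Dir N j f)"
          by (rule box_Poincare) (use ir kN in simp)
        also have "\<dots> \<le> \<Gamma> * (\<Sum>j\<in>{k*l+1..(k+2)*l}. Dir N j f)"
        proof (intro mult_mono sum_Dir_mono)
          show "gam ^ r \<le> \<Gamma>" unfolding \<Gamma>_def using ir by (intro power_increasing gam_ge_1) auto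
        qed (use ir \<Gamma>1 in \<open>auto intro!: sum_nonneg Dir_nonneg\<close>)
        also have "(\<Sum>j\<in>{k*l+1..(k+2)*l}. Dir N j f) = D k + D (Suc k)"
        proof -
          have "{k*l+1..(k+2)*l} = {k*l+1..(k+1)*l} \<union> {Suc k*l+1..(Suc k+1)*l}" by (auto simp: algebra_simps)
          then show ?thesis unfolding D_def by (simp only:) (rule sum.union_disjoint; auto)
        qed
        finally show "mean N (\<lambda>\<eta>. vac i \<eta> * (h \<eta>)\<^sup>2) \<le> \<Gamma> * (D k + D (Suc k))" .
      qed
      also have "\<dots> = l * (\<Gamma> * (D k + D (Suc k)))" by (simp add: setB)
      finally show ?thesis .
    qed
    also have "2 * (l * (\<Gamma> * (D k + D (Suc k)))) \<le> c0 * (D k + D (Suc k))"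
      using D0[of k] D0[of "Suc k"] \<Gamma>1 by (simp add: c0_def algebra_simps)
    finally show ?thesis by simp
  qed
  have c00: "0 \<le> c0" using \<Gamma>1 by (simp add: c0_def)
  \<comment> \<open>With x_k for \<open>s k - s (Suc k)\<close>, \<open>step\<close> reads 3/2 x_j -
    1/2 x_(j-1) \<le> 2 \<open>c0\<close> (\<open>D (j-1) + D j\<close>). The additional half
    increment on the left is the potential that makes these inequalities add up; the subtracted
    \<open>D (j - 1)\<close> is the part of the budget still available for the next increment, every
    block being used twice.\<close>
  have tele: "s 0 - s j + (s (j - 1) - s j) / 2 \<le> 2 * (c0 * (2 * (\<Sum>k<j. D k) - D (j - 1)))" if "0 < j" "j \<le> m" for j
    using that
  proof (induction j)
    case (Suc j)
    show ?case
    proof (cases "j = 0")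
      case True
      have "0 \<le> c0 * D 0" using c00 D0 by simp
      moreover have "s 0 - s 1 \<le> c0 * D 0" using base Suc.prems by simp
      ultimately have "s 0 - s 1 + (s 0 - s 1) / 2 \<le> 2 * (c0 * D 0)" by (simp add: field_simps)
      then show ?thesis using True by simp
    next
      case False
      then obtain i where i: "j = Suc i" by (metis not0_implies_Suc)
      have "s j - s (Suc j) \<le> c0 * (D i + D j) + 1 / 4 * (s i - s (Suc j))"
        using step[of i] Suc.prems i by simp
      moreover have "s 0 - s j + (s i - s j) / 2 \<le> 2 * (c0 * (2 * (\<Sum>k<j. D k) - D i))"
        using Suc.IH Suc.prems i by simp
      ultimately have "s 0 - s (Suc j) + (s j - s (Suc j)) / 2
          \<le> 2 * (c0 * (2 * (\<Sum>k<j. D k) - D i)) + 2 * (c0 * (D i + D j))"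
        by (simp add: field_simps)
      also have "\<dots> = 2 * (c0 * (2 * (\<Sum>k<Suc j. D k) - D j))" by (simp add: algebra_simps)
      finally have "s 0 - s (Suc j) + (s j - s (Suc j)) / 2 \<le> 2 * (c0 * (2 * (\<Sum>k<Suc j. D k) - D j))" .
      then show ?thesis by simp
    qed
  qed simp
  have fin: "mean N (\<lambda>\<eta>. (F m \<eta>)\<^sup>2) = (mean N f)\<^sup>2"
  proof -
    have "avs [1..<Suc N] (\<lambda>\<eta>. (F m \<eta>)\<^sup>2) = (\<lambda>\<eta>. (F m \<eta>)\<^sup>2)"
    proof (rule avs_indep)
      fix x assume "x \<in> set [1..<Suc N]"
      then have "x \<in> set [1..<m * l + 1]" by (simp add: N_def del: upt.simps)
      then have "indep x (F m)" unfolding F_def by (rule indep_avs)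
      then show "indep x (\<lambda>\<eta>. (F m \<eta>)\<^sup>2)" by (simp add: indep_def)
    qed
    then show ?thesis by (simp add: mean_def F_def N_def del: upt.simps)
  qed
  have sumD: "(\<Sum>k<j. D k) = (\<Sum>i\<in>{1..j * l}. Dir N i f)" for j
  proof (induction j)
    case (Suc j)
    have "{1..Suc j * l} = {1..j * l} \<union> {j * l + 1..(j + 1) * l}" by auto
    then have "(\<Sum>i\<in>{1..Suc j * l}. Dir N i f) = (\<Sum>i\<in>{1..j * l}. Dir N i f) + D j"
      unfolding D_def by (simp only:) (rule sum.union_disjoint; auto)
    then show ?case using Suc by simp
  qed simp
  have s0: "s 0 = mean N (\<lambda>\<eta>. (f \<eta>)\<^sup>2)" by (simp add: s_def F_def)
  have sm: "s m = (mean N f)\<^sup>2" using fin by (simp add: s_def)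
  have "s 0 - s m \<le> 2 * (c0 * (2 * (\<Sum>k<m. D k)))"
  proof (cases "m = 0")
    case False
    then have "0 \<le> s (m - 1) - s m" using a0[of "m - 1"] by simp
    moreover have "0 \<le> c0 * D (m - 1)" using c00 D0 by simp
    moreover have "s 0 - s m + (s (m - 1) - s m) / 2 \<le> 2 * (c0 * (2 * (\<Sum>k<m. D k) - D (m - 1)))"
      using tele[of m] False by simp
    moreover have "c0 * (2 * (\<Sum>k<m. D k) - D (m - 1)) = c0 * (2 * (\<Sum>k<m. D k)) - c0 * D (m - 1)"
      by (simp add: algebra_simps)
    ultimately show ?thesis by (simp only: diff_divide_distrib right_diff_distrib)
  qed simp
  then show ?thesis
    unfolding s0 sm sumD by (simp add: c0_def \<Gamma>_def N_def)
qed

lemma mean_shrink: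
  assumes "n \<le> N" "\<And>i. n < i \<Longrightarrow> indep i f"
  shows "mean N f = mean n f"
proof -
  have "[1..<Suc N] = [1..<Suc n] @ [Suc n..<Suc N]"
    using upt_add_eq_append[of 1 "Suc n" "N - n"] assms(1) by simp
  moreover have "avs [Suc n..<Suc N] (avs [1..<Suc n] f) = avs [1..<Suc n] f"
    by (intro avs_indep indep_avs' assms(2)) auto
  ultimately show ?thesis unfolding mean_def by (simp only: avs_append)
qed

text \<open>The chain is padded to \<open>n * l\<close> sites so that it consists of whole blocks.
  The added sites do not enter \<open>f\<close>, and their Dirichlet terms vanish.\<close>

theorem Poincare:
  obtains C where "C > 0"
    "\<And>n f. (\<And>i. n < i \<Longrightarrow> indep i f) \<Longrightarrow>
       mean n (\<lambda>\<eta>. (f \<eta>)\<^sup>2) - (mean n f)\<^sup>2 \<le> C * (\<Sum>i\<in>{1..n}. Dir n i f)"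
proof -
  obtain l where l: "p ^ l \<le> 1 / 8"
    using real_arch_pow_inv[of "1/8" p] p1 by (auto intro: less_imp_le)
  have l0: "0 < l" using l by (cases l) auto
  define C where "C = 2 * ((2 * real l + 1) * gam ^ (2 * l) * 2)"
  have C: "0 < C" using gam_ge_1 by (simp add: C_def)
  show ?thesis
  proof (rule that[OF C])
    fix n :: nat and f :: "(nat \<Rightarrow> bool) \<Rightarrow> real"
    assume ind: "\<And>i. n < i \<Longrightarrow> indep i f"
    define N where "N = n * l"
    have nN: "n \<le> N" using l0 by (simp add: N_def)
    have "mean N (\<lambda>\<eta>. (f \<eta>)\<^sup>2) - (mean N f)\<^sup>2 \<le> C * (\<Sum>i\<in>{1..N}. Dir N i f)"
      unfolding N_def C_def using block_Poincare[OF l, of n f] by (simp add: algebra_simps)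
    moreover have "mean N (\<lambda>\<eta>. (f \<eta>)\<^sup>2) = mean n (\<lambda>\<eta>. (f \<eta>)\<^sup>2)"
      by (rule mean_shrink[OF nN]) (use ind in \<open>simp add: indep_def\<close>)
    moreover have "mean N f = mean n f" by (rule mean_shrink[OF nN ind])
    moreover have "(\<Sum>i\<in>{1..N}. Dir N i f) = (\<Sum>i\<in>{1..n}. Dir n i f)"
    proof (rule sum.mono_neutral_cong_right)
      show "\<forall>i\<in>{1..N} - {1..n}. Dir N i f = 0"
      proof
        fix i assume "i \<in> {1..N} - {1..n}"
        then have "av i f = f" using ind by (intro av_indep) auto
        then show "Dir N i f = 0" by (simp add: Dir_def mean_const)
      qed
      fix i assume i: "i \<in> {1..n}"
      show "Dir N i f = Dir n i f" unfolding Dir_def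
      proof (rule mean_shrink[OF nN])
        fix j assume j: "n < j"
        then have "j \<noteq> i - 1" using i by auto
        then have "indep j (vac (i - 1))" by (rule indep_vac)
        moreover have "indep j f" "indep j (av i f)" using ind[OF j] indep_av' by auto
        ultimately show "indep j (\<lambda>\<eta>. vac (i - 1) \<eta> * (f \<eta> - av i f \<eta>)\<^sup>2)" by (simp add: indep_def)
      qed
    qed (use nN in auto)
    ultimately show "mean n (\<lambda>\<eta>. (f \<eta>)\<^sup>2) - (mean n f)\<^sup>2 \<le> C * (\<Sum>i\<in>{1..n}. Dir n i f)" by simp
  qed
qed

text \<open>A Poincare inequality leaves constants free. The killing term controls the mean: site
  \<open>n\<close> is a zero with probability \<open>1 - p\<close>, so (1-p) m^2 is at most twice
  the killing term plus twice the variance.\<close>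

theorem killed_coercive:
  obtains \<kappa> where "\<kappa> > 0"
    "\<And>n f. (\<And>i. n < i \<Longrightarrow> indep i f) \<Longrightarrow> 1 \<le> n \<Longrightarrow>
       \<kappa> * mean n (\<lambda>\<eta>. (f \<eta>)\<^sup>2) \<le> (\<Sum>i\<in>{1..n}. Dir n i f) + mean n (\<lambda>\<eta>. vac n \<eta> * (f \<eta>)\<^sup>2)"
proof -
  obtain C where C: "C > 0" "\<And>n f. (\<And>i. n < i \<Longrightarrow> indep i f) \<Longrightarrow>
       mean n (\<lambda>\<eta>. (f \<eta>)\<^sup>2) - (mean n f)\<^sup>2 \<le> C * (\<Sum>i\<in>{1..n}. Dir n i f)"
    using Poincare by blast
  let ?q = "1 - p"
  have q: "0 < ?q" using p1 by simp
  define t where "t = 2 / ?q"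
  have t: "0 < t" using q by (simp add: t_def)
  define c where "c = (1 + t) * C + t"
  have c: "0 < c" using C(1) t by (simp add: c_def add_pos_pos)
  show ?thesis
  proof (rule that[of "1 / c"])
    show "0 < 1 / c" using c by simp
    fix n :: nat and f :: "(nat \<Rightarrow> bool) \<Rightarrow> real"
    assume ind: "\<And>i. n < i \<Longrightarrow> indep i f" and n: "1 \<le> n"
    define m where "m = mean n f"
    define D where "D = (\<Sum>i\<in>{1..n}. Dir n i f)"
    define W where "W = mean n (\<lambda>\<eta>. vac n \<eta> * (f \<eta>)\<^sup>2)"
    define V where "V = mean n (\<lambda>\<eta>. (f \<eta>)\<^sup>2) - m\<^sup>2"
    have V: "V \<le> C * D" unfolding V_def m_def D_def by (rule C(2)[OF ind])
    have D0: "0 \<le> D" unfolding D_def by (intro sum_nonneg Dir_nonneg)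
    have W0: "0 \<le> W" unfolding W_def by (rule mean_nonneg) simp
    have "V = mean n (\<lambda>\<eta>. (f \<eta> - m)\<^sup>2)"
    proof -
      have "mean n (\<lambda>\<eta>. (f \<eta> - m)\<^sup>2) = mean n (\<lambda>\<eta>. ((f \<eta>)\<^sup>2 - (2 * m) * f \<eta>) + m\<^sup>2)"
        by (simp add: power2_eq_square algebra_simps)
      also have "\<dots> = mean n (\<lambda>\<eta>. (f \<eta>)\<^sup>2) - 2 * m * m + m\<^sup>2"
        by (simp only: mean_add mean_diff mean_scale mean_const m_def)
      finally show ?thesis by (simp add: V_def power2_eq_square)
    qed
    moreover have "?q * m\<^sup>2 \<le> 2 * W + 2 * mean n (\<lambda>\<eta>. (f \<eta> - m)\<^sup>2)"
    proof -
      have "av n (vac n) = (\<lambda>_. ?q)" by (auto simp: av_def)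
      then have "mean n (vac n) = ?q" using mean_av[OF n order_refl, of "vac n"] by (simp add: mean_const)
      then have "?q * m\<^sup>2 = mean n (\<lambda>\<eta>. m\<^sup>2 * vac n \<eta>)" unfolding mean_scale by simp
      also have "\<dots> \<le> mean n (\<lambda>\<eta>. 2 * (vac n \<eta> * (f \<eta>)\<^sup>2) + 2 * (f \<eta> - m)\<^sup>2)"
      proof (rule mean_mono)
        fix \<eta>
        have "m\<^sup>2 \<le> 2 * (f \<eta>)\<^sup>2 + 2 * (f \<eta> - m)\<^sup>2"
          using zero_le_power2[of "2 * f \<eta> - m"] by (simp add: power2_eq_square algebra_simps)
        then show "m\<^sup>2 * vac n \<eta> \<le> 2 * (vac n \<eta> * (f \<eta>)\<^sup>2) + 2 * (f \<eta> - m)\<^sup>2" by simp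
      qed
      also have "\<dots> = 2 * W + 2 * mean n (\<lambda>\<eta>. (f \<eta> - m)\<^sup>2)" by (simp only: mean_add mean_scale W_def)
      finally show ?thesis .
    qed
    ultimately have "?q * m\<^sup>2 \<le> 2 * W + 2 * (C * D)" using V by linarith
    then have "m\<^sup>2 \<le> (2 * W + 2 * (C * D)) / ?q" using q by (simp add: pos_le_divide_eq mult.commute)
    also have "\<dots> = t * W + t * (C * D)" by (simp add: t_def add_divide_distrib)
    finally have "mean n (\<lambda>\<eta>. (f \<eta>)\<^sup>2) \<le> (1 + t) * (C * D) + t * W"
      using V by (simp add: V_def algebra_simps)
    also have "\<dots> \<le> c * (D + W)"
    proof -
      have "0 \<le> C * W" "0 \<le> t * (C * W)" "0 \<le> t * D" using C(1) t W0 D0 by simp_all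
      then show ?thesis unfolding c_def by (simp add: algebra_simps)
    qed
    finally show "1 / c * mean n (\<lambda>\<eta>. (f \<eta>)\<^sup>2) \<le> D + W"
      using c by (simp add: field_simps)
  qed
qed

section \<open>Persistence under a random schedule\<close>

text \<open>Effect of one ring at \<open>i\<close> on a function of the initial configuration. Where
  \<open>i - 1\<close> is a zero it is a conditional expectation, elsewhere the identity, and the
  constraint does not involve \<open>i\<close>; hence it is self-adjoint for \<open>mean n\<close>
  when \<open>i\<close> is one of the averaged sites.\<close>

definition Q :: "nat \<Rightarrow> ((nat \<Rightarrow> bool) \<Rightarrow> real) \<Rightarrow> (nat \<Rightarrow> bool) \<Rightarrow> real" where
  "Q i f \<eta> = (if \<eta> (i - 1) then f \<eta> else av i f \<eta>)"

lemma Q_eq: "Q i f \<eta> = f \<eta> - vac (i - 1) \<eta> * (f \<eta> - av i f \<eta>)"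
  by (simp add: Q_def)

lemma mean_Q:
  assumes "1 \<le> i" "i \<le> n"
  shows "mean n (\<lambda>\<eta>. f \<eta> * Q i g \<eta>) = mean n (\<lambda>\<eta>. f \<eta> * g \<eta>) - mean n (\<lambda>\<eta>. vac (i - 1) \<eta> * (f \<eta> * g \<eta>))
     + mean n (\<lambda>\<eta>. vac (i - 1) \<eta> * (av i f \<eta> * av i g \<eta>))"
proof -
  have w: "indep i (\<lambda>\<eta>. vac (i - 1) \<eta> * av i g \<eta>)"
    using assms by (intro indep_mult indep_vac indep_av) auto
  have "mean n (\<lambda>\<eta>. (vac (i - 1) \<eta> * av i g \<eta>) * avs [i] f \<eta>) = mean n (\<lambda>\<eta>. (vac (i - 1) \<eta> * av i g \<eta>) * f \<eta>)"
    by (rule mean_mult_avs) (use assms w in auto)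
  then have e: "mean n (\<lambda>\<eta>. vac (i - 1) \<eta> * (av i f \<eta> * av i g \<eta>)) = mean n (\<lambda>\<eta>. vac (i - 1) \<eta> * (f \<eta> * av i g \<eta>))"
    by (simp add: mult_ac)
  have "(\<lambda>\<eta>. f \<eta> * Q i g \<eta>) = (\<lambda>\<eta>. (f \<eta> * g \<eta> - vac (i - 1) \<eta> * (f \<eta> * g \<eta>)) + vac (i - 1) \<eta> * (f \<eta> * av i g \<eta>))"
    by (auto simp: Q_eq algebra_simps)
  then show ?thesis unfolding e by (simp only: mean_add mean_diff)
qed

lemma mean_Q_sym: "1 \<le> i \<Longrightarrow> i \<le> n \<Longrightarrow> mean n (\<lambda>\<eta>. f \<eta> * Q i g \<eta>) = mean n (\<lambda>\<eta>. Q i f \<eta> * g \<eta>)"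
  using mean_Q[of i n f g] mean_Q[of i n g f] by (simp add: mult.commute)

lemma mean_Q_self:
  assumes "1 \<le> i" "i \<le> n"
  shows "mean n (\<lambda>\<eta>. f \<eta> * Q i f \<eta>) = mean n (\<lambda>\<eta>. (f \<eta>)\<^sup>2) - Dir n i f"
proof -
  have "Dir n i f = mean n (\<lambda>\<eta>. vac (i - 1) \<eta> * (f \<eta> - avs [i] f \<eta>)\<^sup>2)" by (simp add: Dir_def)
  also have "\<dots> = mean n (\<lambda>\<eta>. vac (i - 1) \<eta> * (f \<eta>)\<^sup>2) - mean n (\<lambda>\<eta>. vac (i - 1) \<eta> * (avs [i] f \<eta>)\<^sup>2)"
    by (rule mean_var) (use assms in \<open>auto intro!: indep_vac\<close>)
  finally show ?thesis using mean_Q[OF assms, of f f] by (simp add: power2_eq_square)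
qed

lemma Dir_le: "1 \<le> i \<Longrightarrow> i \<le> n \<Longrightarrow> Dir n i f \<le> mean n (\<lambda>\<eta>. (f \<eta>)\<^sup>2)"
proof -
  assume i: "1 \<le> i" "i \<le> n"
  have "Dir n i f = mean n (\<lambda>\<eta>. vac (i - 1) \<eta> * (f \<eta> - avs [i] f \<eta>)\<^sup>2)" by (simp add: Dir_def)
  also have "\<dots> = mean n (\<lambda>\<eta>. vac (i - 1) \<eta> * (f \<eta>)\<^sup>2) - mean n (\<lambda>\<eta>. vac (i - 1) \<eta> * (avs [i] f \<eta>)\<^sup>2)"
    by (rule mean_var) (use i in \<open>auto intro!: indep_vac\<close>)
  also have "\<dots> \<le> mean n (\<lambda>\<eta>. vac (i - 1) \<eta> * (f \<eta>)\<^sup>2)"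
    using mean_nonneg[of "\<lambda>\<eta>. vac (i - 1) \<eta> * (avs [i] f \<eta>)\<^sup>2" n] by simp
  also have "\<dots> \<le> mean n (\<lambda>\<eta>. (f \<eta>)\<^sup>2)" by (rule mean_mono) simp
  finally show ?thesis .
qed

lemma mean_sum: "mean n (\<lambda>\<eta>. \<Sum>i\<in>S. u i \<eta>) = (\<Sum>i\<in>S. mean n (u i))"
  by (induction S rule: infinite_finite_induct) (simp_all add: mean_const mean_add)

text \<open>Transfer operator of one time cell: a ring at the site \<open>n + 1\<close> following the chain requires site \<open>n\<close> to be occupied.\<close>

definition Tr :: "nat \<Rightarrow> real \<Rightarrow> real \<Rightarrow> ((nat \<Rightarrow> bool) \<Rightarrow> real) \<Rightarrow> (nat \<Rightarrow> bool) \<Rightarrow> real" where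
  "Tr n a h f \<eta> = a * f \<eta> + h * (of_bool (\<eta> n) * f \<eta> + (\<Sum>i\<in>{1..n}. Q i f \<eta>))"

lemma mean_Tr:
  "mean n (\<lambda>\<eta>. f \<eta> * Tr n a h g \<eta>) = a * mean n (\<lambda>\<eta>. f \<eta> * g \<eta>)
     + h * (mean n (\<lambda>\<eta>. of_bool (\<eta> n) * (f \<eta> * g \<eta>)) + (\<Sum>i\<in>{1..n}. mean n (\<lambda>\<eta>. f \<eta> * Q i g \<eta>)))"
proof -
  have "(\<lambda>\<eta>. f \<eta> * Tr n a h g \<eta>) =
     (\<lambda>\<eta>. a * (f \<eta> * g \<eta>) + h * (of_bool (\<eta> n) * (f \<eta> * g \<eta>) + (\<Sum>i\<in>{1..n}. f \<eta> * Q i g \<eta>)))"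
    by (auto simp: Tr_def algebra_simps sum_distrib_left)
  then show ?thesis by (simp only: mean_add mean_scale mean_sum)
qed

lemma mean_Tr_sym: "mean n (\<lambda>\<eta>. f \<eta> * Tr n a h g \<eta>) = mean n (\<lambda>\<eta>. Tr n a h f \<eta> * g \<eta>)"
proof -
  have "mean n (\<lambda>\<eta>. f \<eta> * Tr n a h g \<eta>) = mean n (\<lambda>\<eta>. g \<eta> * Tr n a h f \<eta>)"
  proof -
    have "mean n (\<lambda>\<eta>. f \<eta> * Q i g \<eta>) = mean n (\<lambda>\<eta>. g \<eta> * Q i f \<eta>)" if "i \<in> {1..n}" for i
      using mean_Q_sym[of i n f g] that by (simp add: mult.commute)
    then have "(\<Sum>i\<in>{1..n}. mean n (\<lambda>\<eta>. f \<eta> * Q i g \<eta>)) = (\<Sum>i\<in>{1..n}. mean n (\<lambda>\<eta>. g \<eta> * Q i f \<eta>))"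
      by (rule sum.cong[OF refl])
    then show ?thesis unfolding mean_Tr by (simp add: mult.commute)
  qed
  then show ?thesis by (simp add: mult.commute)
qed

lemma indep_Q: "n < j \<Longrightarrow> i \<in> {1..n} \<Longrightarrow> indep j f \<Longrightarrow> indep j (Q i f)"
  using indep_av'[of j f i] by (auto simp: indep_def Q_def)

lemma indep_Tr: "n < j \<Longrightarrow> indep j f \<Longrightarrow> indep j (Tr n a h f)"
proof -
  assume j: "n < j" "indep j f"
  have "(\<Sum>i\<in>{1..n}. Q i f (\<eta>(j := b))) = (\<Sum>i\<in>{1..n}. Q i f \<eta>)" for \<eta> b
    using indep_Q[OF j(1) _ j(2)] by (intro sum.cong) (auto simp: indep_def)
  then show ?thesis using j by (simp add: indep_def Tr_def)
qed

text \<open>Coercivity bounds the quadratic form of \<open>Tr\<close> by \<rho>. Since each summand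
  of \<open>Tr\<close> has a nonnegative form, Cauchy-Schwarz holds for the form itself; applied to
  \<open>f\<close> and \<open>u = Tr f\<close> it turns the bound on the form into one on the
  norm.\<close>

lemma Tr_contraction:
  assumes \<kappa>: "\<And>f. (\<And>i. n < i \<Longrightarrow> indep i f) \<Longrightarrow>
       \<kappa> * mean n (\<lambda>\<eta>. (f \<eta>)\<^sup>2) \<le> (\<Sum>i\<in>{1..n}. Dir n i f) + mean n (\<lambda>\<eta>. vac n \<eta> * (f \<eta>)\<^sup>2)"
    and a: "0 \<le> a" and h: "0 \<le> h" and f: "\<And>i. n < i \<Longrightarrow> indep i f"
  defines "\<rho> \<equiv> a + h * (real n + 1) - h * \<kappa>"
  shows "mean n (\<lambda>\<eta>. (Tr n a h f \<eta>)\<^sup>2) \<le> \<rho>\<^sup>2 * mean n (\<lambda>\<eta>. (f \<eta>)\<^sup>2)"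
proof -
  have self: "mean n (\<lambda>\<eta>. g \<eta> * Tr n a h g \<eta>) = a * mean n (\<lambda>\<eta>. (g \<eta>)\<^sup>2)
     + h * ((mean n (\<lambda>\<eta>. (g \<eta>)\<^sup>2) - mean n (\<lambda>\<eta>. vac n \<eta> * (g \<eta>)\<^sup>2)) + (real n * mean n (\<lambda>\<eta>. (g \<eta>)\<^sup>2) - (\<Sum>i\<in>{1..n}. Dir n i g)))" for g
  proof -
    have "mean n (\<lambda>\<eta>. of_bool (\<eta> n) * (g \<eta> * g \<eta>)) = mean n (\<lambda>\<eta>. (g \<eta>)\<^sup>2 - vac n \<eta> * (g \<eta>)\<^sup>2)"
      by (rule arg_cong[where f = "mean n"]) (auto simp: power2_eq_square)
    moreover have "(\<Sum>i\<in>{1..n}. mean n (\<lambda>\<eta>. g \<eta> * Q i g \<eta>)) = (\<Sum>i\<in>{1..n}. mean n (\<lambda>\<eta>. (g \<eta>)\<^sup>2) - Dir n i g)"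
      by (rule sum.cong) (auto simp: mean_Q_self)
    ultimately show ?thesis unfolding mean_Tr by (simp add: mean_diff sum_subtractf power2_eq_square)
  qed
  have pos: "0 \<le> mean n (\<lambda>\<eta>. g \<eta> * Tr n a h g \<eta>)" for g
  proof -
    have "mean n (\<lambda>\<eta>. vac n \<eta> * (g \<eta>)\<^sup>2) \<le> mean n (\<lambda>\<eta>. (g \<eta>)\<^sup>2)" by (rule mean_mono) simp
    moreover have "(\<Sum>i\<in>{1..n}. Dir n i g) \<le> (\<Sum>i\<in>{1..n}. mean n (\<lambda>\<eta>. (g \<eta>)\<^sup>2))"
      by (rule sum_mono) (simp add: Dir_le)
    moreover have "0 \<le> mean n (\<lambda>\<eta>. (g \<eta>)\<^sup>2)" by (rule mean_nonneg) simp
    ultimately show ?thesis unfolding self using a h by (intro add_nonneg_nonneg mult_nonneg_nonneg) simp_all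
  qed
  have up: "mean n (\<lambda>\<eta>. g \<eta> * Tr n a h g \<eta>) \<le> \<rho> * mean n (\<lambda>\<eta>. (g \<eta>)\<^sup>2)" if "\<And>i. n < i \<Longrightarrow> indep i g" for g
  proof -
    have "h * (\<kappa> * mean n (\<lambda>\<eta>. (g \<eta>)\<^sup>2)) \<le> h * ((\<Sum>i\<in>{1..n}. Dir n i g) + mean n (\<lambda>\<eta>. vac n \<eta> * (g \<eta>)\<^sup>2))"
      by (rule mult_left_mono[OF \<kappa>[OF that] h])
    then show ?thesis unfolding self \<rho>_def by (simp add: algebra_simps)
  qed
  define u where "u = Tr n a h f"
  have ui: "indep i u" if "n < i" for i unfolding u_def by (rule indep_Tr[OF that f[OF that]])
  define F where "F = mean n (\<lambda>\<eta>. (f \<eta>)\<^sup>2)"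
  define G where "G = mean n (\<lambda>\<eta>. (u \<eta>)\<^sup>2)"
  have F0: "0 \<le> F" and G0: "0 \<le> G" unfolding F_def G_def by (rule mean_nonneg, simp)+
  have fu: "mean n (\<lambda>\<eta>. f \<eta> * Tr n a h u \<eta>) = G"
    unfolding mean_Tr_sym by (simp add: u_def G_def power2_eq_square)
  have "(mean n (\<lambda>\<eta>. f \<eta> * Tr n a h u \<eta>))\<^sup>2 \<le> mean n (\<lambda>\<eta>. f \<eta> * Tr n a h f \<eta>) * mean n (\<lambda>\<eta>. u \<eta> * Tr n a h u \<eta>)"
  proof (rule quadratic_nonneg_imp)
    fix s
    have av': "av i (\<lambda>\<eta>. f \<eta> + s * u \<eta>) = (\<lambda>\<eta>. av i f \<eta> + s * av i u \<eta>)" for i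
      by (auto simp: av_def algebra_simps)
    have Q': "Q i (\<lambda>\<eta>. f \<eta> + s * u \<eta>) = (\<lambda>\<eta>. Q i f \<eta> + s * Q i u \<eta>)" for i
      by (auto simp: Q_def av')
    have T': "Tr n a h (\<lambda>\<eta>. f \<eta> + s * u \<eta>) = (\<lambda>\<eta>. Tr n a h f \<eta> + s * Tr n a h u \<eta>)"
    proof
      fix \<eta>
      have "(\<Sum>i\<in>{1..n}. Q i f \<eta> + s * Q i u \<eta>) = (\<Sum>i\<in>{1..n}. Q i f \<eta>) + s * (\<Sum>i\<in>{1..n}. Q i u \<eta>)"
        by (simp add: sum.distrib sum_distrib_left)
      then show "Tr n a h (\<lambda>\<eta>. f \<eta> + s * u \<eta>) \<eta> = Tr n a h f \<eta> + s * Tr n a h u \<eta>"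
        unfolding Tr_def Q' by (simp add: algebra_simps)
    qed
    have "0 \<le> mean n (\<lambda>\<eta>. (f \<eta> + s * u \<eta>) * Tr n a h (\<lambda>\<eta>. f \<eta> + s * u \<eta>) \<eta>)" by (rule pos)
    also have "\<dots> = mean n (\<lambda>\<eta>. (f \<eta> * Tr n a h f \<eta> + s * (f \<eta> * Tr n a h u \<eta>)) + (s * (u \<eta> * Tr n a h f \<eta>) + s\<^sup>2 * (u \<eta> * Tr n a h u \<eta>)))"
      unfolding T' by (rule arg_cong[where f = "mean n"]) (auto simp: algebra_simps power2_eq_square)
    also have "\<dots> = mean n (\<lambda>\<eta>. f \<eta> * Tr n a h f \<eta>) + s * mean n (\<lambda>\<eta>. f \<eta> * Tr n a h u \<eta>)
        + (s * mean n (\<lambda>\<eta>. u \<eta> * Tr n a h f \<eta>) + s\<^sup>2 * mean n (\<lambda>\<eta>. u \<eta> * Tr n a h u \<eta>))"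
      by (simp only: mean_add mean_scale)
    also have "mean n (\<lambda>\<eta>. u \<eta> * Tr n a h f \<eta>) = mean n (\<lambda>\<eta>. f \<eta> * Tr n a h u \<eta>)"
      using mean_Tr_sym[of n u a h f] by (simp add: mult.commute)
    finally show "0 \<le> mean n (\<lambda>\<eta>. f \<eta> * Tr n a h f \<eta>) + 2 * s * mean n (\<lambda>\<eta>. f \<eta> * Tr n a h u \<eta>) + s\<^sup>2 * mean n (\<lambda>\<eta>. u \<eta> * Tr n a h u \<eta>)"
      by simp
  qed
  also have "\<dots> \<le> (\<rho> * F) * (\<rho> * G)"
    unfolding F_def G_def by (intro mult_mono up[OF f] up[OF ui] pos order_trans[OF pos up[OF f]])
  finally have "G * G \<le> (\<rho>\<^sup>2 * F) * G" unfolding fu by (simp add: power2_eq_square mult_ac)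
  then have "G \<le> \<rho>\<^sup>2 * F" using G0 F0 by (cases "G = 0") (auto simp: mult_le_cancel_right)
  then show ?thesis by (simp add: G_def F_def u_def)
qed

lemma mean_Tr_iterate_le:
  assumes \<kappa>: "\<And>f. (\<And>i. n < i \<Longrightarrow> indep i f) \<Longrightarrow>
       \<kappa> * mean n (\<lambda>\<eta>. (f \<eta>)\<^sup>2) \<le> (\<Sum>i\<in>{1..n}. Dir n i f) + mean n (\<lambda>\<eta>. vac n \<eta> * (f \<eta>)\<^sup>2)"
    and a: "0 \<le> a" and h: "0 \<le> h"
  defines "\<rho> \<equiv> a + h * (real n + 1) - h * \<kappa>"
  assumes \<rho>: "0 \<le> \<rho>"
  shows "mean n ((Tr n a h ^^ N) (\<lambda>_. 1)) \<le> \<rho> ^ N"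
proof -
  let ?u = "\<lambda>N. (Tr n a h ^^ N) (\<lambda>_. 1)"
  have ind: "indep i (?u N)" if "n < i" for i N
  proof (induction N)
    case (Suc N)
    then show ?case using indep_Tr[OF that, of "?u N" a h] by simp
  qed (simp add: indep_def)
  have sq: "mean n (\<lambda>\<eta>. (?u N \<eta>)\<^sup>2) \<le> (\<rho> ^ N)\<^sup>2" for N
  proof (induction N)
    case (Suc N)
    have "mean n (\<lambda>\<eta>. (Tr n a h (?u N) \<eta>)\<^sup>2) \<le> \<rho>\<^sup>2 * mean n (\<lambda>\<eta>. (?u N \<eta>)\<^sup>2)"
      unfolding \<rho>_def
    proof (rule Tr_contraction[OF _ a h])
      show "\<kappa> * mean n (\<lambda>\<eta>. (f \<eta>)\<^sup>2) \<le> (\<Sum>i\<in>{1..n}. Dir n i f) + mean n (\<lambda>\<eta>. vac n \<eta> * (f \<eta>)\<^sup>2)"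
        if "\<And>i. n < i \<Longrightarrow> indep i f" for f using that by (rule \<kappa>)
    qed (rule ind)
    also have "\<dots> \<le> \<rho>\<^sup>2 * (\<rho> ^ N)\<^sup>2" by (rule mult_left_mono[OF Suc]) simp
    finally show ?case by (simp add: power_mult_distrib)
  qed (simp add: mean_const)
  have "(mean n (?u N))\<^sup>2 \<le> mean n (\<lambda>\<eta>. (?u N \<eta>)\<^sup>2)" unfolding mean_def by (rule avs_square_mean)
  then have "(mean n (?u N))\<^sup>2 \<le> (\<rho> ^ N)\<^sup>2" using sq[of N] by linarith
  then show ?thesis by (rule power2_le_imp_le) (rule zero_le_power[OF \<rho>])
qed

end

text \<open>Sum over the schedules with at most one ring in each of \<open>N\<close> time cells, with weight \<open>h\<close> for each ring.
  Multiplied by \<open>exp (- h * N * card X)\<close>, this is an expectation over Poisson clocks on \<open>X\<close>.\<close>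

fun WS :: "'s set \<Rightarrow> real \<Rightarrow> nat \<Rightarrow> ('s list \<Rightarrow> real) \<Rightarrow> real" where
  "WS X h 0 F = F []"
| "WS X h (Suc N) F = WS X h N F + h * (\<Sum>x\<in>X. WS X h N (\<lambda>L. F (x # L)))"

lemma WS_mono:
  assumes "0 \<le> h"
  shows "(\<And>L. set L \<subseteq> X \<Longrightarrow> F L \<le> G L) \<Longrightarrow> WS X h N F \<le> WS X h N G"
proof (induction N arbitrary: F G)
  case (Suc N)
  show ?case unfolding WS.simps
    by (intro add_mono Suc.IH mult_left_mono sum_mono assms) (auto intro!: Suc.prems)
qed auto

lemma WS_add: "WS X h N (\<lambda>L. F L + G L) = WS X h N F + WS X h N G"
  by (induction N arbitrary: F G) (auto simp: sum.distrib algebra_simps)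

lemma WS_scale: "WS X h N (\<lambda>L. c * F L) = c * WS X h N F"
  by (induction N arbitrary: F) (auto simp: sum_distrib_left algebra_simps)

lemma WS_sum: "WS X h N (\<lambda>L. \<Sum>i\<in>S. F i L) = (\<Sum>i\<in>S. WS X h N (F i))"
proof (induction S rule: infinite_finite_induct)
  case (infinite S)
  then show ?case using WS_scale[of X h N 0 "\<lambda>_. 0"] by simp
next
  case empty
  then show ?case using WS_scale[of X h N 0 "\<lambda>_. 0"] by simp
qed (simp add: WS_add)

lemma WS_const: "WS X h N (\<lambda>_. c) = c * (1 + h * real (card X)) ^ N"
proof (induction N)
  case (Suc N)
  show ?case unfolding WS.simps Suc by (simp add: algebra_simps)
qed simp

definition pred_site :: "nat \<Rightarrow> nat set" where
  "pred_site i = {i - 1}"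

section \<open>The one-dimensional chain and its survival probability\<close>

context refresh
begin

interpretation chain: facilitated p pred_site
  by unfold_locales

text \<open>Only the coincidences between sites of the path and entries of the schedule matter, so a
  path in any graph can be relabelled as an interval of integers.\<close>

lemma KK_map:
  "(\<And>y z. y \<in> set \<delta> \<Longrightarrow> z \<in> set L \<Longrightarrow> r z = r y \<longleftrightarrow> z = y) \<Longrightarrow> KK \<delta> L \<Phi> = KK (map r \<delta>) (map r L) \<Phi>"
proof (induction \<delta> arbitrary: \<Phi>)
  case (Cons y \<delta>)
  have "map (\<lambda>z. z = y) L = map (\<lambda>z. z = r y) (map r L)"
    using Cons.prems by (auto simp: comp_def)
  then have "KK (map r (y # \<delta>)) (map r L) \<Phi> = KK (map r \<delta>) (map r L) (Kf \<Phi> (map (\<lambda>z. z = y) L))" by (simp only: list.map(2) KK.simps)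
  moreover have "KK \<delta> L (Kf \<Phi> (map (\<lambda>z. z = y) L)) = KK (map r \<delta>) (map r L) (Kf \<Phi> (map (\<lambda>z. z = y) L))"
    by (rule Cons.IH) (use Cons.prems in auto)
  ultimately show ?case by simp
qed simp

lemma chain_facs: "chain.facs (Suc j) tr = zeros j tr"
  by (simp add: chain.facs_def zeros_def chain.fac_def pred_site_def)

lemma chain_zeros_0: "\<not> \<sigma> 0 \<Longrightarrow> 0 \<notin> set L \<Longrightarrow>
   chain.EE L \<sigma> (\<lambda>tr. \<Phi> (zeros 0 tr)) = \<Phi> (replicate (Suc (length L)) True)"
proof (induction L arbitrary: \<sigma> \<Phi>)
  case (Cons x L)
  have "chain.EE L \<sigma>' (\<lambda>tr. \<Phi> (zeros 0 (\<sigma> # tr))) = \<Phi> (replicate (Suc (length (x # L))) True)" if "\<not> \<sigma>' 0" for \<sigma>'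
    using Cons.IH[of \<sigma>' "\<lambda>A. \<Phi> (True # A)"] that Cons.prems by (simp add: zeros_def)
  then show ?case using Cons.prems by (simp add: algebra_simps)
qed (simp add: zeros_def)

lemma avs_chain_zeros:
  "\<not> \<sigma> 0 \<Longrightarrow> 0 \<notin> set L \<Longrightarrow>
   avs [1..<Suc j] (\<lambda>\<sigma>. chain.EE L \<sigma> (\<lambda>tr. \<Phi> (zeros j tr))) \<sigma> = KK (rev [1..<Suc j]) L \<Phi> (replicate (Suc (length L)) True)"
proof (induction j arbitrary: \<Phi>)
  case 0
  then show ?case by (simp add: chain_zeros_0)
next
  case (Suc j)
  have D: "x \<in> {..j} \<Longrightarrow> pred_site x \<subseteq> {..j}" "pred_site (Suc j) \<subseteq> {..j}" "Suc j \<notin> {..j}" for x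
    by (auto simp: pred_site_def)
  have e: "av (Suc j) (\<lambda>\<sigma>. chain.EE L \<sigma> (\<lambda>tr. \<Phi> (zeros (Suc j) tr))) =
      (\<lambda>\<sigma>. chain.EE L \<sigma> (\<lambda>tr. Kf \<Phi> (rings (Suc j) L) (zeros j tr)))"
  proof
    fix \<sigma>
    have "chain.EE L (\<sigma>(Suc j := b)) (\<lambda>tr. \<Phi> (zeros (Suc j) tr)) =
       chain.EE L \<sigma> (\<lambda>tr. K b \<Phi> (rings (Suc j) L) (zeros j tr))" for b
      using chain.EE_zeros_eq_facs[OF D, of L "\<sigma>(Suc j := b)" \<Phi>]
        chain.EE_facs_upd[OF D, of L \<sigma> b "K b \<Phi> (rings (Suc j) L)"] by (simp add: chain_facs)
    then show "av (Suc j) (\<lambda>\<sigma>. chain.EE L \<sigma> (\<lambda>tr. \<Phi> (zeros (Suc j) tr))) \<sigma> = chain.EE L \<sigma> (\<lambda>tr. Kf \<Phi> (rings (Suc j) L) (zeros j tr))"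
      by (simp add: av_def Kf_def chain.EE_add chain.EE_scale)
  qed
  have "[1..<Suc (Suc j)] = [1..<Suc j] @ [Suc j]" by simp
  then have "avs [1..<Suc (Suc j)] (\<lambda>\<sigma>. chain.EE L \<sigma> (\<lambda>tr. \<Phi> (zeros (Suc j) tr)))
      = avs [1..<Suc j] (av (Suc j) (\<lambda>\<sigma>. chain.EE L \<sigma> (\<lambda>tr. \<Phi> (zeros (Suc j) tr))))"
    by (simp only: avs_append avs.simps av_avs)
  moreover have "KK (rev [1..<Suc (Suc j)]) L \<Phi> = KK (rev [1..<Suc j]) L (Kf \<Phi> (rings (Suc j) L))"
    by (simp add: rings_def)
  ultimately show ?case using Suc.IH[OF Suc.prems, of "Kf \<Phi> (rings (Suc j) L)"] by (simp only: e)
qed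

text \<open>Survival probability of a chain killed when its child, site \<open>n + 1\<close>, rings
  while \<open>n\<close> is a zero; a function of the initial spins.\<close>

definition pers :: "nat \<Rightarrow> nat list \<Rightarrow> (nat \<Rightarrow> bool) \<Rightarrow> real" where
  "pers n L \<sigma> = chain.EE L \<sigma> (\<lambda>tr. NU (rings (Suc n) L) (zeros n tr))"

lemma indep_pers:
  assumes "n < i"
  shows "indep i (pers n L)"
  unfolding indep_def pers_def
proof (intro allI)
  fix \<eta> :: "nat \<Rightarrow> bool" and b
  show "chain.EE L (\<eta>(i := b)) (\<lambda>tr. NU (rings (Suc n) L) (zeros n tr)) = chain.EE L \<eta> (\<lambda>tr. NU (rings (Suc n) L) (zeros n tr))"
  proof (rule chain.EE_local[where D = "{..n}"])
    show "NU (rings (Suc n) L) (zeros n tr) = NU (rings (Suc n) L) (zeros n tr')"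
      if "list_all2 (\<lambda>\<zeta> \<zeta>'. \<forall>x\<in>{..n}. \<zeta> x = \<zeta>' x) tr tr'" for tr tr'
    proof -
      from that have "zeros n tr = zeros n tr'" by (induction rule: list_all2_induct) (auto simp: zeros_def)
      then show ?thesis by simp
    qed
  qed (use assms in \<open>auto simp: pred_site_def\<close>)
qed

lemma pers_Nil: "pers n [] = (\<lambda>_. 1)"
  by (auto simp: pers_def rings_def)

text \<open>Feynman-Kac recursion in the first ring: the child kills, sites of the chain act through
  \<open>Q\<close>, and sites above the child cannot act back on \<open>n\<close>.\<close>

lemma pers_Cons:
  "pers n (i # L) = (if i = Suc n then (\<lambda>\<eta>. of_bool (\<eta> n) * pers n L \<eta>)
     else if n < i then pers n L else Q i (pers n L))"
proof
  fix \<eta>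
  have z: "zeros n (\<eta> # tr) = (\<not> \<eta> n) # zeros n tr" for tr by (simp add: zeros_def)
  have f: "chain.fac \<eta> i \<longleftrightarrow> \<not> \<eta> (i - 1)" by (simp add: chain.fac_def pred_site_def)
  have Qi: "pers n (i # L) \<eta> = Q i (pers n L) \<eta>" if "i \<noteq> Suc n"
    using that by (simp add: pers_def Q_def av_def z f)
  have "Q i (pers n L) \<eta> = pers n L \<eta>" if "n < i"
    using av_indep[OF indep_pers[OF that]] by (simp add: Q_def)
  moreover have "pers n (Suc n # L) \<eta> = of_bool (\<eta> n) * pers n L \<eta>"
    by (simp add: pers_def z chain.fac_def pred_site_def chain.EE_const)
  ultimately show "pers n (i # L) \<eta> = (if i = Suc n then (\<lambda>\<eta>. of_bool (\<eta> n) * pers n L \<eta>)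
     else if n < i then pers n L else Q i (pers n L)) \<eta>" using Qi by auto
qed

lemma WS_Q: "WS X h N (\<lambda>L. Q i (G L) \<eta>) = Q i (\<lambda>\<eta>. WS X h N (\<lambda>L. G L \<eta>)) \<eta>"
  by (simp add: Q_def av_def WS_add WS_scale)

lemma mean_WS: "mean n (\<lambda>\<eta>. WS X h N (\<lambda>L. G L \<eta>)) = WS X h N (\<lambda>L. mean n (G L))"
  by (induction N arbitrary: G) (simp_all add: mean_add mean_scale mean_sum)

text \<open>After relabelling, the survival probabilities summed over schedules obey the recursion
  of \<open>Tr\<close>, whose iterates are controlled by coercivity.\<close>

theorem WS_KK_le:
  assumes \<kappa>: "\<And>f. (\<And>i. n < i \<Longrightarrow> indep i f) \<Longrightarrow>
       \<kappa> * mean n (\<lambda>\<eta>. (f \<eta>)\<^sup>2) \<le> (\<Sum>i\<in>{1..n}. Dir n i f) + mean n (\<lambda>\<eta>. vac n \<eta> * (f \<eta>)\<^sup>2)"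
    and \<kappa>1: "\<kappa> \<le> 1"
    and X: "finite X" "distinct (x # \<delta>)" "set (x # \<delta>) \<subseteq> X" "length \<delta> = n" and h: "0 \<le> h"
  shows "WS X h N (\<lambda>L. KK \<delta> L (NU (rings x L)) (replicate (Suc (length L)) True)) \<le> (1 + h * real (card X) - h * \<kappa>) ^ N"
proof -
  \<comment> \<open>The child \<open>x\<close> becomes \<open>n + 1\<close>, the path is numbered
    downwards from \<open>n\<close> to 1, and all other sites share the inert label
    \<open>n + 2\<close>. The label 0 is left to the boundary.\<close>
  define r where "r z = (if z = x then Suc n else if z \<in> set \<delta> then n - (THE j. j < n \<and> \<delta> ! j = z) else Suc (Suc n))" for z
  have x\<delta>: "x \<notin> set \<delta>" "distinct \<delta>" using X by auto
  have rx: "r x = Suc n" by (simp add: r_def)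
  have r\<delta>: "r (\<delta> ! j) = n - j" if "j < n" for j
  proof -
    have "(THE i. i < n \<and> \<delta> ! i = \<delta> ! j) = j"
      by (rule the_equality) (use that X x\<delta> in \<open>auto simp: nth_eq_iff_index_eq\<close>)
    moreover have "\<delta> ! j \<in> set \<delta>" "\<delta> ! j \<noteq> x" using that X x\<delta> by (auto dest: nth_mem)
    ultimately show ?thesis by (simp add: r_def)
  qed
  have ro: "r z = Suc (Suc n)" if "z \<notin> set (x # \<delta>)" for z using that by (auto simp: r_def)
  have r\<delta>': "1 \<le> r z" "r z \<le> n" if "z \<in> set \<delta>" for z
    using that r\<delta> X by (auto simp: in_set_conv_nth)
  have r0: "r z \<noteq> 0" for z using rx ro r\<delta>'(1)[of z] by (cases "z \<in> set (x # \<delta>)") auto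
  have map\<delta>: "map r \<delta> = rev [1..<Suc n]"
    by (rule nth_equalityI) (use X r\<delta> in \<open>auto simp: rev_nth nth_upt simp del: upt_Suc\<close>)
  have inj: "inj_on r (set (x # \<delta>))"
  proof -
    have "distinct (map r (x # \<delta>))" by (simp add: map\<delta> rx del: upt_Suc)
    then show ?thesis by (simp only: distinct_map)
  qed
  have req: "r z = r y \<longleftrightarrow> z = y" if "y \<in> set (x # \<delta>)" for y z
  proof (cases "z \<in> set (x # \<delta>)")
    case True
    then show ?thesis using inj_on_eq_iff[OF inj True that] by simp
  next
    case False
    have "r y \<le> Suc n" using that rx r\<delta>'(2)[of y] by auto
    then show ?thesis using ro[OF False] that False by auto
  qed
  have S: "KK \<delta> L (NU (rings x L)) (replicate (Suc (length L)) True) = mean n (pers n (map r L))" for L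
  proof -
    have "rings x L = rings (Suc n) (map r L)"
      unfolding rings_def using req[of x] rx by (auto simp: comp_def)
    moreover have "KK \<delta> L \<Phi> = KK (rev [1..<Suc n]) (map r L) \<Phi>" for \<Phi>
      using KK_map[of \<delta> L r \<Phi>] req by (simp add: map\<delta> del: upt_Suc)
    moreover have "avs [1..<Suc n] (\<lambda>\<sigma>. chain.EE (map r L) \<sigma> (\<lambda>tr. NU (rings (Suc n) (map r L)) (zeros n tr))) (\<lambda>_. False)
       = KK (rev [1..<Suc n]) (map r L) (NU (rings (Suc n) (map r L))) (replicate (Suc (length (map r L))) True)"
    proof (rule avs_chain_zeros)
      show "0 \<notin> set (map r L)" using r0 by (metis (no_types) ex_map_conv)
    qed simp
    ultimately show ?thesis by (simp add: mean_def pers_def[abs_def] del: upt_Suc)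
  qed
  \<comment> \<open>Weight of an empty cell together with that of a ring at one of the
    \<open>card X - n - 1\<close> inert sites.\<close>
  define a where "a = 1 + h * (real (card X) - real n - 1)"
  have cX: "n + 1 \<le> card X"
    using card_mono[OF X(1) X(3)] distinct_card[OF X(2)] X(4) by simp
  have a0: "0 \<le> a" using cX h by (simp add: a_def)
  have iter: "(\<lambda>\<eta>. WS X h N (\<lambda>L. pers n (map r L) \<eta>)) = (Tr n a h ^^ N) (\<lambda>_. 1)" for N
  proof (induction N)
    case 0
    then show ?case by (simp add: pers_Nil)
  next
    case (Suc N)
    define u where "u = (\<lambda>\<eta>. WS X h N (\<lambda>L. pers n (map r L) \<eta>))"
    have "WS X h (Suc N) (\<lambda>L. pers n (map r L) \<eta>) = Tr n a h u \<eta>" for \<eta>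
    proof -
      define g where "g i = WS X h N (\<lambda>L. pers n (i # map r L) \<eta>)" for i
      have g1: "g (Suc n) = of_bool (\<eta> n) * u \<eta>" by (simp add: g_def pers_Cons WS_scale u_def)
      have g2: "g (Suc (Suc n)) = u \<eta>" by (simp add: g_def pers_Cons u_def)
      have g3: "g i = Q i u \<eta>" if "i \<in> {1..n}" for i
        using that by (simp add: g_def pers_Cons WS_Q u_def)
      have XX: "X = insert x (set \<delta> \<union> (X - set (x # \<delta>)))" using X by auto
      have "(\<Sum>z\<in>X. g (r z)) = g (r x) + ((\<Sum>z\<in>set \<delta>. g (r z)) + (\<Sum>z\<in>X - set (x # \<delta>). g (r z)))"
        by (subst XX, subst sum.insert) (use X x\<delta> in \<open>auto intro!: sum.union_disjoint\<close>)
      also have "(\<Sum>z\<in>set \<delta>. g (r z)) = (\<Sum>i\<in>{1..n}. g i)"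
      proof -
        have "r ` set \<delta> = {1..n}" using arg_cong[OF map\<delta>, of set] by auto
        moreover have "inj_on r (set \<delta>)" using inj by (rule inj_on_subset) auto
        ultimately show ?thesis using sum.reindex[of r "set \<delta>" g] by simp
      qed
      also have "(\<Sum>i\<in>{1..n}. g i) = (\<Sum>i\<in>{1..n}. Q i u \<eta>)" by (rule sum.cong) (auto simp: g3)
      also have "(\<Sum>z\<in>X - set (x # \<delta>). g (r z)) = (real (card X) - real n - 1) * u \<eta>"
      proof -
        have "card (X - set (x # \<delta>)) = card X - (n + 1)"
          using card_Diff_subset[OF _ X(3)] distinct_card[OF X(2)] X(4) by simp
        then show ?thesis using ro g2 cX by (simp add: of_nat_diff)
      qed
      finally have "(\<Sum>z\<in>X. g (r z)) = of_bool (\<eta> n) * u \<eta> + ((\<Sum>i\<in>{1..n}. Q i u \<eta>) + (real (card X) - real n - 1) * u \<eta>)"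
        by (simp add: rx g1)
      moreover have "WS X h (Suc N) (\<lambda>L. pers n (map r L) \<eta>) = u \<eta> + h * (\<Sum>z\<in>X. g (r z))"
        by (simp add: g_def u_def)
      ultimately have "WS X h (Suc N) (\<lambda>L. pers n (map r L) \<eta>) =
          u \<eta> + h * (of_bool (\<eta> n) * u \<eta> + ((\<Sum>i\<in>{1..n}. Q i u \<eta>) + (real (card X) - real n - 1) * u \<eta>))"
        by (simp only:)
      also have "\<dots> = Tr n a h u \<eta>"
        unfolding Tr_def a_def by (simp only: distrib_left distrib_right mult_1_left mult.assoc add_ac)
      finally show ?thesis .
    qed
    then show ?case using Suc by (simp add: u_def)
  qed
  have \<rho>: "a + h * (real n + 1) - h * \<kappa> = 1 + h * real (card X) - h * \<kappa>" by (simp add: a_def algebra_simps)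
  have "WS X h N (\<lambda>L. KK \<delta> L (NU (rings x L)) (replicate (Suc (length L)) True)) = mean n ((Tr n a h ^^ N) (\<lambda>_. 1))"
    unfolding S iter[symmetric] mean_WS ..
  also have "\<dots> \<le> (a + h * (real n + 1) - h * \<kappa>) ^ N"
  proof (rule mean_Tr_iterate_le[OF _ a0 h])
    show "\<kappa> * mean n (\<lambda>\<eta>. (f \<eta>)\<^sup>2) \<le> (\<Sum>i\<in>{1..n}. Dir n i f) + mean n (\<lambda>\<eta>. vac n \<eta> * (f \<eta>)\<^sup>2)"
      if "\<And>i. n < i \<Longrightarrow> indep i f" for f using that by (rule \<kappa>)
    have "h * \<kappa> \<le> h * (real n + 1)" using \<kappa>1 h by (intro mult_left_mono) auto
    then show "0 \<le> a + h * (real n + 1) - h * \<kappa>" using a0 by simp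
  qed
  finally show ?thesis unfolding \<rho> .
qed

end

section \<open>Poisson clocks in small time cells\<close>

definition clk :: "real \<Rightarrow> (real \<times> bool) measure" where
  "clk p = density lborel (exponential_density 1) \<Otimes>\<^sub>M measure_pmf (bernoulli_pmf p)"

abbreviation "seqm p \<equiv> (\<Pi>\<^sub>M _\<in>(UNIV::nat set). clk p)"

lemma prob_space_clk: "prob_space (clk p)"
proof -
  interpret E: prob_space "density lborel (exponential_density 1)" by (rule prob_space_exponential_density) simp
  interpret B: prob_space "measure_pmf (bernoulli_pmf p)" by (rule prob_space_measure_pmf)
  interpret pair_prob_space "density lborel (exponential_density 1)" "measure_pmf (bernoulli_pmf p)" ..
  show ?thesis unfolding clk_def by (rule prob_space_axioms)
qed

lemma sets_clk: "sets (clk p) = sets (borel \<Otimes>\<^sub>M count_space UNIV)"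
  unfolding clk_def by (rule sets_pair_measure_cong) auto

lemma space_clk [simp]: "space (clk p) = UNIV"
  by (simp add: clk_def space_pair_measure)

lemma measurable_fst_clk [measurable]: "fst \<in> borel_measurable (clk p)"
  by (simp add: measurable_cong_sets[OF sets_clk refl])

lemma measurable_snd_clk [measurable]: "snd \<in> clk p \<rightarrow>\<^sub>M count_space UNIV"
  by (simp add: measurable_cong_sets[OF sets_clk refl])

definition cw :: "real \<Rightarrow> bool \<Rightarrow> real" where
  "cw p c = (if c then p else 1 - p)"

text \<open>Site \<open>x\<close>, whose last ring was at time \<open>s\<close> and whose next waiting times are \<open>a\<close>,
  rings in the cells of length \<open>h\<close> following time \<open>b\<close> exactly as prescribed by the word, once in each
  of the cells carrying its name, with the prescribed coins.\<close>

fun sp :: "real \<Rightarrow> 's \<Rightarrow> real \<Rightarrow> ('s \<times> bool) option list \<Rightarrow> real \<Rightarrow> (nat \<Rightarrow> real \<times> bool) \<Rightarrow> bool" where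
  "sp h x b [] s a \<longleftrightarrow> b < s + fst (a 0)"
| "sp h x b (e # w) s a \<longleftrightarrow>
     (case e of
        None \<Rightarrow> sp h x (b + h) w s a
      | Some (y, c) \<Rightarrow>
          if y = x
          then b < s + fst (a 0) \<and> s + fst (a 0) \<le> b + h \<and> snd (a 0) = c \<and> sp h x (b + h) w (s + fst (a 0)) (\<lambda>k. a (Suc k))
          else sp h x (b + h) w s a)"

fun wx :: "real \<Rightarrow> real \<Rightarrow> 's \<Rightarrow> ('s \<times> bool) option list \<Rightarrow> real" where
  "wx p h x [] = 1"
| "wx p h x (e # w) = (case e of None \<Rightarrow> 1 | Some (y, c) \<Rightarrow> if y = x then h * cw p c else 1) * wx p h x w"

lemma measurable_sp:
  "(\<lambda>(s, a). sp h x b w s a) \<in> (borel \<Otimes>\<^sub>M seqm p) \<rightarrow>\<^sub>M count_space UNIV"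
proof (induction w arbitrary: b)
  case Nil
  show ?case by simp
next
  case (Cons e w)
  note [measurable] = Cons.IH[of "b + h"]
  show ?case
  proof (cases "\<exists>c. e = Some (x, c)")
    case True
    then obtain c where e: "e = Some (x, c)" by blast
    have m: "(\<lambda>y. (fst y + fst (snd y 0), \<lambda>k. snd y (Suc k))) \<in> (borel \<Otimes>\<^sub>M seqm p) \<rightarrow>\<^sub>M (borel \<Otimes>\<^sub>M seqm p)"
    proof (intro measurable_Pair measurable_abs_UNIV)
      have [measurable]: "(\<lambda>y. snd y k) \<in> (borel \<Otimes>\<^sub>M seqm p) \<rightarrow>\<^sub>M clk p" for k
        by (rule measurable_compose[OF measurable_snd measurable_component_singleton]) simp
      show "(\<lambda>y. fst y + fst (snd y 0)) \<in> borel_measurable (borel \<Otimes>\<^sub>M seqm p)" by measurable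
      show "(\<lambda>y. snd y (Suc k)) \<in> (borel \<Otimes>\<^sub>M seqm p) \<rightarrow>\<^sub>M clk p" for k by measurable
    qed
    have "(\<lambda>y. case_prod (sp h x (b + h) w) (fst y + fst (snd y 0), \<lambda>k. snd y (Suc k))) \<in> (borel \<Otimes>\<^sub>M seqm p) \<rightarrow>\<^sub>M count_space UNIV"
      by (rule measurable_compose[OF m Cons.IH])
    then have [measurable]: "Measurable.pred (borel \<Otimes>\<^sub>M seqm p) (\<lambda>y. sp h x (b + h) w (fst y + fst (snd y 0)) (\<lambda>k. snd y (Suc k)))" by simp
    show ?thesis unfolding e by (simp add: case_prod_beta)
  next
    case False
    then have "sp h x b (e # w) s a = sp h x (b + h) w s a" for s a
      by (auto split: option.split)
    then have "(\<lambda>(s, a). sp h x b (e # w) s a) = (\<lambda>(s, a). sp h x (b + h) w s a)" by simp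
    then show ?thesis using Cons.IH by simp
  qed
qed

lemma measurable_clk_product [measurable]:
  fixes f :: "real \<Rightarrow> ennreal"
  assumes "f \<in> borel_measurable borel"
  shows "(\<lambda>y. f (fst y) * indicator {c} (snd y)) \<in> borel_measurable (clk p)"
proof -
  have "(\<lambda>y. f (fst y)) \<in> borel_measurable (clk p)" by (rule measurable_compose[OF measurable_fst_clk assms])
  moreover have "(\<lambda>y. indicator {c} (snd y) :: ennreal) \<in> borel_measurable (clk p)"
    by (rule measurable_compose[OF measurable_snd_clk]) simp
  ultimately show ?thesis by (rule borel_measurable_times_ennreal)
qed

lemma nn_integral_clk:
  assumes [measurable]: "f \<in> borel_measurable borel"
  shows "(\<integral>\<^sup>+y. f (fst y) * indicator {c} (snd y) \<partial>clk p) = (\<integral>\<^sup>+u. ennreal (exponential_density 1 u) * f u \<partial>lborel) * ennreal (pmf (bernoulli_pmf p) c)"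
proof -
  interpret E: prob_space "density lborel (exponential_density 1)" by (rule prob_space_exponential_density) simp
  interpret B: prob_space "measure_pmf (bernoulli_pmf p)" by (rule prob_space_measure_pmf)
  interpret pair_prob_space "density lborel (exponential_density 1)" "measure_pmf (bernoulli_pmf p)" ..
  have "(\<integral>\<^sup>+y. f (fst y) * indicator {c} (snd y) \<partial>clk p) = (\<integral>\<^sup>+u. (\<integral>\<^sup>+b. f u * indicator {c} b \<partial>measure_pmf (bernoulli_pmf p)) \<partial>density lborel (exponential_density 1))"
    using measurable_clk_product[OF assms, of c p] unfolding clk_def
    by (subst measure_pmf.nn_integral_fst[symmetric]) auto
  also have "\<dots> = (\<integral>\<^sup>+u. f u * ennreal (pmf (bernoulli_pmf p) c) \<partial>density lborel (exponential_density 1))"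
    by (simp add: nn_integral_cmult emeasure_pmf_single)
  also have "\<dots> = (\<integral>\<^sup>+u. f u \<partial>density lborel (exponential_density 1)) * ennreal (pmf (bernoulli_pmf p) c)"
    by (rule nn_integral_multc) simp
  also have "(\<integral>\<^sup>+u. f u \<partial>density lborel (exponential_density 1)) = (\<integral>\<^sup>+u. ennreal (exponential_density 1 u) * f u \<partial>lborel)"
    by (subst nn_integral_density) auto
  finally show ?thesis .
qed

lemma nn_integral_seqm:
  assumes f: "f \<in> borel_measurable (seqm p)"
  shows "(\<integral>\<^sup>+a. f a \<partial>seqm p) = (\<integral>\<^sup>+y. (\<integral>\<^sup>+a. f (case_nat y a) \<partial>seqm p) \<partial>clk p)"
proof -
  interpret prob_space "clk p" by (rule prob_space_clk)
  interpret sequence_space "clk p" by unfold_locales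
  have "(\<integral>\<^sup>+a. f a \<partial>seqm p) = (\<integral>\<^sup>+a. f a \<partial>distr (clk p \<Otimes>\<^sub>M seqm p) (seqm p) (\<lambda>(s, \<omega>). case_nat s \<omega>))"
    by (simp add: PiM_iter)
  also have "\<dots> = (\<integral>\<^sup>+z. f (case_nat (fst z) (snd z)) \<partial>(clk p \<Otimes>\<^sub>M seqm p))"
    using f by (subst nn_integral_distr) (auto simp: case_prod_beta')
  also have "\<dots> = (\<integral>\<^sup>+y. (\<integral>\<^sup>+a. f (case_nat y a) \<partial>seqm p) \<partial>clk p)"
    using f by (subst P.nn_integral_fst[symmetric]) (auto simp: )
  finally show ?thesis .
qed

lemma pmf_cw: "0 \<le> p \<Longrightarrow> p \<le> 1 \<Longrightarrow> pmf (bernoulli_pmf p) c = cw p c"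
  by (cases c) (auto simp: cw_def)

lemma wx_nonneg: "0 \<le> p \<Longrightarrow> p \<le> 1 \<Longrightarrow> 0 \<le> h \<Longrightarrow> 0 \<le> wx p h x w"
  by (induction w) (auto simp: cw_def split: option.split)

lemma measurable_sp1: "Measurable.pred (seqm p) (sp h x b w s)"
  using measurable_compose[OF measurable_Pair1'[of s borel "seqm p"] measurable_sp[of h x b w p]] by simp

lemma space_seqm: "space (seqm p) = UNIV"
  by (simp add: space_PiM PiE_UNIV_domain)

lemma sets_sp: "{a. sp h x b w s a} \<in> sets (seqm p)"
  using measurable_sp1[where p = p and h = h and x = x and b = b and w = w and s = s] unfolding pred_def by (simp add: space_seqm)

text \<open>The exponential densities of successive waiting times telescope to the probability of
  silence from \<open>s\<close> to the end of the last cell. What each prescribed ring adds is the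
  length \<open>h\<close> of its cell and the probability of its coin.\<close>

lemma nn_integral_sp:
  assumes p: "0 \<le> p" "p \<le> 1" and h: "0 \<le> h"
  shows "s \<le> b \<Longrightarrow> (\<integral>\<^sup>+a. indicator {a. sp h x b w s a} a \<partial>seqm p) = ennreal (exp (s - (b + h * real (length w))) * wx p h x w)"
proof (induction w arbitrary: s b)
  case Nil
  interpret prob_space "clk p" by (rule prob_space_clk)
  interpret sequence_space "clk p" by unfold_locales
  have ms: "{a. sp h x b [] s a} \<in> sets (seqm p)"
    by (rule sets_sp)
  have "(\<integral>\<^sup>+a. indicator {a. sp h x b [] s a} a \<partial>seqm p) = (\<integral>\<^sup>+y. (\<integral>\<^sup>+a. indicator {a. sp h x b [] s a} (case_nat y a) \<partial>seqm p) \<partial>clk p)"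
    using ms by (intro nn_integral_seqm borel_measurable_indicator)
  also have "\<dots> = (\<integral>\<^sup>+y. (\<integral>\<^sup>+a. indicator {u. b < s + u} (fst y) \<partial>seqm p) \<partial>clk p)"
    by (intro nn_integral_cong) (auto simp: indicator_def)
  also have "\<dots> = (\<integral>\<^sup>+y. indicator {u. b < s + u} (fst y) \<partial>clk p)"
    by (simp add: P.emeasure_space_1)
  also have "\<dots> = (\<integral>\<^sup>+y. indicator {u. b < s + u} (fst y) * indicator {True} (snd y) + indicator {u. b < s + u} (fst y) * indicator {False} (snd y) \<partial>clk p)"
    by (rule nn_integral_cong) (auto simp: indicator_def)
  also have "\<dots> = (\<integral>\<^sup>+y. indicator {u. b < s + u} (fst y) * indicator {True} (snd y) \<partial>clk p) + (\<integral>\<^sup>+y. indicator {u. b < s + u} (fst y) * indicator {False} (snd y) \<partial>clk p)"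
    by (rule nn_integral_add) measurable
  also have "\<dots> = (\<integral>\<^sup>+u. ennreal (exponential_density 1 u) * indicator {u. b < s + u} u \<partial>lborel) * (ennreal p + ennreal (1 - p))"
    by (simp add: nn_integral_clk p distrib_left)
  also have "ennreal p + ennreal (1 - p) = 1" using p by (subst ennreal_plus[symmetric]) auto
  also have "(\<integral>\<^sup>+u. ennreal (exponential_density 1 u) * indicator {u. b < s + u} u \<partial>lborel) = (\<integral>\<^sup>+u. ennreal (exp (- u)) * indicator {b - s..} u \<partial>lborel)"
  proof (rule nn_integral_cong_AE)
    have "AE u in lborel. u \<noteq> b - s" by (rule AE_lborel_singleton)
    then show "AE u in lborel. ennreal (exponential_density 1 u) * indicator {u. b < s + u} u = ennreal (exp (- u)) * indicator {b - s..} u"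
      by eventually_elim (use Nil in \<open>auto simp: indicator_def exponential_density_def\<close>)
  qed
  also have "\<dots> = ennreal (0 - (- exp (- (b - s))))"
  proof (rule nn_integral_FTC_atLeast)
    show "((\<lambda>u. - exp (- u)) \<longlongrightarrow> (0::real)) at_top"
      using tendsto_minus[OF filterlim_compose[OF exp_at_bot filterlim_uminus_at_bot_at_top]] by simp
  qed (auto intro!: derivative_eq_intros)
  finally show ?case by simp
next
  case (Cons e w)
  interpret prob_space "clk p" by (rule prob_space_clk)
  interpret sequence_space "clk p" by unfold_locales
  show ?case
  proof (cases "\<exists>c. e = Some (x, c)")
    case False
    then have "sp h x b (e # w) s a = sp h x (b + h) w s a" for a
      by (auto split: option.split)
    moreover have "wx p h x (e # w) = wx p h x w" using False by (auto split: option.split)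
    ultimately show ?thesis using Cons.IH[of s "b + h"] Cons.prems h by (simp only:) (simp add: algebra_simps)
  next
    case True
    then obtain c where e: "e = Some (x, c)" by blast
    define B where "B = b + h * real (length (e # w))"
    define W where "W = wx p h x w"
    have W0: "0 \<le> W" unfolding W_def by (rule wx_nonneg[OF p h])
    have ms: "{a. sp h x b (e # w) s a} \<in> sets (seqm p)"
      by (rule sets_sp)
    have ind: "indicator {a. sp h x b (e # w) s a} (case_nat y a) =
       (indicator {u. b < s + u \<and> s + u \<le> b + h} (fst y) * indicator {c} (snd y)) * (indicator {a. sp h x (b + h) w (s + fst y) a} a :: ennreal)" for y a
      by (auto simp: e indicator_def)
    have "(\<integral>\<^sup>+a. indicator {a. sp h x b (e # w) s a} a \<partial>seqm p) = (\<integral>\<^sup>+y. (\<integral>\<^sup>+a. indicator {a. sp h x b (e # w) s a} (case_nat y a) \<partial>seqm p) \<partial>clk p)"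
      using ms by (intro nn_integral_seqm borel_measurable_indicator)
    also have "\<dots> = (\<integral>\<^sup>+y. (indicator {u. b < s + u \<and> s + u \<le> b + h} (fst y) * ennreal (exp (s + fst y - B) * W)) * indicator {c} (snd y) \<partial>clk p)"
    proof (rule nn_integral_cong)
      fix y assume "y \<in> space (clk p)"
      have m: "{a. sp h x (b + h) w (s + fst y) a} \<in> sets (seqm p)"
        by (rule sets_sp)
      have "(\<integral>\<^sup>+a. indicator {a. sp h x b (e # w) s a} (case_nat y a) \<partial>seqm p) =
         (indicator {u. b < s + u \<and> s + u \<le> b + h} (fst y) * indicator {c} (snd y)) * (\<integral>\<^sup>+a. indicator {a. sp h x (b + h) w (s + fst y) a} a \<partial>seqm p)"
        unfolding ind using m by (intro nn_integral_cmult borel_measurable_indicator)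
      also have "\<dots> = (indicator {u. b < s + u \<and> s + u \<le> b + h} (fst y) * indicator {c} (snd y)) * ennreal (exp (s + fst y - B) * W)"
      proof (cases "s + fst y \<le> b + h")
        case True
        then show ?thesis using Cons.IH[of "s + fst y" "b + h"] by (simp add: B_def W_def algebra_simps)
      qed simp
      finally show "(\<integral>\<^sup>+a. indicator {a. sp h x b (e # w) s a} (case_nat y a) \<partial>seqm p) =
         (indicator {u. b < s + u \<and> s + u \<le> b + h} (fst y) * ennreal (exp (s + fst y - B) * W)) * indicator {c} (snd y)"
        by (simp add: mult_ac)
    qed
    also have "\<dots> = (\<integral>\<^sup>+u. ennreal (exponential_density 1 u) * (indicator {u. b < s + u \<and> s + u \<le> b + h} u * ennreal (exp (s + u - B) * W)) \<partial>lborel) * ennreal (cw p c)"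
      by (subst nn_integral_clk) (auto simp: pmf_cw p)
    also have "(\<integral>\<^sup>+u. ennreal (exponential_density 1 u) * (indicator {u. b < s + u \<and> s + u \<le> b + h} u * ennreal (exp (s + u - B) * W)) \<partial>lborel)
        = (\<integral>\<^sup>+u. ennreal (exp (s - B) * W) * indicator {b - s<..b + h - s} u \<partial>lborel)"
    proof (rule nn_integral_cong)
      fix u :: real
      show "ennreal (exponential_density 1 u) * (indicator {u. b < s + u \<and> s + u \<le> b + h} u * ennreal (exp (s + u - B) * W)) = ennreal (exp (s - B) * W) * indicator {b - s<..b + h - s} u"
      proof (cases "b < s + u \<and> s + u \<le> b + h")
        case True
        then have "0 \<le> u" using Cons.prems by simp
        \<comment> \<open>The density of the ring times the probability of what follows does not
          depend on the position in the cell, so the integral over the cell is a constant times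
          \<open>h\<close>.\<close>
        moreover have "exp (- u) * exp (s + u - B) = exp (s - B)" by (simp add: exp_add[symmetric])
        ultimately show ?thesis using True W0
          by (auto simp: exponential_density_def ennreal_mult[symmetric] mult.assoc[symmetric])
      qed (auto simp: indicator_def)
    qed
    also have "\<dots> = ennreal (exp (s - B) * W) * ennreal h"
      using h by (subst nn_integral_cmult_indicator) auto
    also have "ennreal (exp (s - B) * W) * ennreal h * ennreal (cw p c) = ennreal (exp (s - B) * wx p h x (e # w))"
      using W0 h p by (simp add: ennreal_mult[symmetric] W_def e cw_def mult_ac)
    finally show ?thesis by (simp add: B_def)
  qed
qed

lemma east_clocks_eq: "east_clocks p = (\<Pi>\<^sub>M _\<in>UNIV. clk p)"
  by (simp add: east_clocks_def clk_def)

lemma prob_space_east_clocks: "prob_space (east_clocks p)"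
  unfolding east_clocks_eq by (rule prob_space_PiM) (rule prob_space_clk)

lemma space_east_clocks [simp]: "space (east_clocks p) = UNIV"
  by (simp add: east_clocks_eq space_PiM PiE_UNIV_domain)

lemma measurable_coordinate: "(\<lambda>\<omega>. \<omega> i) \<in> east_clocks p \<rightarrow>\<^sub>M clk p"
  unfolding east_clocks_eq by (rule measurable_component_singleton) simp

lemma measurable_site_seq: "(\<lambda>\<omega> k. \<omega> (x, k)) \<in> east_clocks p \<rightarrow>\<^sub>M seqm p"
  by (rule measurable_abs_UNIV) (rule measurable_coordinate)

lemma distr_site_seq: "distr (east_clocks p) (seqm p) (\<lambda>\<omega> k. \<omega> (x, k)) = seqm p"
  using distr_PiM_reindex[of UNIV "\<lambda>_. clk p" "Pair x" UNIV] prob_space_clk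
  by (simp add: east_clocks_eq inj_on_def restrict_def)

text \<open>All coordinates are independent; grouping them by site gives independent sequences, each
  with law \<open>seqm p\<close>.\<close>

lemma prob_sites:
  fixes X :: "'d site set"
  assumes X: "finite X" and A: "\<And>x. x \<in> X \<Longrightarrow> A x \<in> sets (seqm p)"
  shows "measure (east_clocks p) {\<omega>. \<forall>x\<in>X. (\<lambda>k. \<omega> (x, k)) \<in> A x} = (\<Prod>x\<in>X. measure (seqm p) (A x))"
proof (cases "X = {}")
  case True
  interpret prob_space "east_clocks p" by (rule prob_space_east_clocks)
  show ?thesis using prob_space True by simp
next
  case False
  interpret prob_space "east_clocks p :: ('d site \<times> nat \<Rightarrow> real \<times> bool) measure" by (rule prob_space_east_clocks)
  have coord: "indep_vars (\<lambda>_. clk p) (\<lambda>i \<omega>. \<omega> i) (UNIV :: ('d site \<times> nat) set)"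
  proof (subst indep_vars_iff_distr_eq_PiM')
    have "distr (east_clocks p) (clk p) (\<lambda>\<omega>. \<omega> i) = clk p" for i :: "'d site \<times> nat"
      unfolding east_clocks_eq by (rule distr_PiM_component) (auto intro: prob_space_clk)
    then have 1: "(\<lambda>i::'d site \<times> nat. distr (east_clocks p) (clk p) (\<lambda>\<omega>. \<omega> i)) = (\<lambda>_. clk p)" by (rule ext)
    have 2: "distr (east_clocks p) (\<Pi>\<^sub>M i\<in>UNIV. clk p) (\<lambda>\<omega>. \<omega>) = (east_clocks p :: ('d site \<times> nat \<Rightarrow> real \<times> bool) measure)"
      unfolding east_clocks_eq by (rule distr_id)
    show "distr (east_clocks p) (\<Pi>\<^sub>M i\<in>UNIV. clk p) (\<lambda>x. \<lambda>i\<in>UNIV. x i) = (\<Pi>\<^sub>M i\<in>(UNIV::('d site \<times> nat) set). distr (east_clocks p) (clk p) (\<lambda>x. x i))"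
      unfolding 1 restrict_UNIV 2 by (rule east_clocks_eq)
  qed (auto intro: measurable_coordinate)
  have "indep_vars (\<lambda>x. \<Pi>\<^sub>M i\<in>{x} \<times> UNIV. clk p) (\<lambda>x \<omega>. restrict (\<lambda>i. \<omega> i) ({x} \<times> UNIV)) UNIV"
    by (rule indep_vars_restrict[OF coord]) (auto simp: disjoint_family_on_def)
  then have "indep_vars (\<lambda>x. seqm p) (\<lambda>x \<omega>. (\<lambda>k. restrict (\<lambda>i. \<omega> i) ({x} \<times> UNIV) (x, k))) UNIV"
    by (rule indep_vars_compose2) (auto intro!: measurable_abs_UNIV measurable_component_singleton)
  then have ind: "indep_vars (\<lambda>x. seqm p) (\<lambda>x \<omega> k. \<omega> (x, k)) UNIV" by simp
  have "prob (\<Inter>x\<in>X. (\<lambda>\<omega> k. \<omega> (x, k)) -` A x \<inter> space (east_clocks p)) = (\<Prod>x\<in>X. prob ((\<lambda>\<omega> k. \<omega> (x, k)) -` A x \<inter> space (east_clocks p)))"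
    by (rule indep_varsD[OF ind False X]) (use A in auto)
  also have "\<dots> = (\<Prod>x\<in>X. measure (seqm p) (A x))"
  proof (rule prod.cong[OF refl])
    fix x assume "x \<in> X"
    then show "prob ((\<lambda>\<omega> k. \<omega> (x, k)) -` A x \<inter> space (east_clocks p)) = measure (seqm p) (A x)"
      using measure_distr[OF measurable_site_seq[of x p] A[of x]] by (simp add: distr_site_seq)
  qed
  also have "(\<Inter>x\<in>X. (\<lambda>\<omega> k. \<omega> (x, k)) -` A x \<inter> space (east_clocks p)) = {\<omega>. \<forall>x\<in>X. (\<lambda>k. \<omega> (x, k)) \<in> A x}"
    using False by auto
  finally show ?thesis .
qed

lemma sets_sites:
  assumes X: "finite X" and A: "\<And>x. x \<in> X \<Longrightarrow> A x \<in> sets (seqm p)"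
  shows "{\<omega>. \<forall>x\<in>X. (\<lambda>k. \<omega> (x, k)) \<in> A x} \<in> sets (east_clocks p)"
proof -
  have "{\<omega>\<in>space (east_clocks p). \<forall>x\<in>X. (\<lambda>k. \<omega> (x, k)) \<in> A x} \<in> sets (east_clocks p)"
  proof (rule sets.sets_Collect_finite_All[OF _ X])
    fix x assume "x \<in> X"
    then show "{\<omega> \<in> space (east_clocks p). (\<lambda>k. \<omega> (x, k)) \<in> A x} \<in> sets (east_clocks p)"
      using measurable_sets[OF measurable_site_seq A, of x x] by (simp add: vimage_def)
  qed
  then show ?thesis by simp
qed

text \<open>One word describes all sites of \<open>X\<close> together, with at most one ring per
  cell. Hence these events only capture clocks for which no two rings in \<open>X\<close> share a
  cell.\<close>

definition Ev :: "'d site set \<Rightarrow> real \<Rightarrow> ('d site \<times> bool) option list \<Rightarrow> ('d site \<times> nat \<Rightarrow> real \<times> bool) set" where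
  "Ev X h w = {\<omega>. \<forall>x\<in>X. sp h x 0 w 0 (\<lambda>k. \<omega> (x, k))}"

fun wt :: "real \<Rightarrow> real \<Rightarrow> ('s \<times> bool) option list \<Rightarrow> real" where
  "wt p h [] = 1"
| "wt p h (e # w) = (case e of None \<Rightarrow> 1 | Some (y, c) \<Rightarrow> h * cw p c) * wt p h w"

definition letters :: "'s set \<Rightarrow> ('s \<times> bool) option set" where
  "letters X = insert None (Some ` (X \<times> UNIV))"

definition words :: "'s set \<Rightarrow> nat \<Rightarrow> ('s \<times> bool) option list set" where
  "words X N = {w. set w \<subseteq> letters X \<and> length w = N}"

lemma finite_words: "finite X \<Longrightarrow> finite (words X N)"
  unfolding words_def letters_def by (intro finite_lists_length_eq) auto

lemma prod_wx:
  assumes "finite X" "set w \<subseteq> letters X"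
  shows "(\<Prod>x\<in>X. wx p h x w) = wt p h w"
  using assms(2)
proof (induction w)
  case (Cons e w)
  have "(\<Prod>x\<in>X. case e of None \<Rightarrow> 1 | Some (y, c) \<Rightarrow> if y = x then h * cw p c else 1) = (case e of None \<Rightarrow> 1 | Some (y, c) \<Rightarrow> h * cw p c)"
    using Cons.prems assms(1) by (auto simp: letters_def prod.delta')
  then show ?case using Cons by (simp add: prod.distrib)
qed simp

lemma sets_Ev: "finite X \<Longrightarrow> Ev X h w \<in> sets (east_clocks p)"
  using sets_sites[of X "\<lambda>x. {a. sp h x 0 w 0 a}" p] sets_sp unfolding Ev_def by (simp add: sets_sp)

lemma prob_Ev:
  assumes p: "0 \<le> p" "p \<le> 1" and h: "0 \<le> h" and X: "finite X" and w: "w \<in> words X N"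
  shows "measure (east_clocks p) (Ev X h w) = exp (- (h * real N)) ^ card X * wt p h w"
proof -
  have "measure (seqm p) {a. sp h x 0 w 0 a} = exp (- (h * real N)) * wx p h x w" for x :: "'a site"
  proof -
    have "emeasure (seqm p) {a. sp h x 0 w 0 a} = ennreal (exp (- (h * real N)) * wx p h x w)"
      using nn_integral_sp[OF p h, of 0 0 x w] w by (simp add: sets_sp words_def)
    then show ?thesis using wx_nonneg[OF p h, of x w] by (simp add: measure_def)
  qed
  then have "measure (east_clocks p) (Ev X h w) = (\<Prod>x\<in>X. exp (- (h * real N)) * wx p h x w)"
    using prob_sites[OF X, of "\<lambda>x. {a. sp h x 0 w 0 a}" p] by (simp add: sets_sp Ev_def)
  then show ?thesis using prod_wx[OF X, of w p h] w by (simp add: prod.distrib words_def)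
qed

section \<open>Ring counts and ring times read off a word\<close>

fun ringcount :: "'s \<Rightarrow> ('s \<times> bool) option list \<Rightarrow> nat" where
  "ringcount x [] = 0"
| "ringcount x (e # w) = (case e of None \<Rightarrow> 0 | Some (y, c) \<Rightarrow> if y = x then 1 else 0) + ringcount x w"

lemma sp_first: "sp h x b w s a \<Longrightarrow> 0 \<le> h \<Longrightarrow> b < s + fst (a 0)"
proof (induction w arbitrary: b)
  case (Cons e w)
  show ?case
  proof (cases "\<exists>c. e = Some (x, c)")
    case True
    then show ?thesis using Cons.prems by auto
  next
    case False
    then have "sp h x (b + h) w s a" using Cons.prems by (auto split: option.splits if_splits)
    from Cons.IH[OF this] Cons.prems show ?thesis by simp
  qed
qed simp

text \<open>The position of a ring inside its cell is unknown, but at the cell boundaries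
  \<open>b + h * i\<close> the number of past rings is determined by the word.\<close>

lemma sp_count:
  assumes "sp h x b w s a" "0 \<le> h" "\<And>k. 0 < fst (a k)" "i \<le> length w"
  shows "s + (\<Sum>k<Suc m. fst (a k)) \<le> b + h * real i \<longleftrightarrow> m < ringcount x (take i w)"
  using assms
proof (induction w arbitrary: b s a i m)
  case Nil
  have "fst (a 0) \<le> (\<Sum>k<Suc m. fst (a k))"
    by (rule member_le_sum) (use Nil.prems(3) in \<open>auto intro: less_imp_le\<close>)
  then show ?case using Nil by simp
next
  case (Cons e w)
  have first: "b < s + fst (a 0)" by (rule sp_first[OF Cons.prems(1,2)])
  have mono: "fst (a 0) \<le> (\<Sum>k<Suc m. fst (a k))" for m
    by (rule member_le_sum) (use Cons.prems(3) in \<open>auto intro: less_imp_le\<close>)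
  show ?case
  proof (cases i)
    case 0
    then show ?thesis using first mono[of m] by simp
  next
    case (Suc i')
    show ?thesis
    proof (cases "\<exists>c. e = Some (x, c)")
      case False
      then have "sp h x (b + h) w s a" using Cons.prems by (auto split: option.splits if_splits)
      from Cons.IH[OF this, of i' m] Cons.prems Suc False show ?thesis
        by (auto simp: algebra_simps split: option.split)
    next
      case True
      then obtain c where e: "e = Some (x, c)" by blast
      have sp': "s + fst (a 0) \<le> b + h" "sp h x (b + h) w (s + fst (a 0)) (\<lambda>k. a (Suc k))"
        using Cons.prems(1) by (auto simp: e)
      show ?thesis
      proof (cases m)
        case 0
        have "0 \<le> h * real i'" using Cons.prems(2) by simp
        then show ?thesis using sp' 0 Suc by (simp add: e algebra_simps)
      next
        case (Suc m')
        have "(\<Sum>k<Suc m. fst (a k)) = fst (a 0) + (\<Sum>k<Suc m'. fst (a (Suc k)))"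
          unfolding Suc by (rule sum.lessThan_Suc_shift)
        then show ?thesis using Cons.IH[OF sp'(2), of i' m'] Cons.prems \<open>i = Suc i'\<close> Suc
          by (simp add: e algebra_simps)
      qed
    qed
  qed
qed

lemma sp_ring:
  assumes "sp h x b w s a" "0 \<le> h" "i < length w" "w ! i = Some (x, c)"
  shows "b + h * real i < s + (\<Sum>k<Suc (ringcount x (take i w)). fst (a k))"
    "s + (\<Sum>k<Suc (ringcount x (take i w)). fst (a k)) \<le> b + h * real (Suc i)"
    "snd (a (ringcount x (take i w))) = c"
proof -
  have "b + h * real i < s + (\<Sum>k<Suc (ringcount x (take i w)). fst (a k)) \<and>
    s + (\<Sum>k<Suc (ringcount x (take i w)). fst (a k)) \<le> b + h * real (Suc i) \<and>
    snd (a (ringcount x (take i w))) = c"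
    using assms
  proof (induction w arbitrary: b s a i)
    case (Cons e w)
    show ?case
    proof (cases i)
      case 0
      then show ?thesis using Cons.prems by auto
    next
      case (Suc i')
      show ?thesis
      proof (cases "\<exists>c. e = Some (x, c)")
        case False
        then have "sp h x (b + h) w s a" using Cons.prems by (auto split: option.splits if_splits)
        from Cons.IH[OF this, of i'] Cons.prems Suc False show ?thesis
          by (auto simp: algebra_simps split: option.split)
      next
        case True
        then obtain c' where e: "e = Some (x, c')" by blast
        have sp': "sp h x (b + h) w (s + fst (a 0)) (\<lambda>k. a (Suc k))" using Cons.prems(1) by (auto simp: e)
        have "(\<Sum>k<Suc (ringcount x (take i (e # w))). fst (a k)) = fst (a 0) + (\<Sum>k<Suc (ringcount x (take i' w)). fst (a (Suc k)))"
          unfolding Suc e by (simp only: take_Suc_Cons ringcount.simps) (simp add: sum.lessThan_Suc_shift del: sum.lessThan_Suc)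
        then show ?thesis using Cons.IH[OF sp', of i'] Cons.prems Suc by (simp add: e algebra_simps)
      qed
    qed
  qed simp
  then show "b + h * real i < s + (\<Sum>k<Suc (ringcount x (take i w)). fst (a k))"
    "s + (\<Sum>k<Suc (ringcount x (take i w)). fst (a k)) \<le> b + h * real (Suc i)"
    "snd (a (ringcount x (take i w))) = c" by auto
qed

lemma sum_words_Suc:
  "finite X \<Longrightarrow> (\<Sum>w\<in>words X (Suc N). F w) = (\<Sum>w\<in>words X N. F (None # w)) + (\<Sum>x\<in>X. \<Sum>c\<in>UNIV. \<Sum>w\<in>words X N. F (Some (x, c) # w))"
proof -
  assume X: "finite X"
  have eq: "words X (Suc N) = (\<lambda>(e, w). e # w) ` (letters X \<times> words X N)"
    by (auto simp: words_def image_iff length_Suc_conv)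
  have "inj_on (\<lambda>(e, w). e # w) (letters X \<times> words X N)" by (auto simp: inj_on_def)
  then have "(\<Sum>w\<in>words X (Suc N). F w) = (\<Sum>(e, w)\<in>letters X \<times> words X N. F (e # w))"
    unfolding eq by (subst sum.reindex) (auto simp: case_prod_beta)
  also have "\<dots> = (\<Sum>e\<in>letters X. \<Sum>w\<in>words X N. F (e # w))" by (simp add: sum.cartesian_product)
  also have "\<dots> = (\<Sum>w\<in>words X N. F (None # w)) + (\<Sum>z\<in>X \<times> UNIV. \<Sum>w\<in>words X N. F (Some z # w))"
    unfolding letters_def using X by (subst sum.insert) (auto simp: sum.reindex)
  also have "(\<Sum>z\<in>X \<times> UNIV. \<Sum>w\<in>words X N. F (Some z # w)) = (\<Sum>x\<in>X. \<Sum>c\<in>UNIV. \<Sum>w\<in>words X N. F (Some (x, c) # w))"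
    using sum.cartesian_product[of "\<lambda>x c. \<Sum>w\<in>words X N. F (Some (x, c) # w)" UNIV X] by (simp add: case_prod_beta)
  finally show ?thesis .
qed

lemma words_0: "words X 0 = {[]}"
  by (auto simp: words_def)

section \<open>Runs driven by words\<close>

context facilitated
begin

fun run :: "('s \<times> bool) option list \<Rightarrow> ('s \<Rightarrow> bool) \<Rightarrow> 's \<Rightarrow> bool" where
  "run [] \<eta> = \<eta>"
| "run (e # w) \<eta> = run w (case e of None \<Rightarrow> \<eta> | Some (x, c) \<Rightarrow> if fac \<eta> x then \<eta>(x := c) else \<eta>)"

lemma run_snoc: "run (w @ [e]) \<eta> = (case e of None \<Rightarrow> run w \<eta> | Some (x, c) \<Rightarrow> if fac (run w \<eta>) x then (run w \<eta>)(x := c) else run w \<eta>)"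
  by (induction w arbitrary: \<eta>) (auto split: option.split)

text \<open>A word carries both the order of the rings and the coins. Summing out the coins produces
  \<open>EE\<close>; the weights \<open>h\<close> of the rings that remain produce
  \<open>WS\<close>.\<close>

lemma sum_words_run:
  assumes X: "finite X"
  shows "(\<Sum>w\<in>words X N. wt p h w * f (run w \<eta>)) = WS X h N (\<lambda>L. EE L \<eta> (\<lambda>tr. f (last tr)))"
proof (induction N arbitrary: \<eta>)
  case 0
  then show ?case by (simp add: words_0)
next
  case (Suc N)
  let ?G = "\<lambda>\<eta>. \<Sum>w\<in>words X N. wt p h w * f (run w \<eta>)"
  let ?E = "\<lambda>\<eta>. WS X h N (\<lambda>L. EE L \<eta> (\<lambda>tr. f (last tr)))"
  have last: "EE (x # L) \<eta> (\<lambda>tr. f (last tr)) = (if fac \<eta> x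
      then p * EE L (\<eta>(x := True)) (\<lambda>tr. f (last tr)) + (1 - p) * EE L (\<eta>(x := False)) (\<lambda>tr. f (last tr))
      else EE L \<eta> (\<lambda>tr. f (last tr)))" for x L
  proof -
    have "EE L \<zeta> (\<lambda>tr. f (last (\<eta> # tr))) = EE L \<zeta> (\<lambda>tr. f (last tr))" for \<zeta>
      by (rule EE_cong) auto
    then show ?thesis by simp
  qed
  have "(\<Sum>c\<in>UNIV. \<Sum>w\<in>words X N. wt p h (Some (x, c) # w) * f (run (Some (x, c) # w) \<eta>)) = h * WS X h N (\<lambda>L. EE (x # L) \<eta> (\<lambda>tr. f (last tr)))" for x
  proof -
    have "(\<Sum>w\<in>words X N. wt p h (Some (x, c) # w) * f (run (Some (x, c) # w) \<eta>)) = h * cw p c * ?E (if fac \<eta> x then \<eta>(x := c) else \<eta>)" for c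
      unfolding Suc[symmetric] sum_distrib_left by (simp add: mult.assoc)
    then have "(\<Sum>c\<in>UNIV. \<Sum>w\<in>words X N. wt p h (Some (x, c) # w) * f (run (Some (x, c) # w) \<eta>)) =
       h * p * ?E (if fac \<eta> x then \<eta>(x := True) else \<eta>) + h * (1 - p) * ?E (if fac \<eta> x then \<eta>(x := False) else \<eta>)"
      by (simp only: UNIV_bool) (simp add: cw_def)
    moreover have "WS X h N (\<lambda>L. EE (x # L) \<eta> (\<lambda>tr. f (last tr))) =
       p * ?E (if fac \<eta> x then \<eta>(x := True) else \<eta>) + (1 - p) * ?E (if fac \<eta> x then \<eta>(x := False) else \<eta>)"
    proof (cases "fac \<eta> x")
      case True
      then show ?thesis unfolding last by (simp add: WS_add WS_scale)
    next
      case False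
      then have "p * ?E \<eta> + (1 - p) * ?E \<eta> = ?E \<eta>" by (simp add: algebra_simps)
      then show ?thesis unfolding last using False by simp
    qed
    ultimately show ?thesis by (simp add: distrib_left mult.assoc)
  qed
  then show ?case unfolding sum_words_Suc[OF X] by (simp add: Suc sum_distrib_left)
qed

lemma sum_words_wt:
  fixes X :: "'s set"
  assumes X: "finite X"
  shows "(\<Sum>w\<in>words X N. wt p h w) = (1 + h * real (card X)) ^ N"
  using sum_words_run[OF X, of h "\<lambda>_. 1" "\<lambda>_. True" N] by (simp add: EE_const WS_const)

end

section \<open>The graphical construction\<close>

definition epar :: "'d site \<Rightarrow> 'd site set" where
  "epar x = range (shift_down x)"

definition hgt :: "('d::finite) site \<Rightarrow> int" where
  "hgt x = (\<Sum>i\<in>UNIV. x i)"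

lemma hgt_shift_down: "hgt (shift_down x i) = hgt x - 1"
proof -
  have "hgt (shift_down x i) = (x i - 1) + (\<Sum>j\<in>UNIV - {i}. x j)"
    unfolding hgt_def shift_down_def by (subst sum.remove[of UNIV i]) auto
  moreover have "hgt x = x i + (\<Sum>j\<in>UNIV - {i}. x j)"
    unfolding hgt_def by (subst sum.remove[of UNIV i]) auto
  ultimately show ?thesis by simp
qed

locale east_dim = refresh p for p +
  fixes dim :: "'d::finite itself"
begin

sublocale east: oriented p "epar :: 'd site \<Rightarrow> 'd site set" hgt
  by unfold_locales (auto simp: epar_def hgt_shift_down)

lemma fac_iff: "east.fac \<eta> x \<longleftrightarrow> (\<exists>i. \<not> \<eta> (shift_down x i))"
  by (auto simp: east.fac_def epar_def)

end

section \<open>Dependencies in the graphical construction\<close>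

definition pos_clocks :: "('d site \<times> nat \<Rightarrow> real \<times> bool) \<Rightarrow> bool" where
  "pos_clocks \<omega> \<longleftrightarrow> (\<forall>i. 0 < fst (\<omega> i))"

definition unb_clocks :: "('d site \<times> nat \<Rightarrow> real \<times> bool) \<Rightarrow> bool" where
  "unb_clocks \<omega> \<longleftrightarrow> (\<forall>x T. \<exists>m. T < ring_time \<omega> x m)"

lemma ring_time_strict_mono: "pos_clocks \<omega> \<Longrightarrow> strict_mono (ring_time \<omega> x)"
  by (rule strict_monoI_Suc) (simp add: ring_time_def pos_clocks_def)

lemma ring_time_pos: "pos_clocks \<omega> \<Longrightarrow> 1 \<le> n \<Longrightarrow> 0 < ring_time \<omega> x n"
  using strict_monoD[OF ring_time_strict_mono, of \<omega> 0 n x] by (simp add: ring_time_def)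

lemma ring_time_less_iff:
  assumes "pos_clocks \<omega>" "unb_clocks \<omega>" "1 \<le> m"
  shows "ring_time \<omega> x m < s \<longleftrightarrow> m \<le> rings_before \<omega> x s"
proof -
  note mono = ring_time_strict_mono[OF assms(1), of x]
  obtain M where M: "s < ring_time \<omega> x M" using assms(2) unfolding unb_clocks_def by blast
  define k where "k = (LEAST k. \<not> ring_time \<omega> x (Suc k) < s)"
  have "\<not> ring_time \<omega> x (Suc M) < s"
    using M strict_monoD[OF mono, of M "Suc M"] by simp
  then have k: "\<not> ring_time \<omega> x (Suc k) < s" unfolding k_def by (rule LeastI)
  have "ring_time \<omega> x m < s \<longleftrightarrow> m \<le> k" if "1 \<le> m" for m
  proof
    assume "m \<le> k"
    then have "m - 1 < k" using that by simp
    then show "ring_time \<omega> x m < s" using not_less_Least[of "m - 1" "\<lambda>k. \<not> ring_time \<omega> x (Suc k) < s"] that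
      unfolding k_def by simp
  next
    assume "ring_time \<omega> x m < s"
    then have "ring_time \<omega> x m < ring_time \<omega> x (Suc k)" using k by simp
    then show "m \<le> k" using strict_mono_less[OF mono] by simp
  qed
  then have "{m. 1 \<le> m \<and> ring_time \<omega> x m < s} = {1..k}" and *: "ring_time \<omega> x m < s \<longleftrightarrow> m \<le> k" using assms(3) by auto
  then have "rings_before \<omega> x s = k" by (simp add: rings_before_def)
  with * show ?thesis by simp
qed

text \<open>The spin indexed by the right member is computed from those on the left. In infinite
  volume a chain of dependencies could descend through infinitely many sites within a bounded time;
  well-foundedness excludes this and yields a unique solution by recursion.\<close>

definition dep :: "('d site \<times> nat \<Rightarrow> real \<times> bool) \<Rightarrow> (('d site \<times> nat) \<times> ('d site \<times> nat)) set" where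
  "dep \<omega> = {((y, m), (x, k)). \<exists>n. k = Suc n \<and>
     ((y = x \<and> m = n) \<or> (\<exists>i. y = shift_down x i \<and> m = rings_before \<omega> y (ring_time \<omega> x (Suc n))))}"

lemma ex1_east_solution:
  assumes "wf (dep \<omega>)"
  shows "\<exists>!v. east_solution \<eta> \<omega> v"
proof -
  define F where "F = (\<lambda>f xn. case snd xn of 0 \<Rightarrow> \<eta> (fst xn)
     | Suc n \<Rightarrow> if \<exists>i. \<not> f (shift_down (fst xn) i, rings_before \<omega> (shift_down (fst xn) i) (ring_time \<omega> (fst xn) (Suc n)))
               then coin \<omega> (fst xn) (Suc n) else f (fst xn, n))"
  define v where "v = (\<lambda>x n. wfrec (dep \<omega>) F (x, n))"
  have v: "v x n = F (cut (wfrec (dep \<omega>) F) (dep \<omega>) (x, n)) (x, n)" for x n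
    unfolding v_def by (rule wfrec[OF assms])
  have c: "cut (wfrec (dep \<omega>) F) (dep \<omega>) (x, Suc n) (x, n) = v x n" for x n
    unfolding v_def by (rule cut_apply) (auto simp: dep_def)
  have c': "cut (wfrec (dep \<omega>) F) (dep \<omega>) (x, Suc n) (shift_down x i, rings_before \<omega> (shift_down x i) (ring_time \<omega> x (Suc n)))
     = v (shift_down x i) (rings_before \<omega> (shift_down x i) (ring_time \<omega> x (Suc n)))" for x n i
    unfolding v_def by (rule cut_apply) (auto simp: dep_def)
  have sol: "east_solution \<eta> \<omega> v"
    unfolding east_solution_def
  proof (intro conjI allI)
    show "v x 0 = \<eta> x" for x by (subst v) (simp add: F_def)
    show "v x (Suc n) = (if \<exists>i. \<not> v (shift_down x i) (rings_before \<omega> (shift_down x i) (ring_time \<omega> x (Suc n))) then coin \<omega> x (Suc n) else v x n)" for x n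
      by (subst v, subst F_def) (simp only: snd_conv fst_conv nat.case c c')
  qed
  show ?thesis
  proof (rule ex1I[where a = v])
    show "east_solution \<eta> \<omega> v" by (rule sol)
    fix u assume u: "east_solution \<eta> \<omega> u"
    have "u (fst xn) (snd xn) = v (fst xn) (snd xn)" for xn
      using assms
    proof (induction xn rule: wf_induct_rule)
      case (less xn)
      obtain x k where xn: "xn = (x, k)" by (cases xn)
      show ?case
      proof (cases k)
        case 0
        then show ?thesis using u sol by (simp add: east_solution_def xn)
      next
        case (Suc n)
        have "u x n = v x n" using less[of "(x, n)"] by (simp add: dep_def xn Suc)
        moreover have "u (shift_down x i) (rings_before \<omega> (shift_down x i) (ring_time \<omega> x (Suc n))) = v (shift_down x i) (rings_before \<omega> (shift_down x i) (ring_time \<omega> x (Suc n)))" for i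
          using less[of "(shift_down x i, rings_before \<omega> (shift_down x i) (ring_time \<omega> x (Suc n)))"] by (auto simp: dep_def xn Suc)
        moreover have "u x (Suc n) = (if \<exists>i. \<not> u (shift_down x i) (rings_before \<omega> (shift_down x i) (ring_time \<omega> x (Suc n))) then coin \<omega> x (Suc n) else u x n)"
          using u unfolding east_solution_def by blast
        moreover have "v x (Suc n) = (if \<exists>i. \<not> v (shift_down x i) (rings_before \<omega> (shift_down x i) (ring_time \<omega> x (Suc n))) then coin \<omega> x (Suc n) else v x n)"
          using sol unfolding east_solution_def by blast
        ultimately show ?thesis by (simp add: xn Suc)
      qed
    qed
    from this[of "(x, n)" for x n] show "u = v" by (intro ext) simp
  qed
qed

text \<open>All rings that influence the pair occur at sites of \<open>X\<close>. A pair with count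
  0 is an initial spin and may lie anywhere, so a site outside \<open>X\<close> is allowed as long
  as it has not rung.\<close>

inductive okn :: "('d site \<times> nat \<Rightarrow> real \<times> bool) \<Rightarrow> 'd site set \<Rightarrow> 'd site \<Rightarrow> nat \<Rightarrow> bool" for \<omega> X where
  ok0: "okn \<omega> X x 0"
| okS: "x \<in> X \<Longrightarrow> okn \<omega> X x n \<Longrightarrow> (\<And>i. okn \<omega> X (shift_down x i) (rings_before \<omega> (shift_down x i) (ring_time \<omega> x (Suc n)))) \<Longrightarrow> okn \<omega> X x (Suc n)"

inductive_cases okn_SucE: "okn \<omega> X x (Suc n)"

lemma okn_eq_0: "okn \<omega> X x n \<Longrightarrow> x \<notin> X \<Longrightarrow> n = 0"
  by (auto elim: okn.cases)

lemma okn_mono: "okn \<omega> X x n \<Longrightarrow> X \<subseteq> Y \<Longrightarrow> okn \<omega> Y x n"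
  by (induction rule: okn.induct) (auto intro: okn.intros)

text \<open>Each pair depends directly on finitely many others, so a well-founded relation leaves
  only finitely many sites of influence, as in Koenig's lemma.\<close>

lemma ex_okn:
  fixes \<omega> :: "('d::finite) site \<times> nat \<Rightarrow> real \<times> bool"
  assumes "wf (dep \<omega>)"
  shows "\<exists>X. finite X \<and> okn \<omega> X x n"
proof -
  have "\<exists>X. finite X \<and> okn \<omega> X (fst xn) (snd xn)" for xn
    using assms
  proof (induction xn rule: wf_induct_rule)
    case (less xn)
    obtain x k where xn: "xn = (x, k)" by (cases xn)
    show ?case
    proof (cases k)
      case 0
      then show ?thesis using xn by (auto intro: ok0)
    next
      case (Suc n)
      let ?m = "\<lambda>i. rings_before \<omega> (shift_down x i) (ring_time \<omega> x (Suc n))"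
      obtain X0 where X0: "finite X0" "okn \<omega> X0 x n" using less[of "(x, n)"] by (auto simp: dep_def xn Suc)
      have "\<exists>X. finite X \<and> okn \<omega> X (shift_down x i) (?m i)" for i
        using less[of "(shift_down x i, ?m i)"] by (auto simp: dep_def xn Suc)
      then obtain X where X: "finite (X i)" "okn \<omega> (X i) (shift_down x i) (?m i)" for i by metis
      define Y where "Y = insert x (X0 \<union> (\<Union>i. X i))"
      have "finite Y" using X0 X by (simp add: Y_def)
      moreover have "okn \<omega> Y x (Suc n)"
      proof (rule okS)
        show "okn \<omega> Y x n" by (rule okn_mono[OF X0(2)]) (auto simp: Y_def)
        show "okn \<omega> Y (shift_down x i) (?m i)" for i by (rule okn_mono[OF X(2)]) (auto simp: Y_def)
      qed (simp add: Y_def)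
      ultimately show ?thesis using xn Suc by auto
    qed
  qed
  from this[of "(x, n)"] show ?thesis by simp
qed

lemma ringcount_snoc: "ringcount x (w @ [e]) = ringcount x w + (case e of None \<Rightarrow> 0 | Some (y, c) \<Rightarrow> if y = x then 1 else 0)"
  by (induction w) auto

lemma ringcount_outside: "set w \<subseteq> letters X \<Longrightarrow> x \<notin> X \<Longrightarrow> ringcount x w = 0"
  by (induction w) (auto simp: letters_def)

lemma Ev_count:
  assumes "\<omega> \<in> Ev X h w" "x \<in> X" "0 \<le> h" "pos_clocks \<omega>" "i \<le> length w"
  shows "ring_time \<omega> x (Suc m) \<le> h * real i \<longleftrightarrow> m < ringcount x (take i w)"
proof -
  have "sp h x 0 w 0 (\<lambda>k. \<omega> (x, k))" using assms by (simp add: Ev_def)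
  from sp_count[OF this assms(3) _ assms(5), of m] show ?thesis
    using assms(4) by (simp add: pos_clocks_def ring_time_def)
qed

lemma Ev_ring:
  assumes "\<omega> \<in> Ev X h w" "x \<in> X" "0 \<le> h" "i < length w" "w ! i = Some (x, c)"
  shows "h * real i < ring_time \<omega> x (Suc (ringcount x (take i w)))"
    "ring_time \<omega> x (Suc (ringcount x (take i w))) \<le> h * real (Suc i)"
    "coin \<omega> x (Suc (ringcount x (take i w))) = c"
proof -
  have "sp h x 0 w 0 (\<lambda>k. \<omega> (x, k))" using assms by (simp add: Ev_def)
  note r = sp_ring[OF this assms(3-5)]
  show "h * real i < ring_time \<omega> x (Suc (ringcount x (take i w)))"
    "ring_time \<omega> x (Suc (ringcount x (take i w))) \<le> h * real (Suc i)"
    "coin \<omega> x (Suc (ringcount x (take i w))) = c"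
    using r by (simp_all add: ring_time_def coin_def)
qed

text \<open>Increments of the ring counts between cell boundaries recover the sites in the word, and
  the coin attached to the ring so counted recovers the bit. Different words therefore give disjoint
  events.\<close>

lemma Ev_unique:
  assumes "\<omega> \<in> Ev X h w" "\<omega> \<in> Ev X h w'" "w \<in> words X N" "w' \<in> words X N" "0 \<le> h" "pos_clocks \<omega>"
  shows "w = w'"
proof (rule nth_equalityI)
  have l: "length w = N" "length w' = N" "set w \<subseteq> letters X" "set w' \<subseteq> letters X" using assms by (auto simp: words_def)
  then show "length w = length w'" by simp
  have rc: "ringcount x (take i w) = ringcount x (take i w')" if "i \<le> N" "x \<in> X" for i x
  proof -
    have "m < ringcount x (take i w) \<longleftrightarrow> m < ringcount x (take i w')" for m
      using Ev_count[OF assms(1) that(2) assms(5,6), of i m] Ev_count[OF assms(2) that(2) assms(5,6), of i m] l that by simp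
    then show ?thesis by (metis less_irrefl linorder_neqE_nat)
  qed
  have half: "v ! i = Some (x, c) \<Longrightarrow> v' ! i = Some (x, c)"
    if "i < N" "\<omega> \<in> Ev X h v" "\<omega> \<in> Ev X h v'" "length v = N" "length v' = N" "set v \<subseteq> letters X"
      "\<And>j y. j \<le> N \<Longrightarrow> y \<in> X \<Longrightarrow> ringcount y (take j v) = ringcount y (take j v')" for i x c v v'
  proof -
    assume vi: "v ! i = Some (x, c)"
    note H = that
    have "v ! i \<in> set v" using that(1,4) by simp
    with that(6) have "v ! i \<in> letters X" by (rule subsetD)
    then have xX: "x \<in> X" unfolding vi letters_def by auto
    have "ringcount x (take (Suc i) v) = Suc (ringcount x (take i v))"
      using that(1,4) vi by (simp add: take_Suc_conv_app_nth ringcount_snoc)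
    then have "ringcount x (take (Suc i) v') = Suc (ringcount x (take i v'))"
      using that(7)[of i x] that(7)[of "Suc i" x] that(1) xX by simp
    moreover have "ringcount x (take (Suc i) v') = ringcount x (take i v') + (case v' ! i of None \<Rightarrow> 0 | Some (y, c) \<Rightarrow> if y = x then 1 else 0)"
      using H(1,5) by (simp add: take_Suc_conv_app_nth ringcount_snoc)
    ultimately have "(case v' ! i of None \<Rightarrow> 0 | Some (y, c) \<Rightarrow> if y = x then 1 else 0) = (1::nat)" by linarith
    then obtain c' where c': "v' ! i = Some (x, c')"
      by (cases "v' ! i") (auto split: if_splits)
    have "c = c'"
      using Ev_ring(3)[OF that(2) xX assms(5), of i c] Ev_ring(3)[OF that(3) xX assms(5), of i c'] that(1,4,5) that(7)[of i x] vi c' xX by simp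
    with c' show ?thesis by simp
  qed
  fix i assume "i < length w"
  then have i: "i < N" using l by simp
  have 1: "w ! i = Some (x, c) \<Longrightarrow> w' ! i = Some (x, c)" for x c
    by (rule half[OF i assms(1,2) l(1,2,3)]) (simp_all add: rc)
  have 2: "w' ! i = Some (x, c) \<Longrightarrow> w ! i = Some (x, c)" for x c
    by (rule half[OF i assms(2,1) l(2,1,4)]) (simp_all add: rc)
  show "w ! i = w' ! i"
  proof (cases "w ! i")
    case None
    have "w' ! i = None"
    proof (rule ccontr)
      assume "w' ! i \<noteq> None"
      then obtain x c where "w' ! i = Some (x, c)" by fastforce
      from 2[OF this] None show False by simp
    qed
    with None show ?thesis by simp
  next
    case (Some xc)
    then show ?thesis using 1[of "fst xc" "snd xc"] by simp
  qed
qed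

context east_dim
begin

text \<open>Induction over the cells. If \<open>x\<close> rings in a cell, no other site of
  \<open>X\<close> does, so a parent in \<open>X\<close> has rung as often before that ring as
  before the cell; a parent outside \<open>X\<close> has not rung at all by \<open>okn\<close>. Word
  and clocks thus update \<open>x\<close> by the same rule.\<close>

lemma run_eq_solution:
  fixes X :: "'d site set"
  assumes v: "east_solution \<eta> \<omega> v" and Ev: "\<omega> \<in> Ev X h w" and w: "set w \<subseteq> letters X" and h: "0 \<le> h" and pos: "pos_clocks \<omega>"
  shows "i \<le> length w \<Longrightarrow> okn \<omega> X x (ringcount x (take i w)) \<Longrightarrow> east.run (take i w) \<eta> x = v x (ringcount x (take i w))"
proof (induction i arbitrary: x)
  case 0
  then show ?case using v by (simp add: east_solution_def)
next
  case (Suc i)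
  have i: "i < length w" "i \<le> length w" using Suc.prems by auto
  have tk: "take (Suc i) w = take i w @ [w ! i]" using i by (simp add: take_Suc_conv_app_nth)
  let ?n = "ringcount x (take i w)" and ?\<eta> = "east.run (take i w) \<eta>"
  show ?case
  proof (cases "\<exists>c. w ! i = Some (x, c)")
    case False
    then have "ringcount x (take (Suc i) w) = ?n" unfolding tk by (auto simp: ringcount_snoc split: option.splits)
    moreover have "east.run (take (Suc i) w) \<eta> x = ?\<eta> x" unfolding tk east.run_snoc using False by (auto split: option.splits)
    ultimately show ?thesis using Suc.IH[OF i(2), of x] Suc.prems(2) by (simp only:)
  next
    case True
    then obtain c where c: "w ! i = Some (x, c)" by blast
    have "w ! i \<in> letters X" by (rule subsetD[OF w nth_mem[OF i(1)]])
    then have xX: "x \<in> X" unfolding c letters_def by auto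
    have n: "ringcount x (take (Suc i) w) = Suc ?n" unfolding tk by (simp add: ringcount_snoc c)
    note ring = Ev_ring[OF Ev xX h i(1) c]
    let ?\<tau> = "ring_time \<omega> x (Suc ?n)"
    have "okn \<omega> X x (Suc ?n)" using Suc.prems n by simp
    from okn_SucE[OF this] have ok: "okn \<omega> X x ?n" "\<And>j. okn \<omega> X (shift_down x j) (rings_before \<omega> (shift_down x j) ?\<tau>)"
      by metis+
    have x: "?\<eta> x = v x ?n" using Suc.IH[OF i(2) ok(1)] .
    have nb: "?\<eta> (shift_down x j) = v (shift_down x j) (rings_before \<omega> (shift_down x j) ?\<tau>)" for j
    proof -
      let ?y = "shift_down x j"
      have yx: "?y \<noteq> x" using hgt_shift_down[of x j] by auto
      have e2: "rings_before \<omega> ?y ?\<tau> = ringcount ?y (take i w)"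
      proof (cases "?y \<in> X")
        case True
        have e: "ringcount ?y (take (Suc i) w) = ringcount ?y (take i w)"
          unfolding tk using yx by (simp add: ringcount_snoc c)
        have "ring_time \<omega> ?y m < ?\<tau> \<longleftrightarrow> m \<le> ringcount ?y (take i w)" if "1 \<le> m" for m
        proof -
          obtain m' where m': "m = Suc m'" using \<open>1 \<le> m\<close> by (cases m) auto
          have a: "ring_time \<omega> ?y m \<le> h * real i \<longleftrightarrow> m' < ringcount ?y (take i w)"
            "ring_time \<omega> ?y m \<le> h * real (Suc i) \<longleftrightarrow> m' < ringcount ?y (take i w)"
            using Ev_count[OF Ev True h pos, of i m'] Ev_count[OF Ev True h pos, of "Suc i" m'] i e m' by simp_all
          have "ring_time \<omega> ?y m < ?\<tau> \<longleftrightarrow> m' < ringcount ?y (take i w)"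
            using a ring(1,2) by (meson le_less_trans less_imp_le less_le_trans not_le)
          then show ?thesis unfolding m' by (simp only: Suc_le_eq)
        qed
        then have "{m. 1 \<le> m \<and> ring_time \<omega> ?y m < ?\<tau>} = {1..ringcount ?y (take i w)}" by auto
        then show ?thesis by (simp add: rings_before_def)
      next
        case False
        have "rings_before \<omega> ?y ?\<tau> = 0" by (rule okn_eq_0[OF ok(2) False])
        moreover have "ringcount ?y (take i w) = 0"
          by (rule ringcount_outside[OF _ False]) (rule order_trans[OF set_take_subset w])
        ultimately show ?thesis by simp
      qed
      have "okn \<omega> X ?y (ringcount ?y (take i w))" using ok(2)[of j] unfolding e2 .
      then show ?thesis unfolding e2 by (rule Suc.IH[OF i(2)])
    qed
    have "v x (Suc ?n) = (if \<exists>i. \<not> v (shift_down x i) (rings_before \<omega> (shift_down x i) ?\<tau>) then coin \<omega> x (Suc ?n) else v x ?n)"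
      using v unfolding east_solution_def by blast
    also have "\<dots> = (if east.fac ?\<eta> x then c else ?\<eta> x)"
      by (simp only: fac_iff nb x ring(3))
    also have "\<dots> = east.run (take (Suc i) w) \<eta> x"
      unfolding tk east.run_snoc by (simp add: c)
    finally show ?thesis using n by simp
  qed
qed

lemma east_config_eq_run:
  fixes X :: "'d site set"
  assumes wf: "wf (dep \<omega>)" and Ev: "\<omega> \<in> Ev X h w" and w: "w \<in> words X N" and h: "0 \<le> h" and pos: "pos_clocks \<omega>"
    and ok: "okn \<omega> X x (rings_upto \<omega> x (h * real N))"
  shows "east_config \<eta> (h * real N) \<omega> x = east.run w \<eta> x"
proof -
  define v where "v = (THE v. east_solution \<eta> \<omega> v)"
  have ex: "\<exists>!v. east_solution \<eta> \<omega> v" by (rule ex1_east_solution[OF wf])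
  then have v: "east_solution \<eta> \<omega> v" unfolding v_def by (rule theI')
  have l: "length w = N" "set w \<subseteq> letters X" using w by (auto simp: words_def)
  have "rings_upto \<omega> x (h * real N) = ringcount x w"
  proof (cases "x \<in> X")
    case True
    have "{m. 1 \<le> m \<and> ring_time \<omega> x m \<le> h * real N} = {1..ringcount x w}"
    proof -
      have "ring_time \<omega> x m \<le> h * real N \<longleftrightarrow> m \<le> ringcount x w" if "1 \<le> m" for m
        using Ev_count[OF Ev True h pos, of N "m - 1"] l that by auto
      then show ?thesis by auto
    qed
    then show ?thesis by (simp add: rings_upto_def)
  next
    case False
    have "rings_upto \<omega> x (h * real N) = 0" by (rule okn_eq_0[OF ok False])
    then show ?thesis using ringcount_outside[OF l(2) False] by simp
  qed
  then show ?thesis using run_eq_solution[OF v Ev l(2) h pos, of N x] ok l ex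
    by (simp add: east_config_def v_def[symmetric])
qed

end

lemma nn_integral_clk_fst:
  assumes p: "0 \<le> p" "p \<le> 1" and f: "f \<in> borel_measurable borel"
  shows "(\<integral>\<^sup>+y. f (fst y) \<partial>clk p) = (\<integral>\<^sup>+u. ennreal (exponential_density 1 u) * f u \<partial>lborel)"
proof -
  have "(\<integral>\<^sup>+y. f (fst y) \<partial>clk p) = (\<integral>\<^sup>+y. f (fst y) * indicator {True} (snd y) + f (fst y) * indicator {False} (snd y) \<partial>clk p)"
    by (rule nn_integral_cong) (auto simp: indicator_def)
  also have "\<dots> = (\<integral>\<^sup>+y. f (fst y) * indicator {True} (snd y) \<partial>clk p) + (\<integral>\<^sup>+y. f (fst y) * indicator {False} (snd y) \<partial>clk p)"
    by (intro nn_integral_add measurable_clk_product f)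
  also have "\<dots> = (\<integral>\<^sup>+u. ennreal (exponential_density 1 u) * f u \<partial>lborel) * (ennreal p + ennreal (1 - p))"
    using f by (simp add: nn_integral_clk p distrib_left)
  also have "ennreal p + ennreal (1 - p) = 1" using p by (subst ennreal_plus[symmetric]) auto
  finally show ?thesis by simp
qed

lemma AE_clk_pos:
  assumes "0 \<le> p" "p \<le> 1"
  shows "AE y in clk p. 0 < fst y"
proof -
  have "(\<integral>\<^sup>+y. indicator {..0} (fst y) \<partial>clk p) = (\<integral>\<^sup>+u. ennreal (exponential_density 1 u) * indicator {..0} u \<partial>lborel)"
    by (rule nn_integral_clk_fst[OF assms]) simp
  also have "\<dots> = (\<integral>\<^sup>+u. 0 \<partial>(lborel :: real measure))"
  proof (rule nn_integral_cong_AE)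
    have "AE u in lborel. u \<noteq> (0::real)" by (rule AE_lborel_singleton)
    then show "AE u in lborel. ennreal (exponential_density 1 u) * indicator {..0} u = 0"
      by eventually_elim (auto simp: indicator_def exponential_density_def)
  qed
  finally have "(\<integral>\<^sup>+y. indicator {..0} (fst y) \<partial>clk p) = 0" by simp
  moreover have "(\<lambda>y. indicator {..0} (fst y) :: ennreal) \<in> borel_measurable (clk p)"
    by (rule measurable_compose[OF measurable_fst_clk]) simp
  ultimately have "AE y in clk p. (indicator {..0} (fst y) :: ennreal) = 0" by (simp add: nn_integral_0_iff_AE)
  then show ?thesis by eventually_elim (auto simp: indicator_def split: if_splits)
qed

lemma AE_pos_clocks:
  assumes "0 \<le> p" "p \<le> 1"
  shows "AE \<omega> in (east_clocks p :: (('d::finite) site \<times> nat \<Rightarrow> real \<times> bool) measure). pos_clocks \<omega>"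
  unfolding pos_clocks_def AE_all_countable
proof
  fix i :: "'d site \<times> nat"
  show "AE \<omega> in east_clocks p. 0 < fst (\<omega> i)"
    unfolding east_clocks_eq
    by (rule AE_PiM_component[where P = "\<lambda>y. 0 < fst y"]) (use AE_clk_pos[OF assms] in \<open>auto intro: prob_space_clk\<close>)
qed

lemma measurable_ring_time: "(\<lambda>\<omega>. ring_time \<omega> x n) \<in> borel_measurable (east_clocks p)"
  unfolding ring_time_def by (intro borel_measurable_sum measurable_compose[OF measurable_coordinate measurable_fst_clk])

section \<open>Almost sure well-posedness\<close>

context east_dim
begin

lemma p01: "0 \<le> p" "p \<le> 1"
  using p0 p1 by auto

abbreviation \<Omega> :: "('d site \<times> nat \<Rightarrow> real \<times> bool) measure" where
  "\<Omega> \<equiv> east_clocks p"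

definition simple :: "'d site set \<Rightarrow> real \<Rightarrow> nat \<Rightarrow> ('d site \<times> nat \<Rightarrow> real \<times> bool) set" where
  "simple X h N = (\<Union>w\<in>words X N. Ev X h w)"

lemma sets_simple: "finite X \<Longrightarrow> simple X h N \<in> sets \<Omega>"
  unfolding simple_def by (intro sets.finite_UN finite_words sets_Ev)

lemma AE_pos: "AE \<omega> in \<Omega>. pos_clocks \<omega>"
  by (rule AE_pos_clocks[OF p01])

lemma measure_UN_Ev:
  assumes X: "finite X" and W: "W \<subseteq> words X N" and h: "0 \<le> h"
  shows "measure \<Omega> (\<Union>w\<in>W. Ev X h w) = exp (- (h * real N)) ^ card X * (\<Sum>w\<in>W. wt p h w)"
proof -
  interpret prob_space \<Omega> by (rule prob_space_east_clocks)
  have W': "finite W" using finite_subset[OF W finite_words[OF X]] .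
  have "measure \<Omega> (\<Union>w\<in>W. Ev X h w) = (\<Sum>w\<in>W. measure \<Omega> (Ev X h w))"
  proof (rule measure_UNION_AE[OF W'])
    show "Ev X h w \<in> fmeasurable \<Omega>" for w by (simp add: sets_Ev[OF X] fmeasurable_eq_sets)
    show "pairwise (\<lambda>v w. AE \<omega> in \<Omega>. \<omega> \<notin> Ev X h v \<or> \<omega> \<notin> Ev X h w) W"
      unfolding pairwise_def
    proof (intro ballI impI)
      fix v w assume vw: "v \<in> W" "w \<in> W" "v \<noteq> w"
      show "AE \<omega> in \<Omega>. \<omega> \<notin> Ev X h v \<or> \<omega> \<notin> Ev X h w"
        using AE_pos by eventually_elim (use Ev_unique[of _ X h v w N] vw W h in blast)
    qed
  qed
  also have "\<dots> = (\<Sum>w\<in>W. exp (- (h * real N)) ^ card X * wt p h w)"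
    using W by (intro sum.cong refl prob_Ev[OF p01 h X]) auto
  finally show ?thesis by (simp add: sum_distrib_left)
qed

lemma measure_simple:
  assumes "finite X" "0 \<le> h"
  shows "measure \<Omega> (simple X h N) = exp (- (h * real N)) ^ card X * (1 + h * real (card X)) ^ N"
  unfolding simple_def using measure_UN_Ev[OF assms(1) order_refl assms(2)] east.sum_words_wt[OF assms(1)] by simp

text \<open>The probability is exp(-t)^\<open>card X\<close> (1 + t \<open>card X\<close> / N)^N, an
  exponential and the classical approximation of its inverse: coincidences disappear as the cells
  shrink.\<close>

lemma measure_simple_tendsto:
  assumes X: "finite X" and t: "0 \<le> t"
  shows "(\<lambda>N. measure \<Omega> (simple X (t / real N) N)) \<longlonglongrightarrow> 1"
proof -
  have "(\<lambda>N. exp (- t) ^ card X * (1 + (t * real (card X)) / real N) ^ N) \<longlonglongrightarrow> exp (- t) ^ card X * exp (t * real (card X))"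
    by (intro tendsto_mult tendsto_const tendsto_exp_limit_sequentially)
  also have "exp (- t) ^ card X * exp (t * real (card X)) = 1"
    by (simp add: exp_of_nat_mult[symmetric] exp_add[symmetric] mult.commute)
  finally show ?thesis
  proof (rule Lim_transform_eventually)
    show "\<forall>\<^sub>F N in sequentially. exp (- t) ^ card X * (1 + t * real (card X) / real N) ^ N = measure \<Omega> (simple X (t / real N) N)"
      using eventually_gt_at_top[of 0]
    proof eventually_elim
      case (elim N)
      then show ?case using measure_simple[OF X, of "t / real N" N] t by simp
    qed
  qed
qed

text \<open>On \<open>simple\<close> the first ring not listed in the word comes after the horizon,
  and these events have probability close to 1 for fine cells.\<close>

lemma AE_unb: "AE \<omega> in \<Omega>. unb_clocks \<omega>"
proof -
  interpret prob_space \<Omega> by (rule prob_space_east_clocks)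
  have "AE \<omega> in \<Omega>. \<exists>m. real T < ring_time \<omega> x m" for x :: "'d site" and T :: nat
  proof -
    define G where "G = {\<omega>\<in>space \<Omega>. \<exists>m. real T < ring_time \<omega> x m}"
    have G: "G \<in> sets \<Omega>" unfolding G_def using measurable_ring_time[of x _ p] by measurable
    have "measure \<Omega> (simple {x} (real T / real N) N) \<le> measure \<Omega> G" if "0 < N" for N
    proof (rule finite_measure_mono_AE[OF _ G])
      show "AE \<omega> in \<Omega>. \<omega> \<in> simple {x} (real T / real N) N \<longrightarrow> \<omega> \<in> G"
        using AE_pos
      proof eventually_elim
        case (elim \<omega>)
        show ?case
        proof
          assume "\<omega> \<in> simple {x} (real T / real N) N"
          then obtain w where w: "w \<in> words {x} N" "\<omega> \<in> Ev {x} (real T / real N) w" by (auto simp: simple_def)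
          have "\<not> ring_time \<omega> x (Suc (ringcount x w)) \<le> real T / real N * real N"
            using Ev_count[OF w(2) _ _ elim, of x N "ringcount x w"] w(1) by (simp add: words_def)
          then show "\<omega> \<in> G" using that by (auto simp: G_def not_le)
        qed
      qed
    qed
    then have "\<forall>\<^sub>F N in sequentially. measure \<Omega> (simple {x} (real T / real N) N) \<le> measure \<Omega> G"
      by (rule eventually_mono[OF eventually_gt_at_top[of "0::nat"]])
    then have "1 \<le> measure \<Omega> G"
      by (intro tendsto_upperbound[OF measure_simple_tendsto[of "{x}" "real T"]]) auto
    then have "prob G = 1" using prob_le_1[of G] by simp
    then have "AE \<omega> in \<Omega>. \<omega> \<in> G" by (simp add: prob_eq_1 G)
    then show ?thesis by eventually_elim (simp add: G_def)
  qed
  then have "AE \<omega> in \<Omega>. \<forall>x T. \<exists>m. real T < ring_time \<omega> x m" by (simp add: AE_all_countable)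
  then show ?thesis
  proof eventually_elim
    case (elim \<omega>)
    show ?case unfolding unb_clocks_def
    proof (intro allI)
      fix x T
      obtain n :: nat where "T \<le> real n" using real_arch_simple by blast
      moreover obtain m where "real n < ring_time \<omega> x m" using elim by blast
      ultimately show "\<exists>m. T < ring_time \<omega> x m" by (auto intro: le_less_trans)
    qed
  qed
qed

text \<open>The sequence of waiting times gives at least one ring in the \<open>j\<close>-th time cell of length \<open>\<delta>\<close>. For small \<open>\<delta>\<close>
  the \<open>d\<^sup>l\<close> downward paths are too few for infinite chains of such sites, which makes the dependencies well-founded.\<close>

definition active :: "real \<Rightarrow> nat \<Rightarrow> (nat \<Rightarrow> real \<times> bool) set" where
  "active \<delta> j = {a. \<exists>n\<ge>1. \<delta> * real j < (\<Sum>k<n. fst (a k)) \<and> (\<Sum>k<n. fst (a k)) \<le> \<delta> * real (Suc j)}"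

lemma sets_active: "active \<delta> j \<in> sets (seqm p)"
proof -
  have "{a\<in>space (seqm p). \<exists>n\<ge>1. \<delta> * real j < (\<Sum>k<n. fst (a k)) \<and> (\<Sum>k<n. fst (a k)) \<le> \<delta> * real (Suc j)} \<in> sets (seqm p)"
    by measurable
  then show ?thesis by (simp add: active_def space_seqm)
qed

text \<open>The complement is bounded from below: each cell is cut into \<open>M\<close> small ones,
  and words without a ring in the last \<open>M\<close> of them have a probability tending to
  exp(-\<delta>) as \<open>M\<close> grows.\<close>

lemma measure_active_le:
  assumes \<delta>: "0 < \<delta>"
  shows "measure (seqm p) (active \<delta> j) \<le> 1 - exp (- \<delta>)"
proof -
  interpret prob_space \<Omega> by (rule prob_space_east_clocks)
  \<comment> \<open>Any site serves: the clocks of all sites have the law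
    \<open>seqm p\<close>.\<close>
  obtain x :: "'d site" where True by blast
  define G where "G = {\<omega>. (\<lambda>k. \<omega> (x, k)) \<in> active \<delta> j}"
  have G: "G \<in> sets \<Omega>" using sets_sites[of "{x}" "\<lambda>_. active \<delta> j" p] sets_active by (simp add: G_def)
  have mG: "measure \<Omega> G = measure (seqm p) (active \<delta> j)"
    using prob_sites[of "{x}" "\<lambda>_. active \<delta> j" p] sets_active by (simp add: G_def)
  have le: "exp (- (\<delta> * real (Suc j))) * (1 + \<delta> / real M) ^ (M * j) \<le> measure \<Omega> (space \<Omega> - G)" if M: "0 < M" for M
  proof -
    let ?h = "\<delta> / real M"
    have h: "0 \<le> ?h" using \<delta> by simp
    define W where "W = (\<lambda>u. u @ replicate M None) ` words {x} (M * j)"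
    have W: "W \<subseteq> words {x} (M * Suc j)" by (auto simp: W_def words_def letters_def)
    have hN: "?h * real (M * Suc j) = \<delta> * real (Suc j)" "?h * real (M * j) = \<delta> * real j" using M by (auto simp: field_simps)
    have wt_app: "wt p ?h (u @ replicate m None) = wt p ?h u" for u :: "('d site \<times> bool) option list" and m
    proof (induction u)
      case Nil
      show ?case by (induction m) auto
    qed simp
    have "(\<Sum>w\<in>W. wt p ?h w) = (\<Sum>u\<in>words {x} (M * j). wt p ?h u)"
      unfolding W_def by (subst sum.reindex) (auto simp: inj_on_def wt_app)
    also have "\<dots> = (1 + ?h) ^ (M * j)" using east.sum_words_wt[of "{x}" ?h "M * j"] by simp
    finally have "exp (- (\<delta> * real (Suc j))) * (1 + ?h) ^ (M * j) = measure \<Omega> (\<Union>w\<in>W. Ev {x} ?h w)"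
      using measure_UN_Ev[OF _ W h] hN by simp
    also have "\<dots> \<le> measure \<Omega> (space \<Omega> - G)"
    proof (rule finite_measure_mono_AE)
      show "AE \<omega> in \<Omega>. \<omega> \<in> (\<Union>w\<in>W. Ev {x} ?h w) \<longrightarrow> \<omega> \<in> space \<Omega> - G"
        using AE_pos
      proof eventually_elim
        case (elim \<omega>)
        show ?case
        proof
          assume "\<omega> \<in> (\<Union>w\<in>W. Ev {x} ?h w)"
          then obtain u where u: "u \<in> words {x} (M * j)" "\<omega> \<in> Ev {x} ?h (u @ replicate M None)" by (auto simp: W_def)
          have lu: "length u = M * j" using u by (simp add: words_def)
          have rc: "ringcount x (u @ replicate M None) = ringcount x u"
          proof (induction u)
            case Nil
            show ?case by (induction M) auto
          qed simp
          have "ring_time \<omega> x (Suc m) \<le> \<delta> * real j \<longleftrightarrow> ring_time \<omega> x (Suc m) \<le> \<delta> * real (Suc j)" for m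
            using Ev_count[OF u(2) _ h elim, of x "M * j" m] Ev_count[OF u(2) _ h elim, of x "M * Suc j" m] lu rc hN by simp
          then have "\<not> (\<delta> * real j < ring_time \<omega> x n \<and> ring_time \<omega> x n \<le> \<delta> * real (Suc j))" if "1 \<le> n" for n
            using that by (cases n) (auto simp: not_less)
          then show "\<omega> \<in> space \<Omega> - G" by (auto simp: G_def active_def ring_time_def)
        qed
      qed
    qed (rule sets.compl_sets[OF G])
    finally show ?thesis .
  qed
  have "(\<lambda>M. exp (- (\<delta> * real (Suc j))) * ((1 + \<delta> / real M) ^ M) ^ j) \<longlonglongrightarrow> exp (- (\<delta> * real (Suc j))) * exp \<delta> ^ j"
    by (intro tendsto_mult tendsto_const tendsto_power tendsto_exp_limit_sequentially)
  moreover have "exp (- (\<delta> * real (Suc j))) * exp \<delta> ^ j = exp (- \<delta>)"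
    by (simp add: exp_of_nat_mult[symmetric] exp_add[symmetric] algebra_simps)
  moreover have "\<forall>\<^sub>F M in sequentially. exp (- (\<delta> * real (Suc j))) * ((1 + \<delta> / real M) ^ M) ^ j \<le> measure \<Omega> (space \<Omega> - G)"
    using eventually_gt_at_top[of "0::nat"] by eventually_elim (use le in \<open>simp add: power_mult\<close>)
  ultimately have "exp (- \<delta>) \<le> measure \<Omega> (space \<Omega> - G)"
    using tendsto_upperbound[of "\<lambda>M. exp (- (\<delta> * real (Suc j))) * ((1 + \<delta> / real M) ^ M) ^ j" "exp (- \<delta>)" sequentially "measure \<Omega> (space \<Omega> - G)"]
    by (simp only: trivial_limit_sequentially not_False_eq_True)
  then show ?thesis using prob_compl[OF G] mG by simp
qed

lemma length_paths: "\<gamma> \<in> east.paths k y \<Longrightarrow> length \<gamma> = k"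
  by (induction k arbitrary: y \<gamma>) auto

lemma paths_hgt: "\<gamma> \<in> east.paths k y \<Longrightarrow> distinct \<gamma> \<and> (\<forall>z\<in>set \<gamma>. hgt z \<le> hgt y)"
proof (induction k arbitrary: y \<gamma>)
  case (Suc k)
  then obtain y' \<gamma>' where \<gamma>: "\<gamma> = y # \<gamma>'" "y' \<in> epar y" "\<gamma>' \<in> east.paths k y'" by auto
  have "hgt y' < hgt y" using \<gamma>(2) by (rule east.rk_par)
  with Suc.IH[OF \<gamma>(3)] show ?case by (auto simp: \<gamma>(1))
qed simp

lemma finite_card_paths: "finite (east.paths k y) \<and> card (east.paths k y) \<le> CARD('d) ^ k"
proof (induction k arbitrary: y)
  case (Suc k)
  have eq: "east.paths (Suc k) y = (\<Union>i. (#) y ` east.paths k (shift_down y i))" by (auto simp: epar_def)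
  have "card (east.paths (Suc k) y) \<le> (\<Sum>i\<in>UNIV. card ((#) y ` east.paths k (shift_down y i)))"
    unfolding eq by (rule card_UN_le) simp
  also have "\<dots> \<le> (\<Sum>i\<in>(UNIV::'d set). CARD('d) ^ k)"
    by (intro sum_mono order_trans[OF card_image_le]) (use Suc in auto)
  finally show ?case unfolding eq using Suc by simp
qed simp

definition shortp :: "real \<Rightarrow> ('d site \<times> nat \<Rightarrow> real \<times> bool) \<Rightarrow> nat \<Rightarrow> 'd site \<Rightarrow> nat \<Rightarrow> bool" where
  "shortp \<delta> \<omega> j x l \<longleftrightarrow> (\<forall>\<gamma>\<in>east.paths l x. \<exists>z\<in>set \<gamma>. (\<lambda>k. \<omega> (z, k)) \<notin> active \<delta> j)"

text \<open>The sites of a path are distinct, hence independent, and each is active with probability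
  at most \<delta>. The expected number of fully active paths of length \<open>l\<close> is at most
  \<open>2 ^ (- l)\<close> by the choice of \<delta>, which tends to 0.\<close>

lemma AE_shortp:
  assumes \<delta>: "\<delta> = 1 / (2 * real CARD('d))"
  shows "AE \<omega> in \<Omega>. \<forall>j x. \<exists>l. shortp \<delta> \<omega> j x l"
proof -
  interpret prob_space \<Omega> by (rule prob_space_east_clocks)
  have \<delta>0: "0 < \<delta>" by (simp add: \<delta>)
  have "AE \<omega> in \<Omega>. \<exists>l. shortp \<delta> \<omega> j x l" for j and x :: "'d site"
  proof -
    define A where "A \<gamma> = {\<omega>. \<forall>z\<in>set \<gamma>. (\<lambda>k. \<omega> (z, k)) \<in> active \<delta> j}" for \<gamma> :: "'d site list"
    define B where "B l = (\<Union>\<gamma>\<in>east.paths l x. A \<gamma>)" for l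
    have A: "A \<gamma> \<in> sets \<Omega>" for \<gamma> unfolding A_def by (rule sets_sites) (auto simp: sets_active)
    have B: "B l \<in> sets \<Omega>" for l unfolding B_def using finite_card_paths A by (intro sets.finite_UN) auto
    define \<rho> where "\<rho> = measure (seqm p) (active \<delta> j)"
    have \<rho>0: "0 \<le> \<rho>" by (simp add: \<rho>_def)
    have "\<rho> \<le> \<delta>" using measure_active_le[OF \<delta>0, of j] exp_ge_add_one_self[of "- \<delta>"] by (simp add: \<rho>_def)
    then have d\<rho>: "real CARD('d) * \<rho> \<le> 1 / 2" by (simp add: \<delta> field_simps)
    have mB: "measure \<Omega> (B l) \<le> (1 / 2) ^ l" for l
    proof -
      have "measure \<Omega> (B l) \<le> (\<Sum>\<gamma>\<in>east.paths l x. measure \<Omega> (A \<gamma>))"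
        unfolding B_def using finite_card_paths A by (intro finite_measure_subadditive_finite) auto
      also have "\<dots> = (\<Sum>\<gamma>\<in>east.paths l x. \<rho> ^ l)"
      proof (rule sum.cong[OF refl])
        fix \<gamma> assume \<gamma>: "\<gamma> \<in> east.paths l x"
        have "measure \<Omega> (A \<gamma>) = (\<Prod>z\<in>set \<gamma>. \<rho>)" unfolding A_def \<rho>_def by (rule prob_sites) (auto simp: sets_active)
        then show "measure \<Omega> (A \<gamma>) = \<rho> ^ l"
          using paths_hgt[OF \<gamma>] length_paths[OF \<gamma>] distinct_card[of \<gamma>] by simp
      qed
      also have "\<dots> \<le> real (CARD('d) ^ l) * \<rho> ^ l"
        using finite_card_paths[of l x] \<rho>0 by (simp add: mult_right_mono del: of_nat_power)
      also have "\<dots> = (real CARD('d) * \<rho>) ^ l" by (simp add: power_mult_distrib)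
      also have "\<dots> \<le> (1 / 2) ^ l" using d\<rho> \<rho>0 by (intro power_mono) auto
      finally show ?thesis .
    qed
    define G where "G = (\<Inter>l. B l)"
    have G: "G \<in> sets \<Omega>" unfolding G_def using B by auto
    have "measure \<Omega> G \<le> (1 / 2) ^ l" for l
      by (rule order_trans[OF finite_measure_mono mB]) (use B in \<open>auto simp: G_def\<close>)
    moreover have "(\<lambda>l. (1 / 2 :: real) ^ l) \<longlonglongrightarrow> 0" by (rule LIMSEQ_power_zero) simp
    ultimately have "measure \<Omega> G \<le> 0" by (intro tendsto_lowerbound[of _ 0 sequentially]) auto
    then have "measure \<Omega> G = 0" by (simp add: measure_le_0_iff)
    then have "AE \<omega> in \<Omega>. \<omega> \<notin> G" using G by (intro AE_not_in) (auto simp: null_sets_def emeasure_eq_measure)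
    then show ?thesis
      by eventually_elim (auto simp: G_def B_def A_def shortp_def)
  qed
  then show ?thesis by (simp add: AE_all_countable)
qed

text \<open>Lexicographic descent in the cell, the depth in this cell, and the ring count. A
  dependency never leads to a later cell. A step to a parent inside one cell lowers the depth
  because \<open>x\<close> is active there; a step at the same site lowers the count. Initial spins
  rank below everything.\<close>

lemma wf_dep:
  assumes pos: "pos_clocks \<omega>" and unb: "unb_clocks \<omega>" and \<delta>: "0 < \<delta>" and short: "\<And>j x. \<exists>l. shortp \<delta> \<omega> j x l"
  shows "wf (dep \<omega>)"
proof -
  define depth where "depth j x = (LEAST l. shortp \<delta> \<omega> j x l)" for j x
  have depth: "shortp \<delta> \<omega> j x (depth j x)" for j x
    unfolding depth_def using short by (rule LeastI_ex)
  \<comment> \<open>The cells are open on the left and closed on the right, as in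
    \<open>active\<close>, whence the ceiling minus one.\<close>
  define cell where "cell x n = nat (\<lceil>ring_time \<omega> x n / \<delta>\<rceil> - 1)" for x n
  have cell: "\<delta> * real (cell x n) < ring_time \<omega> x n" "ring_time \<omega> x n \<le> \<delta> * real (Suc (cell x n))" if "1 \<le> n" for x n
  proof -
    have "0 < ring_time \<omega> x n / \<delta>" using ring_time_pos[OF pos that] \<delta> by simp
    then have "1 \<le> \<lceil>ring_time \<omega> x n / \<delta>\<rceil>" by (simp add: le_ceiling_iff)
    then have "real (cell x n) = of_int \<lceil>ring_time \<omega> x n / \<delta>\<rceil> - 1" by (simp add: cell_def)
    moreover have "of_int \<lceil>ring_time \<omega> x n / \<delta>\<rceil> - 1 < ring_time \<omega> x n / \<delta>" "ring_time \<omega> x n / \<delta> \<le> of_int \<lceil>ring_time \<omega> x n / \<delta>\<rceil>"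
      by linarith+
    ultimately have "real (cell x n) < ring_time \<omega> x n / \<delta>" "ring_time \<omega> x n / \<delta> \<le> real (Suc (cell x n))" by auto
    then show "\<delta> * real (cell x n) < ring_time \<omega> x n" "ring_time \<omega> x n \<le> \<delta> * real (Suc (cell x n))"
      using \<delta> by (simp_all add: field_simps)
  qed
  have cell_mono: "cell y m \<le> cell x n" if "ring_time \<omega> y m \<le> ring_time \<omega> x n" for x y m n
    unfolding cell_def using that \<delta> by (intro nat_mono diff_right_mono ceiling_mono divide_right_mono) auto
  have depth_less: "depth j (shift_down x i) < depth j x" if "(\<lambda>k. \<omega> (x, k)) \<in> active \<delta> j" for j x i
  proof -
    have "depth j x \<noteq> 0"
    proof
      assume "depth j x = 0"
      with depth[of j x] show False by (simp add: shortp_def)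
    qed
    then obtain l where l: "depth j x = Suc l" by (metis not0_implies_Suc)
    have "shortp \<delta> \<omega> j (shift_down x i) l"
      unfolding shortp_def
    proof
      fix \<gamma> assume "\<gamma> \<in> east.paths l (shift_down x i)"
      then have "x # \<gamma> \<in> east.paths (Suc l) x" by (auto simp: epar_def)
      then obtain z where "z \<in> set (x # \<gamma>)" "(\<lambda>k. \<omega> (z, k)) \<notin> active \<delta> j" using depth[of j x] unfolding l shortp_def by blast
      then show "\<exists>z\<in>set \<gamma>. (\<lambda>k. \<omega> (z, k)) \<notin> active \<delta> j" using that by auto
    qed
    then have "depth j (shift_down x i) \<le> l" unfolding depth_def by (rule Least_le)
    with l show ?thesis by simp
  qed
  define f where "f = (\<lambda>(x, n). (if n = 0 then 0 else Suc (cell x n), depth (cell x n) x, n))"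
  have "dep \<omega> \<subseteq> inv_image (less_than <*lex*> less_than <*lex*> less_than) f"
  proof
    fix e assume "e \<in> dep \<omega>"
    moreover obtain y m x k where e': "e = ((y, m), (x, k))" by (metis surj_pair)
    ultimately have "\<exists>n. k = Suc n \<and> ((y = x \<and> m = n) \<or> (\<exists>i. y = shift_down x i \<and> m = rings_before \<omega> y (ring_time \<omega> x (Suc n))))"
      unfolding dep_def by simp
    then obtain n where k: "k = Suc n"
      and c: "(y = x \<and> m = n) \<or> (\<exists>i. y = shift_down x i \<and> m = rings_before \<omega> y (ring_time \<omega> x (Suc n)))"
      by (elim exE conjE)
    have e: "e = ((y, m), (x, Suc n))" unfolding e' k ..
    show "e \<in> inv_image (less_than <*lex*> less_than <*lex*> less_than) f"
    proof (cases "m = 0")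
      case True
      then show ?thesis by (simp add: e f_def)
    next
      case False
      from c show ?thesis
      proof
        assume yx: "y = x \<and> m = n"
        have "ring_time \<omega> x n < ring_time \<omega> x (Suc n)" using strict_monoD[OF ring_time_strict_mono[OF pos], of n "Suc n" x] by simp
        then have "cell x n \<le> cell x (Suc n)" by (intro cell_mono) simp
        then show ?thesis using yx False by (auto simp: e f_def)
      next
        assume "\<exists>i. y = shift_down x i \<and> m = rings_before \<omega> y (ring_time \<omega> x (Suc n))"
        then obtain i where i: "y = shift_down x i" "m = rings_before \<omega> y (ring_time \<omega> x (Suc n))" by blast
        have "ring_time \<omega> y m < ring_time \<omega> x (Suc n)"
          using ring_time_less_iff[OF pos unb, of m y] False i(2) by simp
        then have le: "cell y m \<le> cell x (Suc n)" by (intro cell_mono) simp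
        have "(\<lambda>k. \<omega> (x, k)) \<in> active \<delta> (cell x (Suc n))"
          unfolding active_def using cell[of "Suc n" x] by (intro CollectI exI[of _ "Suc n"]) (simp add: ring_time_def)
        from depth_less[OF this, of i] have "depth (cell x (Suc n)) y < depth (cell x (Suc n)) x" by (simp add: i(1))
        then show ?thesis using le False by (auto simp: e f_def le_less)
      qed
    qed
  qed
  then show ?thesis by (rule wf_subset[rotated]) auto
qed

lemma AE_good: "AE \<omega> in \<Omega>. pos_clocks \<omega> \<and> wf (dep \<omega>)"
  using AE_pos AE_unb AE_shortp[OF refl]
proof eventually_elim
  case (elim \<omega>)
  have "wf (dep \<omega>)" by (rule wf_dep[OF elim(1,2), of "1 / (2 * real CARD('d))"]) (use elim(3) in auto)
  with elim show ?case by simp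
qed

section \<open>Finite-volume approximation of the expectation\<close>

definition box :: "nat \<Rightarrow> 'd site set" where
  "box B = {x. \<forall>i. x i \<in> {- int B..int B}}"

lemma finite_box: "finite (box B)"
proof -
  have "box B = (UNIV \<rightarrow>\<^sub>E {- int B..int B})" by (auto simp: box_def)
  then show ?thesis by (simp add: finite_PiE)
qed

lemma eventually_subset_box:
  assumes "finite Y"
  shows "\<forall>\<^sub>F B in sequentially. Y \<subseteq> box B"
proof -
  have "\<forall>\<^sub>F B in sequentially. \<forall>y\<in>Y. \<forall>i\<in>UNIV. y i \<in> {- int B..int B}"
  proof (intro eventually_ball_finite assms ballI finite)
    fix y :: "'d site" and i
    show "\<forall>\<^sub>F B in sequentially. y i \<in> {- int B..int B}"
      using eventually_ge_at_top[of "nat \<bar>y i\<bar>"] by eventually_elim auto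
  qed
  then show ?thesis by eventually_elim (auto simp: box_def)
qed

text \<open>A measurable approximation to \<open>f\<close> of the configuration at time
  \<open>h * N\<close>: it involves finitely many clock events, takes the value given by the word of
  the clocks on \<open>simple\<close>, and vanishes elsewhere.\<close>

definition gw :: "('d config \<Rightarrow> real) \<Rightarrow> 'd config \<Rightarrow> 'd site set \<Rightarrow> real \<Rightarrow> nat \<Rightarrow> ('d site \<times> nat \<Rightarrow> real \<times> bool) \<Rightarrow> real" where
  "gw f \<eta> X h N \<omega> = (\<Sum>w\<in>words X N. f (east.run w \<eta>) * indicator (Ev X h w) \<omega>)"

lemma gw_eq:
  assumes "finite X" "0 \<le> h" "pos_clocks \<omega>" "w \<in> words X N" "\<omega> \<in> Ev X h w"
  shows "gw f \<eta> X h N \<omega> = f (east.run w \<eta>)"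
proof -
  have "gw f \<eta> X h N \<omega> = (\<Sum>v\<in>words X N. if v = w then f (east.run w \<eta>) else 0)"
    unfolding gw_def
  proof (rule sum.cong[OF refl])
    fix v assume v: "v \<in> words X N"
    show "f (east.run v \<eta>) * indicator (Ev X h v) \<omega> = (if v = w then f (east.run w \<eta>) else 0)"
    proof (cases "v = w")
      case True
      then show ?thesis using assms(5) by simp
    next
      case False
      then have "\<omega> \<notin> Ev X h v" using Ev_unique[OF assms(5) _ assms(4) v assms(2,3)] by blast
      then show ?thesis using False by simp
    qed
  qed
  then show ?thesis using assms(4) by (simp add: finite_words[OF assms(1)])
qed

lemma gw_eq_0: "\<omega> \<notin> simple X h N \<Longrightarrow> gw f \<eta> X h N \<omega> = 0"
  unfolding gw_def simple_def by (rule sum.neutral) auto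

lemma integral_gw:
  assumes X: "finite X" and h: "0 \<le> h"
  shows "(\<integral>\<omega>. gw f \<eta> X h N \<omega> \<partial>\<Omega>) = exp (- (h * real N)) ^ card X * WS X h N (\<lambda>L. east.EE L \<eta> (\<lambda>tr. f (last tr)))"
proof -
  interpret prob_space \<Omega> by (rule prob_space_east_clocks)
  have "(\<integral>\<omega>. gw f \<eta> X h N \<omega> \<partial>\<Omega>) = (\<Sum>w\<in>words X N. f (east.run w \<eta>) * measure \<Omega> (Ev X h w))"
  proof -
    have "integrable \<Omega> (indicator (Ev X h w) :: _ \<Rightarrow> real)" for w
      by (rule integrable_real_indicator[OF sets_Ev[OF X]]) (simp add: less_top[symmetric])
    then show ?thesis unfolding gw_def by (subst Bochner_Integration.integral_sum) auto
  qed
  also have "\<dots> = (\<Sum>w\<in>words X N. exp (- (h * real N)) ^ card X * (wt p h w * f (east.run w \<eta>)))"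
    by (intro sum.cong refl) (simp add: prob_Ev[OF p01 h X])
  finally show ?thesis by (simp add: sum_distrib_left[symmetric] east.sum_words_run[OF X])
qed

text \<open>Almost surely the rings that influence \<Lambda> lie in a finite set, which large boxes
  contain, and the cells eventually separate all rings in the box. The approximation is then exact,
  and dominated convergence applies. The second limit says that the total mass of the schedules
  tends to 1.\<close>

theorem east_expect_limit:
  fixes f :: "'d config \<Rightarrow> real"
  assumes \<Lambda>: "finite \<Lambda>" and f: "supp_in f \<Lambda>" and M: "\<And>\<zeta>. \<bar>f \<zeta>\<bar> \<le> M" and t: "0 < t"
  obtains Ns :: "nat \<Rightarrow> nat" where
    "\<And>B. 0 < Ns B"
    "(\<lambda>B. exp (- t) ^ card (box B) * (1 + t / real (Ns B) * real (card (box B))) ^ Ns B) \<longlonglongrightarrow> 1"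
    "(\<lambda>B. exp (- t) ^ card (box B) * WS (box B) (t / real (Ns B)) (Ns B) (\<lambda>L. east.EE L \<eta> (\<lambda>tr. f (last tr)))) \<longlonglongrightarrow> east_expect p \<eta> t f"
proof -
  interpret prob_space \<Omega> by (rule prob_space_east_clocks)
  have ex: "\<exists>N. 0 < N \<and> 1 - (1/2) ^ B < measure \<Omega> (simple (box B) (t / real N) N)" for B
  proof -
    have "\<forall>\<^sub>F N in sequentially. 1 - (1/2) ^ B < measure \<Omega> (simple (box B) (t / real N) N)"
      by (rule order_tendstoD(1)[OF measure_simple_tendsto[OF finite_box]]) (use t in auto)
    then have "\<forall>\<^sub>F N in sequentially. 0 < N \<and> 1 - (1/2) ^ B < measure \<Omega> (simple (box B) (t / real N) N)"
      using eventually_gt_at_top[of "0::nat"] by eventually_elim simp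
    then show ?thesis by (rule eventually_happens'[rotated]) simp
  qed
  \<comment> \<open>The cells are made so fine that the exceptional probabilities are below
    \<open>(1/2) ^ B\<close>, hence summable, for the Borel-Cantelli lemma.\<close>
  define Ns where "Ns B = (SOME N. 0 < N \<and> 1 - (1/2) ^ B < measure \<Omega> (simple (box B) (t / real N) N))" for B
  have Ns: "0 < Ns B \<and> 1 - (1/2) ^ B < measure \<Omega> (simple (box B) (t / real (Ns B)) (Ns B))" for B
    unfolding Ns_def by (rule someI_ex[OF ex])
  have N0: "0 < Ns B" for B by (rule conjunct1[OF Ns])
  have Nm: "1 - (1/2) ^ B < measure \<Omega> (simple (box B) (t / real (Ns B)) (Ns B))" for B by (rule conjunct2[OF Ns])
  define h where "h B = t / real (Ns B)" for B
  have h0: "0 \<le> h B" and hN: "h B * real (Ns B) = t" for B using t N0[of B] by (auto simp: h_def)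
  define S where "S B = simple (box B) (h B) (Ns B)" for B
  have S: "S B \<in> sets \<Omega>" for B unfolding S_def by (rule sets_simple[OF finite_box])
  have mS: "1 - (1/2) ^ B < measure \<Omega> (S B)" for B using Nm[of B] by (simp add: S_def h_def)
  have ev: "AE \<omega> in \<Omega>. \<forall>\<^sub>F B in sequentially. \<omega> \<in> S B"
  proof -
    have "AE \<omega> in \<Omega>. \<forall>\<^sub>F B in sequentially. \<omega> \<in> space \<Omega> - (space \<Omega> - S B)"
    proof (rule borel_cantelli_AE1)
      show "summable (\<lambda>B. measure \<Omega> (space \<Omega> - S B))"
      proof (rule summable_comparison_test')
        show "summable (\<lambda>B. (1 / 2 :: real) ^ B)" by (rule summable_geometric) simp
        show "norm (measure \<Omega> (space \<Omega> - S B)) \<le> (1 / 2) ^ B" if "0 \<le> B" for B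
          using mS[of B] prob_compl[OF S[of B]] by simp
      qed
      show "space \<Omega> - S B \<in> sets \<Omega>" for B by (rule sets.compl_sets[OF S])
      show "emeasure \<Omega> (space \<Omega> - S B) < \<infinity>" for B
        unfolding emeasure_eq_measure by simp
    qed
    then show ?thesis
    proof eventually_elim
      case (elim \<omega>)
      then show ?case by (rule eventually_mono) blast
    qed
  qed
  define g where "g B = gw f \<eta> (box B) (h B) (Ns B)" for B
  define F where "F \<omega> = f (east_config \<eta> t \<omega>)" for \<omega>
  have gm: "g B \<in> borel_measurable \<Omega>" for B
    unfolding g_def gw_def by (intro sets_Ev[OF finite_box] borel_measurable_sum borel_measurable_times borel_measurable_const borel_measurable_indicator)
  have lim: "AE \<omega> in \<Omega>. (\<lambda>B. g B \<omega>) \<longlonglongrightarrow> F \<omega>"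
    using ev AE_good
  proof eventually_elim
    case (elim \<omega>)
    note good = elim(2)
    have ex': "\<exists>X. finite X \<and> okn \<omega> X x (rings_upto \<omega> x t)" for x by (rule ex_okn[OF conjunct2[OF elim(2)]])
    define X where "X x = (SOME X. finite X \<and> okn \<omega> X x (rings_upto \<omega> x t))" for x
    have X': "finite (X x) \<and> okn \<omega> (X x) x (rings_upto \<omega> x t)" for x
      unfolding X_def by (rule someI_ex[OF ex'])
    have X: "finite (X x)" "okn \<omega> (X x) x (rings_upto \<omega> x t)" for x by (rule conjunct1[OF X'], rule conjunct2[OF X'])
    define Y where "Y = (\<Union>x\<in>\<Lambda>. X x)"
    have "finite Y" using X \<Lambda> by (simp add: Y_def)
    then have "\<forall>\<^sub>F B in sequentially. Y \<subseteq> box B" by (rule eventually_subset_box)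
    then have "\<forall>\<^sub>F B in sequentially. g B \<omega> = F \<omega>"
      using elim(1)
    proof eventually_elim
      case (elim B)
      then obtain w where w: "w \<in> words (box B) (Ns B)" "\<omega> \<in> Ev (box B) (h B) w" unfolding S_def simple_def by blast
      have pos: "pos_clocks \<omega>" and wf: "wf (dep \<omega>)" by (rule conjunct1[OF good], rule conjunct2[OF good])
      have "\<forall>x\<in>\<Lambda>. east_config \<eta> t \<omega> x = east.run w \<eta> x"
      proof
        fix x assume that: "x \<in> \<Lambda>"
        have "X x \<subseteq> box B" using elim(1) that unfolding Y_def by blast
        then have "okn \<omega> (box B) x (rings_upto \<omega> x (h B * real (Ns B)))" unfolding hN by (rule okn_mono[OF X(2)])
        from east_config_eq_run[OF wf w(2,1) h0 pos this, of \<eta>] show "east_config \<eta> t \<omega> x = east.run w \<eta> x" unfolding hN .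
      qed
      then have "F \<omega> = f (east.run w \<eta>)" unfolding F_def by (rule f[unfolded supp_in_def, THEN spec, THEN spec, THEN mp])
      then show ?case unfolding g_def gw_eq[OF finite_box h0 pos w] by (rule sym)
    qed
    then show ?case by (rule tendsto_eventually)
  qed
  have bound: "AE \<omega> in \<Omega>. \<bar>g B \<omega>\<bar> \<le> M" for B
    using AE_pos
  proof eventually_elim
    case (elim \<omega>)
    have M0: "0 \<le> M" using M[of "\<lambda>_. True"] by simp
    show ?case
    proof (cases "\<omega> \<in> S B")
      case True
      then obtain w where w: "w \<in> words (box B) (Ns B)" "\<omega> \<in> Ev (box B) (h B) w" unfolding S_def simple_def by blast
      show ?thesis unfolding g_def gw_eq[OF finite_box h0 elim w] by (rule M)
    next
      case False
      then have "g B \<omega> = 0" unfolding g_def S_def by (rule gw_eq_0)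
      with M0 show ?thesis by simp
    qed
  qed
  \<comment> \<open>Measurability of \<open>F\<close> for the completion comes from its almost sure
    equality with the limit of the measurable \<open>g B\<close>.\<close>
  have Fm: "F \<in> borel_measurable (completion \<Omega>)"
  proof (rule measurableI)
    fix A :: "real set" assume A: "A \<in> sets borel"
    define G where "G \<omega> = lim (\<lambda>B. g B \<omega>)" for \<omega>
    have G: "G \<in> borel_measurable \<Omega>" unfolding G_def by (rule borel_measurable_lim_metric[OF gm])
    have "AE \<omega> in \<Omega>. F \<omega> = G \<omega>" unfolding G_def using lim
    proof eventually_elim
      case (elim \<omega>)
      show ?case by (rule limI[OF elim, symmetric])
    qed
    then have "AE \<omega> in completion \<Omega>. F \<omega> = G \<omega>" by (rule AE_completion)
    then have "AE \<omega> in completion \<Omega>. \<omega> \<in> G -` A \<inter> space (completion \<Omega>) \<longleftrightarrow> \<omega> \<in> F -` A \<inter> space (completion \<Omega>)"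
    proof eventually_elim
      case (elim \<omega>)
      show ?case unfolding Int_iff vimage_eq elim by (rule refl)
    qed
    then show "F -` A \<inter> space (completion \<Omega>) \<in> sets (completion \<Omega>)"
      by (rule completion.in_sets_AE) (rule measurable_sets[OF measurable_completion[OF G] A] Int_lower2)+
  qed (unfold space_borel, rule UNIV_I)
  have "(\<lambda>B. \<integral>\<omega>. g B \<omega> \<partial>completion \<Omega>) \<longlonglongrightarrow> (\<integral>\<omega>. F \<omega> \<partial>completion \<Omega>)"
  proof (rule integral_dominated_convergence[where w = "\<lambda>_. M"])
    show "integrable (completion \<Omega>) (\<lambda>_. M)"
      using integrable_completion[of "\<lambda>_. M" \<Omega>] by simp
    show "AE \<omega> in completion \<Omega>. (\<lambda>B. g B \<omega>) \<longlonglongrightarrow> F \<omega>" by (rule AE_completion[OF lim])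
    show "AE \<omega> in completion \<Omega>. norm (g B \<omega>) \<le> M" for B using AE_completion[OF bound[of B]] by simp
    show "F \<in> borel_measurable (completion \<Omega>)" by (rule Fm)
    show "g B \<in> borel_measurable (completion \<Omega>)" for B by (rule measurable_completion[OF gm])
  qed
  moreover have "(\<integral>\<omega>. g B \<omega> \<partial>completion \<Omega>) = exp (- t) ^ card (box B) * WS (box B) (h B) (Ns B) (\<lambda>L. east.EE L \<eta> (\<lambda>tr. f (last tr)))" for B
    using integral_completion[OF gm[of B]] integral_gw[OF finite_box h0, of f \<eta> B B "Ns B"] by (simp add: g_def hN)
  ultimately have 1: "(\<lambda>B. exp (- t) ^ card (box B) * WS (box B) (h B) (Ns B) (\<lambda>L. east.EE L \<eta> (\<lambda>tr. f (last tr)))) \<longlonglongrightarrow> east_expect p \<eta> t f"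
    by (simp add: east_expect_def F_def[abs_def])
  have "(\<lambda>B. measure \<Omega> (S B)) \<longlonglongrightarrow> 1"
  proof (rule tendsto_sandwich)
    have "(\<lambda>B. 1 - (1/2 :: real) ^ B) \<longlonglongrightarrow> 1 - 0" by (intro tendsto_diff tendsto_const LIMSEQ_power_zero) simp
    then show "(\<lambda>B. 1 - (1/2 :: real) ^ B) \<longlonglongrightarrow> 1" by simp
    show "(\<lambda>_. 1 :: real) \<longlonglongrightarrow> 1" by (rule tendsto_const)
    show "\<forall>\<^sub>F B in sequentially. 1 - (1/2) ^ B \<le> measure \<Omega> (S B)" by (intro always_eventually allI less_imp_le mS)
    show "\<forall>\<^sub>F B in sequentially. measure \<Omega> (S B) \<le> 1" by (intro always_eventually allI prob_le_1)
  qed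
  then have 2: "(\<lambda>B. exp (- t) ^ card (box B) * (1 + h B * real (card (box B))) ^ Ns B) \<longlonglongrightarrow> 1"
    unfolding S_def measure_simple[OF finite_box h0] hN .
  show ?thesis
  proof (rule that[of Ns])
    show "0 < Ns B" for B by (rule N0)
    show "(\<lambda>B. exp (- t) ^ card (box B) * (1 + t / real (Ns B) * real (card (box B))) ^ Ns B) \<longlonglongrightarrow> 1"
      using 2 unfolding h_def .
    show "(\<lambda>B. exp (- t) ^ card (box B) * WS (box B) (t / real (Ns B)) (Ns B) (\<lambda>L. east.EE L \<eta> (\<lambda>tr. f (last tr)))) \<longlonglongrightarrow> east_expect p \<eta> t f"
      using 1 unfolding h_def .
  qed
qed

end

section \<open>Relaxation of local functions\<close>

lemma finite_supp_values:
  fixes f :: "('s \<Rightarrow> bool) \<Rightarrow> real"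
  assumes "finite L" "\<And>\<zeta> \<zeta>'. \<forall>x\<in>L. \<zeta> x = \<zeta>' x \<Longrightarrow> f \<zeta> = f \<zeta>'"
  shows "f \<eta> = (\<Sum>A\<in>Pow L. f (\<lambda>x. x \<in> A) * of_bool (\<forall>x\<in>L. \<eta> x = (x \<in> A)))"
proof -
  define A0 where "A0 = {x\<in>L. \<eta> x}"
  have "(\<Sum>A\<in>Pow L. f (\<lambda>x. x \<in> A) * of_bool (\<forall>x\<in>L. \<eta> x = (x \<in> A))) = (\<Sum>A\<in>Pow L. if A = A0 then f (\<lambda>x. x \<in> A0) else 0)"
  proof (rule sum.cong[OF refl])
    fix A assume "A \<in> Pow L"
    then have "(\<forall>x\<in>L. \<eta> x = (x \<in> A)) \<longleftrightarrow> A = A0" by (auto simp: A0_def)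
    then show "f (\<lambda>x. x \<in> A) * of_bool (\<forall>x\<in>L. \<eta> x = (x \<in> A)) = (if A = A0 then f (\<lambda>x. x \<in> A0) else 0)" by simp
  qed
  also have "\<dots> = f (\<lambda>x. x \<in> A0)" using assms(1) by (simp add: A0_def)
  also have "\<dots> = f \<eta>" by (rule assms(2)) (simp add: A0_def)
  finally show ?thesis by simp
qed

lemma prob_space_bern_prod: "prob_space (bern_prod p)"
  unfolding bern_prod_def by (rule prob_space_PiM) (rule prob_space_measure_pmf)

lemma measurable_bern_prod:
  fixes f :: "'d config \<Rightarrow> real"
  assumes "finite L" "\<And>\<zeta> \<zeta>'. \<forall>x\<in>L. \<zeta> x = \<zeta>' x \<Longrightarrow> f \<zeta> = f \<zeta>'"
  shows "f \<in> borel_measurable (bern_prod p)"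
proof -
  have coord: "(\<lambda>\<eta>. \<eta> x) \<in> bern_prod p \<rightarrow>\<^sub>M count_space UNIV" for x :: "'d site"
    unfolding bern_prod_def using measurable_component_singleton[of x UNIV "\<lambda>_. measure_pmf (bernoulli_pmf p)"] by simp
  have "Measurable.pred (bern_prod p) (\<lambda>\<eta>. \<forall>x\<in>L. \<eta> x = (x \<in> A))" for A
    using assms(1) coord by (intro pred_intros_finite pred_intros_logic) auto
  then have "(\<lambda>\<eta>. \<Sum>A\<in>Pow L. f (\<lambda>x. x \<in> A) * of_bool (\<forall>x\<in>L. \<eta> x = (x \<in> A))) \<in> borel_measurable (bern_prod p)"
    by (intro borel_measurable_sum borel_measurable_times borel_measurable_const) (simp add: measurable_of_bool)
  moreover have "f = (\<lambda>\<eta>. \<Sum>A\<in>Pow L. f (\<lambda>x. x \<in> A) * of_bool (\<forall>x\<in>L. \<eta> x = (x \<in> A)))"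
    by (rule ext, rule finite_supp_values[OF assms(1)], rule assms(2))
  ultimately show ?thesis by (rule ssubst[rotated])
qed

section \<open>Integrals under the product measure\<close>

context refresh
begin

text \<open>Overwriting the spin at \<open>x\<close> by an independent coin preserves the product
  measure; the identity is then Fubini's theorem.\<close>

lemma integral_av:
  fixes f :: "'d config \<Rightarrow> real"
  assumes L: "finite L" "\<And>\<zeta> \<zeta>'. \<forall>x\<in>L. \<zeta> x = \<zeta>' x \<Longrightarrow> f \<zeta> = f \<zeta>'" and M: "\<And>\<zeta>. \<bar>f \<zeta>\<bar> \<le> M"
  shows "(\<integral>\<eta>. f \<eta> \<partial>bern_prod p) = (\<integral>\<eta>. av x f \<eta> \<partial>bern_prod p)"
proof -
  let ?B = "measure_pmf (bernoulli_pmf p)"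
  interpret mu: prob_space "bern_prod p :: 'd config measure" by (rule prob_space_bern_prod)
  interpret B: prob_space ?B by (rule prob_space_measure_pmf)
  interpret pair_prob_space ?B "bern_prod p :: 'd config measure" ..
  have fm: "f \<in> borel_measurable (bern_prod p)" by (rule measurable_bern_prod[OF L])
  have d: "distr (?B \<Otimes>\<^sub>M bern_prod p) (bern_prod p) (\<lambda>(c, \<eta>). \<eta>(x := c)) = (bern_prod p :: 'd config measure)"
    unfolding bern_prod_def using distr_pair_PiM_eq_PiM[of UNIV "\<lambda>_. ?B" x] by (simp add: prob_space_measure_pmf)
  have um: "(\<lambda>(c, \<eta>). \<eta>(x := c)) \<in> (?B \<Otimes>\<^sub>M bern_prod p) \<rightarrow>\<^sub>M (bern_prod p :: 'd config measure)"
    unfolding bern_prod_def using measurable_add_dim[of x UNIV "\<lambda>_. ?B"] 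
      measurable_compose[OF measurable_pair_swap' measurable_add_dim[of x UNIV "\<lambda>_. ?B"]] by (simp add: case_prod_beta')
  have "(\<integral>\<eta>. f \<eta> \<partial>bern_prod p) = (\<integral>\<eta>. f \<eta> \<partial>distr (?B \<Otimes>\<^sub>M bern_prod p) (bern_prod p) (\<lambda>(c, \<eta>). \<eta>(x := c)))"
    by (simp only: d)
  also have "\<dots> = (\<integral>z. f ((snd z)(x := fst z)) \<partial>(?B \<Otimes>\<^sub>M bern_prod p))"
    by (subst integral_distr[OF um fm]) (simp add: case_prod_beta')
  also have "\<dots> = (\<integral>\<eta>. (\<integral>c. f (\<eta>(x := c)) \<partial>?B) \<partial>bern_prod p)"
  proof -
    have "integrable (?B \<Otimes>\<^sub>M bern_prod p) (\<lambda>z. f ((snd z)(x := fst z)))"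
    proof (rule P.integrable_const_bound[where B = M])
      show "(\<lambda>z. f ((snd z)(x := fst z))) \<in> borel_measurable (?B \<Otimes>\<^sub>M bern_prod p)"
        using measurable_compose[OF um fm] by (simp add: case_prod_beta')
    qed (use M in auto)
    then have "integrable (?B \<Otimes>\<^sub>M bern_prod p) (case_prod (\<lambda>c \<eta>. f (\<eta>(x := c))))" by (simp add: case_prod_beta')
    from integral_snd[OF this] show ?thesis by (simp add: case_prod_beta')
  qed
  also have "\<dots> = (\<integral>\<eta>. av x f \<eta> \<partial>bern_prod p)"
    using p0 p1 by (intro Bochner_Integration.integral_cong refl) (simp add: av_def)
  finally show ?thesis .
qed

lemma integral_avs:
  fixes f :: "'d config \<Rightarrow> real"
  assumes "\<And>\<zeta> \<zeta>'. \<forall>x\<in>set xs. \<zeta> x = \<zeta>' x \<Longrightarrow> f \<zeta> = f \<zeta>'" and "\<And>\<zeta>. \<bar>f \<zeta>\<bar> \<le> M"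
  shows "(\<integral>\<eta>. f \<eta> \<partial>bern_prod p) = avs xs f \<zeta>"
  using assms
proof (induction xs arbitrary: f)
  case Nil
  interpret mu: prob_space "bern_prod p :: 'd config measure" by (rule prob_space_bern_prod)
  have "f \<eta> = f \<zeta>" for \<eta> by (rule Nil(1)) simp
  then have "(\<integral>\<eta>. f \<eta> \<partial>bern_prod p) = (\<integral>\<eta>. f \<zeta> \<partial>(bern_prod p :: 'd config measure))"
    by (intro Bochner_Integration.integral_cong refl)
  then show ?case using mu.prob_space by simp
next
  case (Cons x xs)
  have "(\<integral>\<eta>. f \<eta> \<partial>bern_prod p) = (\<integral>\<eta>. av x f \<eta> \<partial>bern_prod p)"
    by (rule integral_av[of "set (x # xs)"]) (use Cons.prems in auto)
  also have "\<dots> = avs xs (av x f) \<zeta>"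
  proof (rule Cons.IH)
    show "av x f \<zeta> = av x f \<zeta>'" if "\<forall>z\<in>set xs. \<zeta> z = \<zeta>' z" for \<zeta> \<zeta>'
    proof -
      have "f (\<zeta>(x := b)) = f (\<zeta>'(x := b))" for b using that by (intro Cons.prems(1)) auto
      then show ?thesis by (simp add: av_def)
    qed
    show "\<bar>av x f \<zeta>\<bar> \<le> M" for \<zeta> by (rule av_abs_le[OF Cons.prems(2)])
  qed
  finally show ?case by simp
qed

end

section \<open>The estimate for one initial configuration\<close>

context east_dim
begin

lemma descending_append: "east.descending (as @ [y]) \<Longrightarrow> east.descending (y # bs) \<Longrightarrow> east.descending (as @ y # bs)"
proof (induction as)
  case (Cons a as)
  then show ?case by (cases as) auto
qed simp

lemma descending_sorted: "east.descending l \<Longrightarrow> sorted_wrt (\<lambda>a b. hgt b < hgt a) l"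
proof (induction l rule: east.descending.induct)
  case (1 x y \<gamma>)
  then have "hgt y < hgt x" by (simp add: east.rk_par)
  with 1 show ?case by fastforce
qed auto

lemma sorted_wrt_hgt_distinct: "sorted_wrt (\<lambda>a b. hgt b < hgt a) l \<Longrightarrow> distinct l"
  by (induction l) auto

lemma paths_descending: "\<gamma> \<in> east.paths k y \<Longrightarrow> east.descending \<gamma> \<and> (\<gamma> \<noteq> [] \<longrightarrow> hd \<gamma> = y)"
proof (induction k arbitrary: y \<gamma>)
  case (Suc k)
  then obtain y' \<gamma>' where \<gamma>: "\<gamma> = y # \<gamma>'" "y' \<in> epar y" "\<gamma>' \<in> east.paths k y'" by auto
  with Suc.IH[OF \<gamma>(3)] show ?case by (cases \<gamma>') auto
qed simp

text \<open>Any coordinate of \<open>x\<close> that exceeds the one of \<open>y\<close> may be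
  lowered; the coordinatewise order is kept, and the height measures the progress.\<close>

lemma ex_descending:
  assumes "\<forall>i. y i \<le> x i" "x \<noteq> (y :: 'd site)"
  shows "\<exists>\<pi>. east.descending (x # \<pi> @ [y]) \<and> int (length \<pi>) \<le> hgt x - hgt y"
  using assms
proof (induction "nat (hgt x - hgt y)" arbitrary: x rule: less_induct)
  case less
  obtain i where "x i \<noteq> y i" using less.prems(2) by (auto simp: fun_eq_iff)
  with less.prems have i: "y i < x i" by (metis order_neq_le_trans)
  let ?x = "shift_down x i"
  have le: "\<forall>j. y j \<le> ?x j" using less.prems i by (auto simp: shift_down_def)
  have par: "?x \<in> epar x" by (simp add: epar_def)
  have h: "hgt ?x = hgt x - 1" by (rule hgt_shift_down)
  have hy: "hgt y \<le> hgt ?x" unfolding hgt_def using le by (intro sum_mono) auto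
  show ?case
  proof (cases "?x = y")
    case True
    then show ?thesis using par h by (intro exI[of _ "[]"]) auto
  next
    case False
    have "nat (hgt ?x - hgt y) < nat (hgt x - hgt y)" using h hy by simp
    from less.hyps[OF this le False] obtain \<pi> where \<pi>: "east.descending (?x # \<pi> @ [y])" "int (length \<pi>) \<le> hgt ?x - hgt y" by blast
    then show ?thesis using par h by (intro exI[of _ "?x # \<pi>"]) auto
  qed
qed

lemma WS_diff: "WS X h N (\<lambda>L. F L - G L) = WS X h N F - WS X h N G"
  using WS_add[of X h N "\<lambda>L. F L - G L" G] by simp

lemma WS_sum_list: "WS X h N (\<lambda>L. \<Sum>x\<leftarrow>xs. F x L) = (\<Sum>x\<leftarrow>xs. WS X h N (F x))"
proof (induction xs)
  case Nil
  then show ?case using WS_scale[of X h N 0 "\<lambda>_. 0"] by simp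
qed (simp add: WS_add)

text \<open>Proved for each large box with schedules weighted by \<open>WS\<close>, then passed to
  the limit: resampling reduces the claim to one site, \<open>no_update_le\<close> to the paths, and
  \<open>WS_KK_le\<close> to the spectral gap.\<close>

lemma expect_bound:
  fixes f :: "'d config \<Rightarrow> real"
  assumes \<kappa>: "0 < \<kappa>" "\<kappa> \<le> 1"
    "\<And>n f. (\<And>i. n < i \<Longrightarrow> indep i f) \<Longrightarrow> 1 \<le> n \<Longrightarrow>
       \<kappa> * mean n (\<lambda>\<eta>. (f \<eta>)\<^sup>2) \<le> (\<Sum>i\<in>{1..n}. Dir n i f) + mean n (\<lambda>\<eta>. vac n \<eta> * (f \<eta>)\<^sup>2)"
    and \<Lambda>: "finite \<Lambda>" and f: "supp_in f \<Lambda>" and M: "\<And>\<zeta>. \<bar>f \<zeta>\<bar> \<le> M" and t: "0 < t" and k: "1 \<le> k"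
    and y: "\<not> \<eta> y" "\<And>x i. x \<in> \<Lambda> \<Longrightarrow> y i \<le> x i" "y \<notin> \<Lambda>" "\<And>x. x \<in> \<Lambda> \<Longrightarrow> hgt x - hgt y \<le> int m"
  shows "\<bar>east_expect p \<eta> t f - (\<integral>\<xi>. f \<xi> \<partial>bern_prod p)\<bar>
     \<le> 2 * M * real (card \<Lambda>) * (real CARD('d) ^ k * exp (- \<kappa> * t) / p ^ m + p ^ k)"
proof -
  have "\<exists>xs. set xs = \<Lambda> \<and> distinct xs \<and> sorted_wrt (\<lambda>x y. hgt y \<le> hgt x) xs"
  proof -
    obtain l where l: "set l = \<Lambda>" "distinct l" using finite_distinct_list[OF \<Lambda>] by blast
    have "sorted_wrt (\<lambda>x y. hgt x \<le> hgt y) (sort_key hgt l)"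
      using sorted_sort_key[of hgt l] by (simp add: sorted_wrt_map)
    then have "sorted_wrt (\<lambda>x y. hgt y \<le> hgt x) (rev (sort_key hgt l))" by (simp add: sorted_wrt_rev)
    then show ?thesis using l by (intro exI[of _ "rev (sort_key hgt l)"]) simp
  qed
  then obtain xs where xs: "set xs = \<Lambda>" "distinct xs" "sorted_wrt (\<lambda>x y. hgt y \<le> hgt x) xs" by blast
  have M0: "0 \<le> M" using M[of "\<lambda>_. True"] by simp
  have dep: "f \<zeta> = f \<zeta>'" if "\<forall>x\<in>set xs. \<zeta> x = \<zeta>' x" for \<zeta> \<zeta>' using f that xs(1) unfolding supp_in_def by blast
  define \<mu> where "\<mu> = (\<integral>\<xi>. f \<xi> \<partial>bern_prod p)"
  have \<mu>: "\<mu> = avs xs f \<eta>" unfolding \<mu>_def by (rule integral_avs[OF dep M])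
  have "\<exists>\<pi>. east.descending (x # \<pi> @ [y]) \<and> length \<pi> \<le> m" if "x \<in> \<Lambda>" for x
  proof -
    obtain \<pi> where "east.descending (x # \<pi> @ [y])" "int (length \<pi>) \<le> hgt x - hgt y"
      using ex_descending[of y x] y(2)[OF \<open>x \<in> \<Lambda>\<close>] y(3) \<open>x \<in> \<Lambda>\<close> by blast
    then show ?thesis using y(4)[OF that] by (intro exI[of _ \<pi>]) auto
  qed
  then obtain \<pi> where \<pi>: "east.descending (x # \<pi> x @ [y])" "length (\<pi> x) \<le> m" if "x \<in> \<Lambda>" for x by metis
  let ?P = "east.paths k y"
  have finP: "finite ?P" and cardP: "card ?P \<le> CARD('d) ^ k" using finite_card_paths by auto
  \<comment> \<open>Sites of all chains whose persistence will be estimated; \<open>WS_KK_le\<close>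
    needs them inside the box.\<close>
  define Y where "Y = (\<Union>x\<in>\<Lambda>. \<Union>\<gamma>\<in>?P. set (x # \<pi> x @ \<gamma>))"
  have Y: "finite Y" unfolding Y_def using \<Lambda> finP by auto
  obtain Ns :: "nat \<Rightarrow> nat" where N0: "\<And>B. 0 < Ns B"
    and l1: "(\<lambda>B. exp (- t) ^ card (box B) * (1 + t / real (Ns B) * real (card (box B))) ^ Ns B) \<longlonglongrightarrow> 1"
    and l2: "(\<lambda>B. exp (- t) ^ card (box B) * WS (box B) (t / real (Ns B)) (Ns B) (\<lambda>L. east.EE L \<eta> (\<lambda>tr. f (last tr)))) \<longlonglongrightarrow> east_expect p \<eta> t f"
    by (rule east_expect_limit[OF \<Lambda> f M t, where \<eta> = \<eta>]) blast
  \<comment> \<open>Bound, up to normalisation, for the probability that a given site of \<Lambda>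
    is not updated before time \<open>t\<close>.\<close>
  define R where "R = real CARD('d) ^ k * exp (- \<kappa> * t) / p ^ m + p ^ k"
  have main: "\<bar>exp (- t) ^ card (box B) * WS (box B) (t / real (Ns B)) (Ns B) (\<lambda>L. east.EE L \<eta> (\<lambda>tr. f (last tr)))
      - \<mu> * (exp (- t) ^ card (box B) * (1 + t / real (Ns B) * real (card (box B))) ^ Ns B)\<bar> \<le> 2 * M * real (card \<Lambda>) * R"
    if YB: "Y \<subseteq> box B" and ne: "box B \<noteq> {}" for B
  proof -
    define X where "X = box B"
    define N where "N = Ns B"
    define h where "h = t / real N"
    define e where "e = exp (- t) ^ card X"
    have X: "finite X" by (simp add: X_def finite_box)
    have h: "0 \<le> h" and hN: "h * real N = t" using t N0[of B] by (auto simp: h_def N_def)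
    have e0: "0 \<le> e" by (simp add: e_def)
    have eexp: "e * exp (real N * u) = exp (real N * u - t * real (card X))" for u
      by (simp add: e_def exp_of_nat_mult[symmetric] exp_add[symmetric] algebra_simps)
    have cX: "1 \<le> card X" using X ne by (simp add: X_def Suc_le_eq card_gt_0_iff)
    have up1: "e * (1 + h * real (card X)) ^ N \<le> 1"
    proof -
      have "(1 + h * real (card X)) ^ N \<le> exp (h * real (card X)) ^ N"
        using h by (intro power_mono exp_ge_add_one_self add_nonneg_nonneg mult_nonneg_nonneg) auto
      then have "e * (1 + h * real (card X)) ^ N \<le> e * exp (real N * (h * real (card X)))"
        using e0 by (intro mult_left_mono) (simp_all add: exp_of_nat_mult)
      also have "\<dots> = 1" unfolding eexp using hN by (simp add: algebra_simps)
      finally show ?thesis .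
    qed
    \<comment> \<open>The loss \<open>h *\<close> \<kappa> in each of \<open>N\<close> cells
      accumulates to \<kappa> \<open>t\<close> after normalisation, by 1 + u \<le> exp(u).\<close>
    have up2: "e * (1 + h * real (card X) - h * \<kappa>) ^ N \<le> exp (- \<kappa> * t)"
    proof -
      have a: "1 + h * real (card X) - h * \<kappa> = 1 + h * (real (card X) - \<kappa>)" by (simp add: algebra_simps)
      have "0 \<le> h * (real (card X) - \<kappa>)" using h cX \<kappa>(2) by (intro mult_nonneg_nonneg) auto
      then have "(1 + h * real (card X) - h * \<kappa>) ^ N \<le> exp (h * (real (card X) - \<kappa>)) ^ N"
        unfolding a by (intro power_mono exp_ge_add_one_self) auto
      then have "e * (1 + h * real (card X) - h * \<kappa>) ^ N \<le> e * exp (real N * (h * (real (card X) - \<kappa>)))"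
        using e0 by (intro mult_left_mono) (simp_all add: exp_of_nat_mult)
      also have "\<dots> = exp (- \<kappa> * t)" unfolding eexp using hN by (simp add: algebra_simps)
      finally show ?thesis .
    qed
    let ?NU = "\<lambda>x L. east.EE L \<eta> (\<lambda>tr. NU (rings x L) (east.facs x tr))"
    have one: "e * WS X h N (?NU x) \<le> R" if x: "x \<in> \<Lambda>" for x
    proof -
      let ?S = "\<lambda>\<gamma> L. KK (\<pi> x @ \<gamma>) L (NU (rings x L)) (replicate (Suc (length L)) True)"
      have pm: "0 < p ^ length (\<pi> x)" using p0 by simp
      have "WS X h N (?NU x) \<le> WS X h N (\<lambda>L. inverse (p ^ length (\<pi> x)) * (\<Sum>\<gamma>\<in>?P. ?S \<gamma> L) + p ^ k)"
      proof (rule WS_mono[OF h])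
        fix L
        show "?NU x L \<le> inverse (p ^ length (\<pi> x)) * (\<Sum>\<gamma>\<in>?P. ?S \<gamma> L) + p ^ k"
          using east.no_update_le[of x "\<pi> x" y \<eta> k L, OF \<pi>(1)[OF x] y(1) finP] unfolding divide_inverse_commute .
      qed
      also have "\<dots> = inverse (p ^ length (\<pi> x)) * (\<Sum>\<gamma>\<in>?P. WS X h N (?S \<gamma>)) + p ^ k * (1 + h * real (card X)) ^ N"
        by (simp only: WS_add WS_scale WS_sum WS_const)
      finally have "e * WS X h N (?NU x) \<le> e * (inverse (p ^ length (\<pi> x)) * (\<Sum>\<gamma>\<in>?P. WS X h N (?S \<gamma>)) + p ^ k * (1 + h * real (card X)) ^ N)"
        using e0 by (rule mult_left_mono)
      also have "\<dots> = inverse (p ^ length (\<pi> x)) * (\<Sum>\<gamma>\<in>?P. e * WS X h N (?S \<gamma>)) + p ^ k * (e * (1 + h * real (card X)) ^ N)"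
        by (simp add: algebra_simps sum_distrib_left)
      also have "\<dots> \<le> inverse (p ^ m) * (\<Sum>\<gamma>\<in>?P. exp (- \<kappa> * t)) + p ^ k * 1"
      proof (intro add_mono mult_mono sum_mono)
        show "inverse (p ^ length (\<pi> x)) \<le> inverse (p ^ m)"
          using p0 p1 \<pi>(2)[OF x] by (intro le_imp_inverse_le power_decreasing) auto
        fix \<gamma> assume \<gamma>: "\<gamma> \<in> ?P"
        have len: "length \<gamma> = k" by (rule length_paths[OF \<gamma>])
        \<comment> \<open>As \<open>k\<close> is positive, \<gamma> starts at \<open>y\<close> and
          can be attached to the path from \<open>x\<close> to \<open>y\<close>. The heights
          decrease along the whole path, so its sites are distinct.\<close>
        then obtain \<gamma>' where \<gamma>': "\<gamma> = y # \<gamma>'" using paths_descending[OF \<gamma>] k by (cases \<gamma>) auto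
        have "east.descending ((x # \<pi> x) @ y # \<gamma>')"
          by (rule descending_append) (use \<pi>(1)[OF x] paths_descending[OF \<gamma>] \<gamma>' in auto)
        then have "sorted_wrt (\<lambda>a b. hgt b < hgt a) (x # (\<pi> x @ \<gamma>))" unfolding \<gamma>' using descending_sorted by (metis append_Cons)
        then have dist: "distinct (x # (\<pi> x @ \<gamma>))"
          by (rule sorted_wrt_hgt_distinct)
        have "WS X h N (?S \<gamma>) \<le> (1 + h * real (card X) - h * \<kappa>) ^ N"
        proof (rule WS_KK_le[OF _ \<kappa>(2) X dist _ refl h])
          show "set (x # (\<pi> x @ \<gamma>)) \<subseteq> X" using YB x \<gamma> unfolding X_def Y_def by blast
          show "\<kappa> * mean (length (\<pi> x @ \<gamma>)) (\<lambda>\<eta>. (f \<eta>)\<^sup>2) \<le> (\<Sum>i\<in>{1..length (\<pi> x @ \<gamma>)}. Dir (length (\<pi> x @ \<gamma>)) i f) + mean (length (\<pi> x @ \<gamma>)) (\<lambda>\<eta>. vac (length (\<pi> x @ \<gamma>)) \<eta> * (f \<eta>)\<^sup>2)"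
            if "\<And>i. length (\<pi> x @ \<gamma>) < i \<Longrightarrow> indep i f" for f by (rule \<kappa>(3)[OF that]) (use len k in simp_all)
        qed
        then have "e * WS X h N (?S \<gamma>) \<le> e * (1 + h * real (card X) - h * \<kappa>) ^ N" using e0 by (rule mult_left_mono)
        with up2 show "e * WS X h N (?S \<gamma>) \<le> exp (- \<kappa> * t)" by linarith
      next
        show "0 \<le> (\<Sum>\<gamma>\<in>?P. e * WS X h N (?S \<gamma>))"
        proof (intro sum_nonneg mult_nonneg_nonneg e0)
          fix \<gamma>
          have c: "CM (Suc (length L)) (NU (rings x L))" for L using CM_NU[of "rings x L"] by (simp add: rings_def)
          have "WS X h N (\<lambda>_. 0) \<le> WS X h N (?S \<gamma>)"
            by (intro WS_mono[OF h] CM_nonneg[OF CM_KK[OF c]]) simp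
          then show "0 \<le> WS X h N (?S \<gamma>)" by (simp add: WS_const)
        qed
        show "0 \<le> e * (1 + h * real (card X)) ^ N" using e0 h by simp
      qed (use up1 p0 in auto)
      also have "\<dots> \<le> R"
      proof -
        have "inverse (p ^ m) * (real (card ?P) * exp (- \<kappa> * t)) \<le> inverse (p ^ m) * (real (CARD('d) ^ k) * exp (- \<kappa> * t))"
          using p0 cardP by (intro mult_left_mono mult_right_mono) (auto simp del: of_nat_power)
        then show ?thesis by (simp add: R_def divide_inverse mult_ac)
      qed
      finally show ?thesis .
    qed
    have "\<bar>e * WS X h N (\<lambda>L. east.EE L \<eta> (\<lambda>tr. f (last tr))) - \<mu> * (e * (1 + h * real (card X)) ^ N)\<bar>
       = e * \<bar>WS X h N (\<lambda>L. east.EE L \<eta> (\<lambda>tr. f (last tr)) - \<mu>)\<bar>"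
    proof -
      have "e * WS X h N (\<lambda>L. east.EE L \<eta> (\<lambda>tr. f (last tr))) - \<mu> * (e * (1 + h * real (card X)) ^ N)
        = e * WS X h N (\<lambda>L. east.EE L \<eta> (\<lambda>tr. f (last tr)) - \<mu>)"
        unfolding WS_diff WS_const by (simp add: algebra_simps)
      then show ?thesis using e0 by (simp add: abs_mult)
    qed
    also have "\<dots> \<le> e * (\<Sum>x\<leftarrow>xs. 2 * M * WS X h N (?NU x))"
    proof (intro mult_left_mono e0)
      let ?D = "\<lambda>L. \<Sum>x\<leftarrow>xs. 2 * M * ?NU x L"
      have b: "\<bar>east.EE L \<eta> (\<lambda>tr. f (last tr)) - \<mu>\<bar> \<le> ?D L" for L
        unfolding \<mu> by (rule east.EE_last_minus_avs[OF xs(3) dep M])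
      have "WS X h N (\<lambda>L. east.EE L \<eta> (\<lambda>tr. f (last tr)) - \<mu>) \<le> WS X h N ?D"
        using b by (intro WS_mono[OF h]) (auto intro: abs_le_D1)
      moreover have "WS X h N (\<lambda>L. - 1 * (east.EE L \<eta> (\<lambda>tr. f (last tr)) - \<mu>)) \<le> WS X h N ?D"
      proof (rule WS_mono[OF h])
        fix L
        show "- 1 * (east.EE L \<eta> (\<lambda>tr. f (last tr)) - \<mu>) \<le> ?D L" using abs_le_D2[OF b[of L]] by simp
      qed
      ultimately have "\<bar>WS X h N (\<lambda>L. east.EE L \<eta> (\<lambda>tr. f (last tr)) - \<mu>)\<bar> \<le> WS X h N ?D"
        unfolding WS_scale by simp
      then show "\<bar>WS X h N (\<lambda>L. east.EE L \<eta> (\<lambda>tr. f (last tr)) - \<mu>)\<bar> \<le> (\<Sum>x\<leftarrow>xs. 2 * M * WS X h N (?NU x))"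
        by (simp only: WS_sum_list WS_scale)
    qed
    also have "\<dots> = (\<Sum>x\<in>\<Lambda>. 2 * M * (e * WS X h N (?NU x)))"
      using xs by (simp add: sum_list_distinct_conv_sum_set sum_distrib_left mult_ac)
    also have "\<dots> \<le> (\<Sum>x\<in>\<Lambda>. 2 * M * R)"
      using M0 by (intro sum_mono mult_left_mono one) auto
    finally show ?thesis by (simp add: X_def N_def h_def e_def mult_ac)
  qed
  have "(\<lambda>B. \<bar>exp (- t) ^ card (box B) * WS (box B) (t / real (Ns B)) (Ns B) (\<lambda>L. east.EE L \<eta> (\<lambda>tr. f (last tr)))
      - \<mu> * (exp (- t) ^ card (box B) * (1 + t / real (Ns B) * real (card (box B))) ^ Ns B)\<bar>) \<longlonglongrightarrow> \<bar>east_expect p \<eta> t f - \<mu> * 1\<bar>"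
    by (intro tendsto_rabs tendsto_diff l2 tendsto_mult tendsto_const l1)
  moreover have "\<forall>\<^sub>F B in sequentially. \<bar>exp (- t) ^ card (box B) * WS (box B) (t / real (Ns B)) (Ns B) (\<lambda>L. east.EE L \<eta> (\<lambda>tr. f (last tr)))
      - \<mu> * (exp (- t) ^ card (box B) * (1 + t / real (Ns B) * real (card (box B))) ^ Ns B)\<bar> \<le> 2 * M * real (card \<Lambda>) * R"
    using eventually_subset_box[OF Y] eventually_subset_box[OF finite.insertI[OF finite.emptyI], of y]
  proof eventually_elim
    case (elim B)
    show ?case by (rule main) (use elim in auto)
  qed
  ultimately have "\<bar>east_expect p \<eta> t f - \<mu> * 1\<bar> \<le> 2 * M * real (card \<Lambda>) * R"
    by (rule tendsto_upperbound) simp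
  then show ?thesis by (simp add: \<mu>_def R_def)
qed

end

section \<open>Cardinality of the support and bounds by the sup norm\<close>

lemma finite_Lam: "finite (Lam r :: ('d::finite) site set)"
  and card_Lam: "0 \<le> r \<Longrightarrow> real (card (Lam r :: 'd site set)) \<le> (r + 1) ^ CARD('d)"
proof -
  let ?P = "PiE (UNIV :: 'd set) (\<lambda>_. {0..\<lfloor>r\<rfloor>})"
  have P: "finite ?P" by (intro finite_PiE) auto
  have sub: "(Lam r :: 'd site set) \<subseteq> ?P" by (auto simp: Lam_def)
  show "finite (Lam r :: 'd site set)" by (rule finite_subset[OF sub P])
  assume r: "0 \<le> r"
  have "card (Lam r :: 'd site set) \<le> card ?P" by (rule card_mono[OF P sub])
  also have "card ?P = nat (\<lfloor>r\<rfloor> + 1) ^ CARD('d)" by (simp add: card_PiE)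
  finally have "real (card (Lam r :: 'd site set)) \<le> real (nat (\<lfloor>r\<rfloor> + 1) ^ CARD('d))" by (rule of_nat_mono)
  also have "\<dots> = real (nat (\<lfloor>r\<rfloor> + 1)) ^ CARD('d)" by simp
  also have "\<dots> \<le> (r + 1) ^ CARD('d)"
  proof (rule power_mono)
    have "real (nat (\<lfloor>r\<rfloor> + 1)) = of_int \<lfloor>r\<rfloor> + 1" using r by simp
    then show "real (nat (\<lfloor>r\<rfloor> + 1)) \<le> r + 1" by linarith
  qed simp
  finally show "real (card (Lam r :: 'd site set)) \<le> (r + 1) ^ CARD('d)" .
qed

text \<open>A function with finite support takes finitely many values, so the supremum is over a
  bounded set.\<close>

lemma abs_le_sup_norm:
  assumes "supp_in f \<Lambda>" "finite \<Lambda>"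
  shows "\<bar>f \<eta>\<bar> \<le> sup_norm f"
proof -
  have "range f \<subseteq> (\<lambda>A. f (\<lambda>x. x \<in> A)) ` Pow \<Lambda>"
  proof
    fix v assume "v \<in> range f"
    then obtain \<zeta> where v: "v = f \<zeta>" by blast
    have "f \<zeta> = f (\<lambda>x. x \<in> {x\<in>\<Lambda>. \<zeta> x})"
      by (rule assms(1)[unfolded supp_in_def, THEN spec, THEN spec, THEN mp]) simp
    then show "v \<in> (\<lambda>A. f (\<lambda>x. x \<in> A)) ` Pow \<Lambda>" unfolding v by blast
  qed
  then have "finite (range f)" by (rule finite_subset) (simp add: assms(2))
  then have "finite (range (\<lambda>\<eta>. \<bar>f \<eta>\<bar>))" using finite_imageI[of "range f" abs] by (simp add: image_image)
  then show ?thesis unfolding sup_norm_def by (intro cSUP_upper bounded_imp_bdd_above finite_imp_bounded) simp_all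
qed

lemma abs_integral_le:
  fixes g :: "'a \<Rightarrow> real"
  assumes "prob_space M" "\<And>x. \<bar>g x\<bar> \<le> B"
  shows "\<bar>\<integral>x. g x \<partial>M\<bar> \<le> B"
proof (cases "integrable M g")
  case True
  interpret prob_space M by fact
  have b: "- B \<le> g x" "g x \<le> B" for x using assms(2)[of x] by auto
  have "(\<integral>x. g x \<partial>M) \<le> B" using b by (intro integral_le_const True) auto
  moreover have "- B \<le> (\<integral>x. g x \<partial>M)" using b by (intro integral_ge_const True) auto
  ultimately show ?thesis by (simp add: abs_le_iff)
next
  \<comment> \<open>The integral of a nonintegrable function is 0 by convention, and
    \<open>B\<close> is nonnegative.\<close>
  case False
  then show ?thesis using assms(2)[of undefined] by (simp add: not_integrable_integral_eq)
qed

section \<open>Choice of the constants and conclusion\<close>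

context east_dim
begin

lemma abs_east_expect_le:
  fixes f :: "'d config \<Rightarrow> real"
  assumes "\<And>\<zeta>. \<bar>f \<zeta>\<bar> \<le> M"
  shows "\<bar>east_expect p \<eta> t f\<bar> \<le> M"
  unfolding east_expect_def
  by (rule abs_integral_le[OF prob_space.prob_space_completion[OF prob_space_east_clocks] assms])

lemma expect_decay:
  obtains \<epsilon> C c where "0 < \<epsilon>" "0 < C" "0 < c"
    "\<And>t f \<eta> M. 1 \<le> t \<Longrightarrow> supp_in f (Lam (\<epsilon> * t powr (1 / real CARD('d))) :: 'd site set) \<Longrightarrow>
      (\<And>\<zeta>. \<bar>f \<zeta>\<bar> \<le> M) \<Longrightarrow> \<exists>y. (\<forall>i. - \<lfloor>\<epsilon> * t\<rfloor> \<le> y i \<and> y i \<le> 0) \<and> \<not> \<eta> y \<Longrightarrow>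
      \<bar>east_expect p \<eta> t f - (\<integral>\<xi>. f \<xi> \<partial>bern_prod p)\<bar> \<le> C * M * exp (- c * t)"
proof -
  define d where "d = real CARD('d)"
  define L where "L = - ln p"
  define D where "D = ln d"
  have "0 < CARD('d)" by (rule zero_less_card_finite)
  then have d1: "1 \<le> d" unfolding d_def by linarith
  have L0: "0 < L" and pL: "p = exp (- L)" using p0 p1 by (auto simp: L_def)
  have D0: "0 \<le> D" and dD: "d = exp D" using d1 by (auto simp: D_def)
  obtain \<kappa>0 where \<kappa>0: "0 < \<kappa>0" "\<And>n f. (\<And>i. n < i \<Longrightarrow> indep i f) \<Longrightarrow> 1 \<le> n \<Longrightarrow>
       \<kappa>0 * mean n (\<lambda>\<eta>. (f \<eta>)\<^sup>2) \<le> (\<Sum>i\<in>{1..n}. Dir n i f) + mean n (\<lambda>\<eta>. vac n \<eta> * (f \<eta>)\<^sup>2)"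
    using killed_coercive by blast
  define \<kappa> where "\<kappa> = min \<kappa>0 1"
  have \<kappa>: "0 < \<kappa>" "\<kappa> \<le> 1" using \<kappa>0(1) by (auto simp: \<kappa>_def)
  have \<kappa>c: "\<kappa> * mean n (\<lambda>\<eta>. (f \<eta>)\<^sup>2) \<le> (\<Sum>i\<in>{1..n}. Dir n i f) + mean n (\<lambda>\<eta>. vac n \<eta> * (f \<eta>)\<^sup>2)"
    if "\<And>i. n < i \<Longrightarrow> indep i f" "1 \<le> n" for n f
  proof -
    have "\<kappa> * mean n (\<lambda>\<eta>. (f \<eta>)\<^sup>2) \<le> \<kappa>0 * mean n (\<lambda>\<eta>. (f \<eta>)\<^sup>2)"
      by (intro mult_right_mono mean_nonneg) (auto simp: \<kappa>_def)
    with \<kappa>0(2)[OF that] show ?thesis by linarith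
  qed
  \<comment> \<open>The rate \<kappa> is shared out. The height difference is at most 2
    \<open>d\<close> \<epsilon> \<open>t\<close>, so \<epsilon> makes the factors
    \<open>1 / p\<close> cost \<kappa>/4; \<epsilon>\<open>2\<close> makes the number of paths cost
    \<kappa>/4, up to a factor \<open>d\<close> from rounding up \<open>k\<close>, with
    \<open>D + 1\<close> because \<open>D\<close> is 0 in dimension one. Half of \<kappa> remains,
    and \<open>L\<close> \<epsilon>\<open>2\<close> is the rate of \<open>p ^ k\<close>.\<close>
  define \<epsilon> where "\<epsilon> = \<kappa> / (8 * d * L)"
  define \<epsilon>2 where "\<epsilon>2 = \<kappa> / (4 * (D + 1))"
  define c where "c = min (\<kappa> / 2) (L * \<epsilon>2)"
  define C where "C = 2 * (\<epsilon> + 1) ^ CARD('d) * (2 / c) * (d + 1)"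
  have \<epsilon>0: "0 < \<epsilon>" using \<kappa> d1 L0 by (simp add: \<epsilon>_def)
  have \<epsilon>20: "0 < \<epsilon>2" using \<kappa> D0 by (simp add: \<epsilon>2_def)
  have c0: "0 < c" using \<kappa> L0 \<epsilon>20 by (simp add: c_def)
  have C0: "0 < C" using \<epsilon>0 c0 d1 by (simp add: C_def)
  have e1: "2 * d * L * \<epsilon> = \<kappa> / 4" using d1 L0 by (simp add: \<epsilon>_def field_simps)
  have e2: "D * \<epsilon>2 \<le> \<kappa> / 4"
  proof -
    have "D * \<epsilon>2 \<le> (D + 1) * \<epsilon>2" using \<epsilon>20 by (intro mult_right_mono) auto
    also have "\<dots> = \<kappa> / 4" using D0 by (simp add: \<epsilon>2_def field_simps)
    finally show ?thesis .
  qed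
  show ?thesis
  \<comment> \<open>Half of the rate is given up to absorb the factor \<open>t\<close> contributed
    by the cardinality of the support.\<close>
  proof (rule that[of \<epsilon> C "c / 2"])
    fix t :: real and f :: "'d config \<Rightarrow> real" and \<eta> :: "'d config" and M
    assume t: "1 \<le> t" and f: "supp_in f (Lam (\<epsilon> * t powr (1 / real CARD('d))))"
      and M: "\<And>\<zeta>. \<bar>f \<zeta>\<bar> \<le> M" and ex: "\<exists>y. (\<forall>i. - \<lfloor>\<epsilon> * t\<rfloor> \<le> y i \<and> y i \<le> 0) \<and> \<not> \<eta> y"
    obtain y where y: "\<And>i. - \<lfloor>\<epsilon> * t\<rfloor> \<le> y i" "\<And>i. y i \<le> 0" "\<not> \<eta> y" using ex by blast
    have M0: "0 \<le> M" using M[of "\<lambda>_. True"] by simp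
    define s where "s = t powr (1 / real CARD('d))"
    have s1: "1 \<le> s" unfolding s_def using t by (intro ge_one_powr_ge_zero) auto
    have st: "s \<le> t"
    proof -
      have "s \<le> t powr 1" unfolding s_def using t d1 by (intro powr_mono) (auto simp: d_def)
      then show ?thesis using t by simp
    qed
    \<comment> \<open>A support of side of order \<open>s\<close> has at most of order
      \<open>t\<close> sites.\<close>
    have sd: "s ^ CARD('d) = t"
      using t s1 d1 by (simp add: powr_realpow[symmetric] s_def powr_powr)
    define \<Lambda> :: "'d site set" where "\<Lambda> = Lam (\<epsilon> * s)"
    have \<Lambda>: "finite \<Lambda>" unfolding \<Lambda>_def by (rule finite_Lam)
    have fl: "\<lfloor>\<epsilon> * s\<rfloor> \<le> \<lfloor>\<epsilon> * t\<rfloor>" using st \<epsilon>0 by (intro floor_mono mult_left_mono) auto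
    have \<Lambda>x: "0 \<le> x i" "x i \<le> \<lfloor>\<epsilon> * t\<rfloor>" if "x \<in> \<Lambda>" for x i
      using that fl unfolding \<Lambda>_def Lam_def by (auto intro: order_trans)
    \<comment> \<open>In every coordinate a site of \<Lambda> and the zero \<open>y\<close> differ
      by at most twice the floor of \<epsilon> \<open>t\<close>.\<close>
    define m where "m = 2 * CARD('d) * nat \<lfloor>\<epsilon> * t\<rfloor>"
    define k where "k = nat \<lceil>\<epsilon>2 * t\<rceil>"
    have \<epsilon>t: "0 \<le> \<epsilon> * t" and \<epsilon>2t: "0 < \<epsilon>2 * t" using \<epsilon>0 \<epsilon>20 t by auto
    have m_le: "real m \<le> 2 * d * (\<epsilon> * t)"
    proof -
      have "real (nat \<lfloor>\<epsilon> * t\<rfloor>) \<le> \<epsilon> * t" using \<epsilon>t by simp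
      then show ?thesis unfolding m_def d_def by simp
    qed
    have k1: "1 \<le> k" and k_ge: "\<epsilon>2 * t \<le> real k" and k_le: "real k \<le> \<epsilon>2 * t + 1"
      using \<epsilon>2t unfolding k_def by linarith+
    have "\<bar>east_expect p \<eta> t f - (\<integral>\<xi>. f \<xi> \<partial>bern_prod p)\<bar>
        \<le> 2 * M * real (card \<Lambda>) * (real CARD('d) ^ k * exp (- \<kappa> * t) / p ^ m + p ^ k)"
    proof (rule expect_bound[where \<kappa> = \<kappa> and y = y and k = k and m = m])
      show "\<kappa> * mean n (\<lambda>\<eta>. (f \<eta>)\<^sup>2) \<le> (\<Sum>i\<in>{1..n}. Dir n i f) + mean n (\<lambda>\<eta>. vac n \<eta> * (f \<eta>)\<^sup>2)"
        if "\<And>i. n < i \<Longrightarrow> indep i f" "1 \<le> n" for n f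
        by (rule \<kappa>c[OF that])
      show "supp_in f \<Lambda>" using f unfolding \<Lambda>_def s_def .
      show "0 < t" using t by simp
      show "y i \<le> x i" if "x \<in> \<Lambda>" for x i using \<Lambda>x(1)[OF that, of i] y(2)[of i] by simp
      show "y \<notin> \<Lambda>"
      proof
        assume a: "y \<in> \<Lambda>"
        have "y = (\<lambda>_. 0)" using \<Lambda>x(1)[OF a] y(2) by (intro ext order_antisym) auto
        with a show False by (simp add: \<Lambda>_def Lam_def)
      qed
      show "hgt x - hgt y \<le> int m" if "x \<in> \<Lambda>" for x
      proof -
        have "hgt x - hgt y = (\<Sum>i\<in>UNIV. x i - y i)" by (simp add: hgt_def sum_subtractf)
        also have "\<dots> \<le> (\<Sum>i\<in>(UNIV :: 'd set). 2 * \<lfloor>\<epsilon> * t\<rfloor>)"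
        proof (rule sum_mono)
          fix i show "x i - y i \<le> 2 * \<lfloor>\<epsilon> * t\<rfloor>" using \<Lambda>x(2)[OF that, of i] y(1)[of i] by linarith
        qed
        also have "\<dots> = int m" using \<epsilon>t by (simp add: m_def)
        finally show ?thesis .
      qed
    qed (rule \<kappa> \<Lambda> M k1 y(3))+
    also have "\<dots> \<le> 2 * M * ((\<epsilon> + 1) ^ CARD('d) * t) * ((d + 1) * exp (- c * t))"
    proof (intro mult_mono mult_left_mono)
      have "real (card \<Lambda>) \<le> (\<epsilon> * s + 1) ^ CARD('d)" unfolding \<Lambda>_def using \<epsilon>0 s1 by (intro card_Lam) simp
      also have "\<dots> \<le> ((\<epsilon> + 1) * s) ^ CARD('d)" using \<epsilon>0 s1 by (intro power_mono) (auto simp: algebra_simps)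
      finally show "real (card \<Lambda>) \<le> (\<epsilon> + 1) ^ CARD('d) * t" by (simp add: power_mult_distrib sd)
      have "real CARD('d) ^ k = exp (D * real k)" unfolding d_def[symmetric] dD by (simp add: exp_of_nat_mult[symmetric] mult.commute)
      moreover have "1 / p ^ m = exp (L * real m)"
        unfolding pL by (simp add: exp_of_nat_mult[symmetric] mult.commute exp_minus inverse_eq_divide[symmetric] power_inverse)
      moreover have "real CARD('d) ^ k * exp (- \<kappa> * t) / p ^ m = real CARD('d) ^ k * (1 / p ^ m) * exp (- \<kappa> * t)" by simp
      ultimately have "real CARD('d) ^ k * exp (- \<kappa> * t) / p ^ m = exp (D * real k + L * real m - \<kappa> * t)"
        by (simp only: exp_add[symmetric]) simp
      also have "\<dots> \<le> exp (D + - c * t)"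
      proof -
        have "D * real k \<le> D * (\<epsilon>2 * t + 1)" using k_le D0 by (rule mult_left_mono)
        moreover have "D * (\<epsilon>2 * t + 1) = D * \<epsilon>2 * t + D" by (simp add: algebra_simps)
        moreover have "D * \<epsilon>2 * t \<le> \<kappa> / 4 * t" using e2 t by (intro mult_right_mono) auto
        moreover have "L * real m \<le> L * (2 * d * (\<epsilon> * t))" using m_le L0 by (intro mult_left_mono) auto
        moreover have "L * (2 * d * (\<epsilon> * t)) = \<kappa> / 4 * t" unfolding e1[symmetric] by (simp add: algebra_simps)
        moreover have "c * t \<le> \<kappa> / 2 * t" using t by (intro mult_right_mono) (auto simp: c_def)
        moreover have "\<kappa> * t = \<kappa> / 4 * t + \<kappa> / 4 * t + \<kappa> / 2 * t" by (simp add: algebra_simps)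
        ultimately have "D * real k + L * real m - \<kappa> * t \<le> D + - (c * t)" by linarith
        then show ?thesis by simp
      qed
      also have "\<dots> = d * exp (- c * t)" unfolding dD by (rule exp_add)
      finally have 1: "real CARD('d) ^ k * exp (- \<kappa> * t) / p ^ m \<le> d * exp (- c * t)" .
      have "p ^ k = exp (- (L * real k))" unfolding pL by (simp add: exp_of_nat_mult[symmetric] mult.commute)
      also have "\<dots> \<le> exp (- c * t)"
      proof -
        have "c * t \<le> L * \<epsilon>2 * t" using t by (intro mult_right_mono) (auto simp: c_def)
        moreover have "L * (\<epsilon>2 * t) \<le> L * real k" using k_ge L0 by (intro mult_left_mono) auto
        ultimately show ?thesis by (simp add: mult.assoc)
      qed
      finally show "real CARD('d) ^ k * exp (- \<kappa> * t) / p ^ m + p ^ k \<le> (d + 1) * exp (- c * t)"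
        using 1 by (simp add: algebra_simps)
    qed (use M0 \<epsilon>0 t p0 in auto)
    also have "\<dots> = 2 * M * (\<epsilon> + 1) ^ CARD('d) * (d + 1) * (t * exp (- c * t))" by (simp add: mult_ac)
    also have "\<dots> \<le> 2 * M * (\<epsilon> + 1) ^ CARD('d) * (d + 1) * (2 / c * exp (- (c / 2) * t))"
    proof (intro mult_left_mono)
      have "c / 2 * t \<le> exp (c / 2 * t)" using exp_ge_add_one_self[of "c / 2 * t"] by linarith
      then have "2 / c * (c / 2 * t) \<le> 2 / c * exp (c / 2 * t)" using c0 by (intro mult_left_mono) auto
      then have "t \<le> 2 / c * exp (c / 2 * t)" using c0 by simp
      then have "t * exp (- c * t) \<le> 2 / c * exp (c / 2 * t) * exp (- c * t)" by (rule mult_right_mono) simp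
      also have "\<dots> = 2 / c * exp (- (c / 2) * t)" by (simp add: exp_add[symmetric] mult.assoc)
      finally show "t * exp (- c * t) \<le> 2 / c * exp (- (c / 2) * t)" .
    qed (use M0 \<epsilon>0 d1 in auto)
    also have "\<dots> = C * M * exp (- (c / 2) * t)" by (simp add: C_def mult_ac)
    finally show "\<bar>east_expect p \<eta> t f - (\<integral>\<xi>. f \<xi> \<partial>bern_prod p)\<bar> \<le> C * M * exp (- (c / 2) * t)" .
  qed (use \<epsilon>0 C0 c0 in auto)
qed

end

theorem theorem1:
  fixes p :: real
  assumes "0 < p" and "p < 1"
  shows "\<exists>\<kappa>>0. \<forall>\<nu> :: ('d::finite) config measure.
           prob_space \<nu> \<and> sets \<nu> = sets config_space \<and> condition_C \<nu> \<longrightarrow>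
           (\<exists>c1>0. \<exists>C1>0. \<forall>t::real. \<forall>f :: 'd config \<Rightarrow> real.
              t \<ge> 0 \<and> supp_in f (Lam (\<kappa> * t powr (1 / real CARD('d)))) \<longrightarrow>
              (\<integral>\<eta>. \<bar>east_expect p \<eta> t f - (\<integral>\<xi>. f \<xi> \<partial>bern_prod p)\<bar> \<partial>\<nu>)
                \<le> C1 * sup_norm f * exp (- c1 * t))"
proof -
  interpret east_dim p "TYPE('d)" by unfold_locales (use assms in auto)
  \<comment> \<open>The same \<epsilon> scales the support and the negative box in which a zero is
    sought; it is fixed before the initial measure is given.\<close>
  obtain \<epsilon> C c where \<epsilon>: "0 < \<epsilon>" and C: "0 < C" and c: "0 < c"
    and dec: "\<And>t f \<eta> M. 1 \<le> t \<Longrightarrow> supp_in f (Lam (\<epsilon> * t powr (1 / real CARD('d))) :: 'd site set) \<Longrightarrow>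
      (\<And>\<zeta>. \<bar>f \<zeta>\<bar> \<le> M) \<Longrightarrow> \<exists>y. (\<forall>i. - \<lfloor>\<epsilon> * t\<rfloor> \<le> y i \<and> y i \<le> 0) \<and> \<not> \<eta> y \<Longrightarrow>
      \<bar>east_expect p \<eta> t f - (\<integral>\<xi>. f \<xi> \<partial>bern_prod p)\<bar> \<le> C * M * exp (- c * t)"
    by (rule expect_decay) blast
  have "\<exists>c1>0. \<exists>C1>0. \<forall>t::real. \<forall>f :: 'd config \<Rightarrow> real.
              t \<ge> 0 \<and> supp_in f (Lam (\<epsilon> * t powr (1 / real CARD('d)))) \<longrightarrow>
              (\<integral>\<eta>. \<bar>east_expect p \<eta> t f - (\<integral>\<xi>. f \<xi> \<partial>bern_prod p)\<bar> \<partial>\<nu>)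
                \<le> C1 * sup_norm f * exp (- c1 * t)"
    if "prob_space \<nu>" and sets: "sets \<nu> = sets config_space" and "condition_C \<nu>" for \<nu> :: "'d config measure"
  proof -
    interpret nu: prob_space \<nu> by fact
    obtain a A where a: "0 < a" and A: "0 < A"
      and CC: "\<And>l::real. 0 \<le> l \<Longrightarrow> measure \<nu> {\<eta>. \<forall>x. (\<forall>i. - \<lfloor>l\<rfloor> \<le> x i \<and> x i \<le> 0) \<longrightarrow> \<eta> x} \<le> A * exp (- a * l)"
      using \<open>condition_C \<nu>\<close> unfolding condition_C_def by blast
    \<comment> \<open>The slower of two rates: that of the probability of a box without zeros, and
      that of the relaxation when there is a zero.\<close>
    define c1 where "c1 = min (a * \<epsilon>) c"
    define C1 where "C1 = 2 * A + C + 2 * exp c1"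
    have c1: "0 < c1" using a \<epsilon> c by (simp add: c1_def)
    have C1: "0 < C1" using A C exp_gt_zero[of c1] by (simp add: C1_def add_pos_pos)
    have "(\<integral>\<eta>. \<bar>east_expect p \<eta> t f - (\<integral>\<xi>. f \<xi> \<partial>bern_prod p)\<bar> \<partial>\<nu>) \<le> C1 * sup_norm f * exp (- c1 * t)"
      if t: "0 \<le> t" and f: "supp_in f (Lam (\<epsilon> * t powr (1 / real CARD('d))))" for t and f :: "'d config \<Rightarrow> real"
    proof -
      define M where "M = sup_norm f"
      define G where "G \<eta> = \<bar>east_expect p \<eta> t f - (\<integral>\<xi>. f \<xi> \<partial>bern_prod p)\<bar>" for \<eta>
      have M: "\<bar>f \<zeta>\<bar> \<le> M" for \<zeta> unfolding M_def by (rule abs_le_sup_norm[OF f finite_Lam])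
      have M0: "0 \<le> M" using M[of "\<lambda>_. True"] by simp
      have G2: "G \<eta> \<le> 2 * M" for \<eta>
      proof -
        have "\<bar>east_expect p \<eta> t f\<bar> \<le> M" by (rule abs_east_expect_le[OF M])
        moreover have "\<bar>\<integral>\<xi>. f \<xi> \<partial>bern_prod p\<bar> \<le> M" by (rule abs_integral_le[OF prob_space_bern_prod M])
        ultimately show ?thesis unfolding G_def by linarith
      qed
      have G0: "0 \<le> G \<eta>" for \<eta> by (simp add: G_def)
      have "(\<integral>\<eta>. G \<eta> \<partial>\<nu>) \<le> C1 * M * exp (- c1 * t)"
      proof (cases "1 \<le> t")
        \<comment> \<open>For times below 1 the trivial bound suffices, with a factor
          exp(\<open>c1\<close>) in the constant.\<close>
        case False
        have "(\<integral>\<eta>. G \<eta> \<partial>\<nu>) \<le> 2 * M"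
          using abs_integral_le[OF \<open>prob_space \<nu>\<close>, of G "2 * M"] G2 G0 by (simp add: abs_le_iff)
        also have "\<dots> \<le> 2 * exp c1 * M * exp (- c1 * t)"
        proof -
          have "c1 * t \<le> c1 * 1" using False c1 by (intro mult_left_mono) auto
          then have "1 \<le> exp (c1 + - c1 * t)" by simp
          then have "2 * M * 1 \<le> 2 * M * exp (c1 + - c1 * t)" using M0 by (intro mult_left_mono) auto
          then show ?thesis by (simp add: exp_add exp_diff exp_minus field_simps)
        qed
        also have "\<dots> \<le> C1 * M * exp (- c1 * t)"
          using A C M0 by (intro mult_right_mono) (auto simp: C1_def)
        finally show ?thesis .
      next
        case True
        define Z where "Z = {\<eta> :: 'd config. \<forall>x. (\<forall>i. - \<lfloor>\<epsilon> * t\<rfloor> \<le> x i \<and> x i \<le> 0) \<longrightarrow> \<eta> x}"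
        have Zs: "Z \<in> sets \<nu>"
        proof -
          define X :: "'d site set" where "X = PiE UNIV (\<lambda>_. {- \<lfloor>\<epsilon> * t\<rfloor>..0})"
          have X: "finite X" unfolding X_def by (intro finite_PiE) auto
          have "(\<lambda>\<eta>. \<eta> x) \<in> config_space \<rightarrow>\<^sub>M count_space UNIV" for x :: "'d site"
            unfolding config_space_def by (rule measurable_component_singleton) simp
          then have "Measurable.pred config_space (\<lambda>\<eta> :: 'd config. \<forall>x\<in>X. \<eta> x)"
            using X by (intro pred_intros_finite)
          then have "{\<eta> \<in> space config_space. \<forall>x\<in>X. \<eta> x} \<in> sets (config_space :: 'd config measure)" by (rule predE)
          also have "{\<eta> \<in> space config_space. \<forall>x\<in>X. \<eta> x} = Z"
            by (auto simp: Z_def X_def config_space_def space_PiM PiE_UNIV_domain Pi_iff)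
          finally show ?thesis using sets by simp
        qed
        have Zm: "measure \<nu> Z \<le> A * exp (- a * (\<epsilon> * t))" unfolding Z_def using \<epsilon> t by (intro CC) simp
        have b: "G \<eta> \<le> 2 * M * indicator Z \<eta> + C * M * exp (- c * t)" for \<eta>
        proof (cases "\<eta> \<in> Z")
          case True
          have "0 \<le> C * M * exp (- c * t)" using C M0 by simp
          then show ?thesis using G2[of \<eta>] True by simp
        next
          case False
          then have "\<exists>y. (\<forall>i. - \<lfloor>\<epsilon> * t\<rfloor> \<le> y i \<and> y i \<le> 0) \<and> \<not> \<eta> y" unfolding Z_def by blast
          from dec[OF \<open>1 \<le> t\<close> f M this] show ?thesis using False by (simp add: G_def)
        qed
        have iZ: "integrable \<nu> (indicator Z :: _ \<Rightarrow> real)"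
          by (rule integrable_real_indicator[OF Zs]) (simp add: less_top[symmetric])
        have "(\<integral>\<eta>. G \<eta> \<partial>\<nu>) \<le> (\<integral>\<eta>. 2 * M * indicator Z \<eta> + C * M * exp (- c * t) \<partial>\<nu>)"
        \<comment> \<open>Only the dominating function has to be integrable here, so measurability
          of \<open>G\<close> in the initial configuration does not come up.\<close>
        proof (rule integral_mono')
          show "integrable \<nu> (\<lambda>\<eta>. 2 * M * indicator Z \<eta> + C * M * exp (- c * t))"
            by (intro Bochner_Integration.integrable_add integrable_mult_right iZ nu.integrable_const)
          show "0 \<le> 2 * M * indicator Z \<eta> + C * M * exp (- c * t)" for \<eta>
            using order_trans[OF G0 b] .
        qed (rule b)
        also have "\<dots> = 2 * M * measure \<nu> Z + C * M * exp (- c * t)"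
          using iZ Zs nu.prob_space by (subst Bochner_Integration.integral_add) auto
        also have "\<dots> \<le> 2 * M * (A * exp (- c1 * t)) + C * M * exp (- c1 * t)"
        proof (intro add_mono mult_left_mono)
          have "c1 * t \<le> a * \<epsilon> * t" using t by (intro mult_right_mono) (auto simp: c1_def)
          then have "A * exp (- a * (\<epsilon> * t)) \<le> A * exp (- c1 * t)" using A by (intro mult_left_mono) (auto simp: mult.assoc)
          with Zm show "measure \<nu> Z \<le> A * exp (- c1 * t)" by linarith
          have "c1 * t \<le> c * t" using t by (intro mult_right_mono) (auto simp: c1_def)
          then show "exp (- c * t) \<le> exp (- c1 * t)" by simp
        qed (use M0 C in auto)
        also have "\<dots> = (2 * A + C) * M * exp (- c1 * t)" by (simp add: algebra_simps)
        also have "\<dots> \<le> C1 * M * exp (- c1 * t)"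
          using M0 by (intro mult_right_mono) (auto simp: C1_def)
        finally show ?thesis .
      qed
      then show ?thesis unfolding G_def M_def .
    qed
    then show ?thesis using c1 C1 by blast
  qed
  then show ?thesis using \<epsilon> by blast
qed

end
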